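(* Let $\lambda\in\mathbf R$. The Rellich type theorem (RT) for the operator $\hat H^{D}-\lambda$ holds in each of the following cases: (1) $\boldsymbol\beta\in\mathbf B_0$ and $0<|\lambda|<\lambda_+$; (2) $\boldsymbol\beta\in\mathbf B_3$ and $0<|\lambda|<\lambda_+$; (3) $\boldsymbol\beta\in\mathbf B_{12}$ and $0<|\lambda|<\lambda_-$. That is, in each of these cases: if $\hat u\in\mathcal B_0^*(\mathbf Z^3;\mathbf C^6)$ satisfies $((\hat H^D-\lambda)\hat u)(n)=0$ for all $n$ outside a compact (finite) subset of $\mathbf Z^3$, then there is $R>0$ such that $\hat u(n)=0$ for all $n\in\mathbf Z^3$ with $|n|>R$.
   Context: Parameters: $\epsilon_1,\epsilon_2,\epsilon_3,\mu_1,\mu_2,\mu_3\in(0,\infty)$; $\boldsymbol\epsilon=\mathrm{diag}(\epsilon_1,\epsilon_2,\epsilon_3)$, $\boldsymbol\mu=\mathrm{diag}(\mu_1,\mu_2,\mu_3)$, also identified with vectors. $\boldsymbol\beta=(\beta_1,\beta_2,\beta_3)=\boldsymbol\epsilon\times\boldsymbol\mu$ (cross product), and $\alpha_i=(\epsilon_j\mu_k+\epsilon_k\mu_j)/2$ for $(i,j,k)$ a cyclic permutation of $(1,2,3)$. $\mathbf B_0=\{(0,0,0)\}$, $\mathbf B_3=\{\boldsymbol\beta\in\mathbf R^3:\beta_1\beta_2\beta_3\ne0\}$, $\mathbf B_{12}=\mathbf R^3\setminus(\mathbf B_0\cup\mathbf B_3)$. For $z\in[0,\infty)^3$: $\Psi_0(z)=\sum_i\alpha_iz_i$,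 $K_0(z)=\frac14\sum_{i=1}^3(\beta_iz_i)^2-\frac12\sum_{i<j}\beta_i\beta_jz_iz_j$ (which is $\ge 0$ there), $\tau^\pm(z)=\Psi_0(z)\pm\sqrt{K_0(z)}\ge0$, and $\lambda_\pm=\max_{z\in[0,1]^3}\sqrt{\tau^\pm(z)}$. Operators: for sequences on $\mathbf Z^3$ let $(\hat y_j\hat u)(n)=\frac1{2i}(\hat u(n+e_j)-\hat u(n-e_j))$ (this is multiplication by $y_j=\sin x_j$ under the Fourier convention $u(x)=(2\pi)^{-3/2}\sum_n e^{-in\cdot x}\hat u(n)$). The isotropic discrete Maxwell operator $\hat H_0$ acts on sequences $\hat u:\mathbf Z^3\to\mathbf C^6$ as the block matrix $\begin{pmatrix}0&\tilde M\\-\tilde M&0\end{pmatrix}$, $\tilde M=\begin{pmatrix}0&-\hat y_3&\hat y_2\\ \hat y_3&0&-\hat y_1\\-\hat y_2&\hat y_1&0\end{pmatrix}$. With $\hat D=\mathrm{diag}(\boldsymbol\epsilon,\boldsymbol\mu)$ ($6\times6$), the anisotropic operator is $\hat H^D=\hat D\hat H_0$. For $n\in\mathbf Z^3$, $|n|=\sum_j|n_j|$. $\mathcal B_0^*(\mathbf Z^3;\mathbf C^6)=\{\hat u:\mathbf Z^3\to\mathbf C^6:\ \lim_{R\to\infty}\frac1R\sum_{|n|<R}|\hat u(n)|^2=0\}$. *)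

theory Defs
  imports "HOL-Analysis.Analysis"
begin

text \<open>
  The parameters \<epsilon>, \<mu> are positive vectors of \<open>real^3\<close>.  \<open>cross3\<close> is the library's cross product.
  A diagonal \<open>3 \<times> 3\<close> matrix is represented by the vector of its diagonal entries.
\<close>

definition beta :: "real^3 \<Rightarrow> real^3 \<Rightarrow> real^3" where
  "beta \<epsilon> \<mu> = cross3 \<epsilon> \<mu>"

definition alpha :: "real^3 \<Rightarrow> real^3 \<Rightarrow> real^3" where
  "alpha \<epsilon> \<mu> = vector [(\<epsilon>$2 * \<mu>$3 + \<epsilon>$3 * \<mu>$2) / 2,
                       (\<epsilon>$3 * \<mu>$1 + \<epsilon>$1 * \<mu>$3) / 2,
                       (\<epsilon>$1 * \<mu>$2 + \<epsilon>$2 * \<mu>$1) / 2]"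

definition B0 :: "(real^3) set" where
  "B0 = {0}"

definition B3 :: "(real^3) set" where
  "B3 = {b. b$1 * b$2 * b$3 \<noteq> 0}"

definition B12 :: "(real^3) set" where
  "B12 = UNIV - (B0 \<union> B3)"

definition Psi0 :: "real^3 \<Rightarrow> real^3 \<Rightarrow> real^3 \<Rightarrow> real" where
  "Psi0 \<epsilon> \<mu> z = (\<Sum>i\<in>UNIV. alpha \<epsilon> \<mu> $ i * z$i)"

definition K0 :: "real^3 \<Rightarrow> real^3 \<Rightarrow> real^3 \<Rightarrow> real" where
  "K0 \<epsilon> \<mu> z = (let b = beta \<epsilon> \<mu> in
     1/4 * (\<Sum>i\<in>UNIV. (b$i * z$i)\<^sup>2)
     - 1/2 * (b$1 * b$2 * z$1 * z$2 + b$1 * b$3 * z$1 * z$3 + b$2 * b$3 * z$2 * z$3))"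

definition tau_plus :: "real^3 \<Rightarrow> real^3 \<Rightarrow> real^3 \<Rightarrow> real" where
  "tau_plus \<epsilon> \<mu> z = Psi0 \<epsilon> \<mu> z + sqrt (K0 \<epsilon> \<mu> z)"

definition tau_minus :: "real^3 \<Rightarrow> real^3 \<Rightarrow> real^3 \<Rightarrow> real" where
  "tau_minus \<epsilon> \<mu> z = Psi0 \<epsilon> \<mu> z - sqrt (K0 \<epsilon> \<mu> z)"

definition unit_cube :: "(real^3) set" where
  "unit_cube = {z. \<forall>i. 0 \<le> z$i \<and> z$i \<le> 1}"

text \<open>
  The maxima over the cube are written as suprema; \<open>lambda_plus_max\<close> and \<open>lambda_minus_max\<close>
  below show that they are attained.
\<close>

definition lambda_plus :: "real^3 \<Rightarrow> real^3 \<Rightarrow> real" where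
  "lambda_plus \<epsilon> \<mu> = (SUP z\<in>unit_cube. sqrt (tau_plus \<epsilon> \<mu> z))"

definition lambda_minus :: "real^3 \<Rightarrow> real^3 \<Rightarrow> real" where
  "lambda_minus \<epsilon> \<mu> = (SUP z\<in>unit_cube. sqrt (tau_minus \<epsilon> \<mu> z))"

lemma compact_unit_cube: "compact unit_cube"
proof -
  have "unit_cube = cbox 0 (1 :: real^3)"
    by (auto simp: unit_cube_def mem_box_cart)
  then show ?thesis by (metis compact_cbox)
qed

lemma zero_in_unit_cube: "0 \<in> unit_cube"
  by (simp add: unit_cube_def)

lemma SUP_unit_cube_attained:
  fixes f :: "real^3 \<Rightarrow> real"
  assumes "continuous_on unit_cube f"
  obtains z where "z \<in> unit_cube" "(SUP w\<in>unit_cube. f w) = f z" "\<forall>w\<in>unit_cube. f w \<le> f z"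
proof -
  obtain z where z: "z \<in> unit_cube" "\<forall>w\<in>unit_cube. f w \<le> f z"
    using continuous_attains_sup[OF compact_unit_cube _ assms] zero_in_unit_cube by blast
  have "(SUP w\<in>unit_cube. f w) = f z"
    using z by (intro cSup_eq_maximum) auto
  with z that show ?thesis by blast
qed

lemma lambda_plus_max:
  obtains z where "z \<in> unit_cube" "lambda_plus \<epsilon> \<mu> = sqrt (tau_plus \<epsilon> \<mu> z)"
    "\<forall>w\<in>unit_cube. sqrt (tau_plus \<epsilon> \<mu> w) \<le> sqrt (tau_plus \<epsilon> \<mu> z)"
proof -
  have "continuous_on unit_cube (\<lambda>z. sqrt (tau_plus \<epsilon> \<mu> z))"
    unfolding tau_plus_def Psi0_def K0_def Let_def by (intro continuous_intros)
  from SUP_unit_cube_attained[OF this] that show ?thesis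
    unfolding lambda_plus_def by metis
qed

lemma lambda_minus_max:
  obtains z where "z \<in> unit_cube" "lambda_minus \<epsilon> \<mu> = sqrt (tau_minus \<epsilon> \<mu> z)"
    "\<forall>w\<in>unit_cube. sqrt (tau_minus \<epsilon> \<mu> w) \<le> sqrt (tau_minus \<epsilon> \<mu> z)"
proof -
  have "continuous_on unit_cube (\<lambda>z. sqrt (tau_minus \<epsilon> \<mu> z))"
    unfolding tau_minus_def Psi0_def K0_def Let_def by (intro continuous_intros)
  from SUP_unit_cube_attained[OF this] that show ?thesis
    unfolding lambda_minus_def by metis
qed

text \<open>
  The fibre \<open>\<complex>\<^sup>6\<close> is split as \<open>\<complex>\<^sup>3 \<times> \<complex>\<^sup>3\<close>, following the block structure of the operators;
  the library norm on the product type is the Euclidean norm of \<open>\<complex>\<^sup>6\<close>.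
\<close>

type_synonym em_field = "int^3 \<Rightarrow> (complex^3) \<times> (complex^3)"

definition yhat :: "3 \<Rightarrow> (int^3 \<Rightarrow> complex) \<Rightarrow> int^3 \<Rightarrow> complex" where
  "yhat j f n = (f (n + axis j 1) - f (n - axis j 1)) / (2 * \<i>)"

definition Mtilde :: "(int^3 \<Rightarrow> complex^3) \<Rightarrow> int^3 \<Rightarrow> complex^3" where
  "Mtilde v n = vector
     [- yhat 3 (\<lambda>m. v m $ 2) n + yhat 2 (\<lambda>m. v m $ 3) n,
      yhat 3 (\<lambda>m. v m $ 1) n - yhat 1 (\<lambda>m. v m $ 3) n,
      - yhat 2 (\<lambda>m. v m $ 1) n + yhat 1 (\<lambda>m. v m $ 2) n]"

definition H0hat :: "em_field \<Rightarrow> em_field" where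
  "H0hat u n = (Mtilde (\<lambda>m. snd (u m)) n, - Mtilde (\<lambda>m. fst (u m)) n)"

definition Dhat :: "real^3 \<Rightarrow> real^3 \<Rightarrow> (complex^3) \<times> (complex^3) \<Rightarrow> (complex^3) \<times> (complex^3)" where
  "Dhat \<epsilon> \<mu> w = (\<chi> i. of_real (\<epsilon>$i) * fst w $ i, \<chi> i. of_real (\<mu>$i) * snd w $ i)"

definition HDhat :: "real^3 \<Rightarrow> real^3 \<Rightarrow> em_field \<Rightarrow> em_field" where
  "HDhat \<epsilon> \<mu> u n = Dhat \<epsilon> \<mu> (H0hat u n)"

definition l1norm :: "int^3 \<Rightarrow> int" where
  "l1norm n = (\<Sum>j\<in>UNIV. \<bar>n$j\<bar>)"

lemma finite_l1norm_ball: "finite {n. real_of_int (l1norm n) < R}"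
proof -
  let ?S = "{-\<lceil>R\<rceil>..\<lceil>R\<rceil>} :: int set"
  have "{n. real_of_int (l1norm n) < R} \<subseteq> (\<lambda>(a, b, c). vector [a, b, c] :: int^3) ` (?S \<times> ?S \<times> ?S)"
  proof
    fix n :: "int^3"
    assume "n \<in> {n. real_of_int (l1norm n) < R}"
    then have "\<bar>n$1\<bar> + \<bar>n$2\<bar> + \<bar>n$3\<bar> \<le> \<lceil>R\<rceil>"
      by (simp add: l1norm_def sum_3) linarith
    then have "(n$1, n$2, n$3) \<in> ?S \<times> ?S \<times> ?S" by auto
    moreover have "n = vector [n$1, n$2, n$3]"
      by (simp add: vec_eq_iff forall_3)
    ultimately show "n \<in> (\<lambda>(a, b, c). vector [a, b, c] :: int^3) ` (?S \<times> ?S \<times> ?S)"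
      by (auto intro!: image_eqI[where x = "(n$1, n$2, n$3)"])
  qed
  then show ?thesis by (rule finite_subset) simp
qed

definition B0star :: "em_field set" where
  "B0star = {u. ((\<lambda>R::real. 1 / R * (\<Sum>n | real_of_int (l1norm n) < R. (norm (u n))\<^sup>2)) \<longlongrightarrow> 0) at_top}"

text \<open>The Rellich type theorem (RT), as a property of an operator on sequences.\<close>

definition rellich_type :: "(em_field \<Rightarrow> em_field) \<Rightarrow> bool" where
  "rellich_type T \<longleftrightarrow>
     (\<forall>u\<in>B0star. (\<exists>F. finite F \<and> (\<forall>n. n \<notin> F \<longrightarrow> T u n = 0)) \<longrightarrow>
        (\<exists>R>0::real. \<forall>n. real_of_int (l1norm n) > R \<longrightarrow> u n = 0))"

end

theory Submission
  imports Defs "HOL-Library.Poly_Mapping"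
begin

text \<open>
  Eliminating the magnetic field and multiplying by an adjugate turns the system into scalar equations \<open>P v = g\<close>,
  where \<open>g\<close> has finite support and, up to a constant, \<open>P = \<lambda>\<^sup>4 - 2 \<lambda>\<^sup>2 \<Psi>\<^sub>0(z) + A(z) B(z)\<close> with \<open>A\<close>, \<open>B\<close>
  linear in \<open>z\<^sub>j = sin\<^sup>2 x\<^sub>j\<close>. If \<open>w\<close> satisfies \<open>\<Sum>\<^bsub>|n| < R\<^esub> |w(n)|\<^sup>2 = O(R)\<close>, a cutoff argument gives
  \<open>\<langle>v, P w\<rangle> = \<langle>g, w\<rangle>\<close> for every \<open>v\<close> in the space \<open>B\<^sub>0\<^sup>*\<close>. Such \<open>w\<close> are obtained from the discrete Fourier transform in two of
  the variables, with an arbitrary bounded dependence on the third, and are used twice.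

  With \<open>P w = 0\<close> they show that the symbol of \<open>g\<close> vanishes on an open part of the real zero set of \<open>P\<close>. Dividing
  by \<open>P\<close> in the third variable, where its leading coefficient is constant, yields \<open>g = P h\<close>: if some \<open>\<beta>\<^sub>j\<close> vanishes,
  \<open>P\<close> is a product of two factors linear in \<open>z\<close>, each with enough real zeros to kill the remainder; otherwise
  the remainder vanishes because the discriminant of \<open>P\<close> is not a square.

  With \<open>P w\<close> equal to a finitely supported sequence they show that \<open>P v = 0\<close> implies \<open>D v = 0\<close> for a nonzero \<open>D\<close> in one
  variable less. Iterating down to one variable gives \<open>v = 0\<close>; applied to \<open>v - h\<close> this proves the theorem.
\<close>

section \<open>Laurent polynomials acting on sequences\<close>

text \<open>The growth rate in the definition of the space is balanced at codimension one: waves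
  smeared over a surface have square sum \<open>O(R)\<close> on balls, a cutoff at scale
  \<open>R\<close> leaves a commutator of size \<open>1 / R\<close>, and Cauchy-Schwarz against the
  square sum \<open>o(R)\<close> of \<open>v\<close> makes the error \<open>o(1)\<close>. Every test
  sequence is a finite sum of explicit waves, so \<open>v\<close> itself is never Fourier
  transformed, and of the characteristic surface only continuous graphs are used; its singular
  points need no attention.

  The bounds on \<open>lam\<close> come from the factorization of the polynomial as
  \<open>(l - tau_plus) * (l - tau_minus)\<close> with \<open>l = lam^2\<close>. If
  \<open>K0\<close> is the square of a linear form, both factors are polynomials and the real zeros
  of one say nothing about the other, whence \<open>lambda_minus\<close>; for \<beta> = 0 the two
  factors agree. If no component of \<beta> vanishes, the sheets are conjugate and information on
  the sheet of \<open>tau_plus\<close> transfers to the other, whence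
  \<open>lambda_plus\<close>.\<close>

type_synonym laurent = "(int^3) \<Rightarrow>\<^sub>0 complex"

abbreviation "coef \<equiv> Poly_Mapping.lookup"
abbreviation "supp \<equiv> Poly_Mapping.keys"

definition act :: "laurent \<Rightarrow> (int^3 \<Rightarrow> complex) \<Rightarrow> int^3 \<Rightarrow> complex" where
  "act a u n = (\<Sum>m\<in>supp a. coef a m * u (n - m))"

lemma act_superset:
  assumes "finite S" "supp a \<subseteq> S"
  shows "act a u n = (\<Sum>m\<in>S. coef a m * u (n - m))"
  unfolding act_def using assms
  by (intro sum.mono_neutral_left) (auto simp: in_keys_iff)

lemma act_add: "act (a + b) u n = act a u n + act b u n"
proof -
  have "act c u n = (\<Sum>m\<in>supp a \<union> supp b. coef c m * u (n - m))"
    if "supp c \<subseteq> supp a \<union> supp b" for c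
    using that by (intro act_superset) auto
  from this[of a] this[of b] this[of "a + b"] show ?thesis
    by (simp add: keys_add lookup_add algebra_simps sum.distrib)
qed

lemma act_0 [simp]: "act 0 u n = 0"
  by (simp add: act_def)

lemma act_uminus: "act (- a) u n = - act a u n"
  using act_add[of a "- a" u n] by (simp add: add_eq_0_iff2 add.commute)

lemma act_diff: "act (a - b) u n = act a u n - act b u n"
  using act_add[of a "- b" u n] by (simp add: act_uminus)

lemma act_single [simp]: "act (Poly_Mapping.single m c) u n = c * u (n - m)"
  by (simp add: act_superset[of "{m}"])

lemma act_zero_right [simp]: "act a (\<lambda>n. 0) = (\<lambda>n. 0)"
  by (simp add: act_def fun_eq_iff)

lemma act_add_right: "act a (\<lambda>n. u n + v n) n = act a u n + act a v n"
  by (simp add: act_def sum.distrib algebra_simps)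

lemma act_diff_right: "act a (\<lambda>n. u n - v n) n = act a u n - act a v n"
  by (simp add: act_def sum_subtractf algebra_simps)

lemma act_scale_right: "act a (\<lambda>n. c * u n) n = c * act a u n"
  by (simp add: act_def sum_distrib_left mult_ac)

lemma act_sum_right: "act a (\<lambda>n. \<Sum>k\<in>A. f k n) n = (\<Sum>k\<in>A. act a (f k) n)"
proof -
  have "(\<Sum>m\<in>supp a. coef a m * (\<Sum>k\<in>A. f k (n - m)))
      = (\<Sum>m\<in>supp a. \<Sum>k\<in>A. coef a m * f k (n - m))"
    by (simp add: sum_distrib_left)
  then show ?thesis
    unfolding act_def by (subst sum.swap) simp
qed

lemma laurent_induct [case_names single add]:
  assumes "\<And>m c. P (Poly_Mapping.single m c)"
    and "\<And>a b. P a \<Longrightarrow> P b \<Longrightarrow> P (a + b)"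
  shows "P (a :: 'a \<Rightarrow>\<^sub>0 'b::monoid_add)"
proof (induction a rule: update_induct)
  case const
  show ?case using assms(1)[of undefined 0] by simp
next
  case (update f k v)
  have "Poly_Mapping.update k v f = f + Poly_Mapping.single k v"
    using update(1) by (intro poly_mapping_eqI)
      (auto simp: lookup_update lookup_add lookup_single in_keys_iff when_def)
  then show ?case using assms update by simp
qed

lemma act_mult: "act (a * b) u = act a (act b u)"
proof (induction a rule: laurent_induct)
  case (single m c)
  show ?case
  proof (induction b rule: laurent_induct)
    case (single m' c')
    show ?case by (simp add: mult_single fun_eq_iff algebra_simps)
  next
    case (add a b)
    then show ?case by (simp add: fun_eq_iff distrib_left act_add)
  qed
next
  case (add a b)
  then show ?case by (simp add: fun_eq_iff distrib_right act_add)
qed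

text \<open>A finitely supported sequence is \<open>coef g\<close>, and convolution applied to it is
  the ring product. This turns \<open>P v = g\<close> into a question of divisibility.\<close>

lemma coef_mult: "coef (a * b) = act a (coef b)"
proof (induction a rule: laurent_induct)
  case (single m c)
  show ?case
  proof (induction b rule: laurent_induct)
    case (single m' c')
    show ?case by (auto simp: mult_single fun_eq_iff lookup_single when_def algebra_simps)
  next
    case (add a b)
    then show ?case by (simp add: fun_eq_iff distrib_left lookup_add act_add_right algebra_simps)
  qed
next
  case (add a b)
  then show ?case by (simp add: fun_eq_iff distrib_right act_add lookup_add)
qed

definition const :: "complex \<Rightarrow> laurent" where
  "const c = Poly_Mapping.single 0 c"

lemma const_hom:
  "const (a + b) = const a + const b" "const (a * b) = const a * const b"
  "const (a - b) = const a - const b" "const (- a) = - const a"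
  "const 0 = 0" "const 1 = 1" "const (numeral k) = numeral k"
  by (simp_all add: const_def single_add mult_single single_diff single_uminus)

lemma act_const [simp]: "act (const c) u n = c * u n"
  by (simp add: const_def)

definition shift :: "3 \<Rightarrow> int \<Rightarrow> laurent" where
  "shift j k = Poly_Mapping.single (axis j k) 1"

lemma axis_add: "axis j (k + l) = axis j k + (axis j l :: int^3)"
  by (simp add: vec_eq_iff axis_def)

lemma shift_0 [simp]: "shift j 0 = 1"
  by (simp add: shift_def axis_def zero_vec_def[symmetric] flip: single_one)

lemma shift_add: "shift j (k + l) = shift j k * shift j l"
  by (simp add: shift_def mult_single axis_add)

lemma shift_inverse: "shift j k * shift j (- k) = 1"
  by (simp flip: shift_add)

lemma act_shift [simp]: "act (shift j k) u n = u (n - axis j k)"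
  by (simp add: shift_def)

definition yop :: "3 \<Rightarrow> laurent" where
  "yop j = const (1 / (2 * \<i>)) * (shift j (- 1) - shift j 1)"

definition zop :: "3 \<Rightarrow> laurent" where
  "zop j = const (1 / 4) * (2 - shift j 2 - shift j (- 2))"

lemma yop_square: "yop j * yop j = zop j"
proof -
  have "yop j * yop j = const (1 / (2 * \<i>)) * const (1 / (2 * \<i>)) *
      (shift j (- 1) * shift j (- 1) + shift j 1 * shift j 1 - 2 * (shift j 1 * shift j (- 1)))"
    unfolding yop_def by (simp add: algebra_simps)
  also have "const (1 / (2 * \<i>)) * const (1 / (2 * \<i>)) = - const (1 / 4)"
    by (simp flip: const_hom)
  also have "shift j (- 1) * shift j (- 1) = shift j (- 2)"
    by (simp flip: shift_add)
  also have "shift j 1 * shift j 1 = shift j 2"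
    by (simp flip: shift_add)
  finally show ?thesis
    by (simp add: shift_inverse zop_def algebra_simps)
qed

lemma act_yop: "act (yop j) u n = yhat j u n"
proof -
  have "axis j (- 1) = - (axis j 1 :: int^3)" by (simp add: vec_eq_iff axis_def)
  then show ?thesis
    by (simp add: yop_def act_mult act_diff yhat_def)
qed

lemma act_zop:
  "act (zop j) u n = (2 * u n - u (n - axis j 2) - u (n + axis j 2)) / 4"
proof -
  have "axis j (- 2) = - (axis j 2 :: int^3)" by (simp add: vec_eq_iff axis_def)
  moreover have "act (2 * a) u n = 2 * act a u n" for a
    using act_add[of a a u n] by (simp only: mult_2) 
  then have "act 2 u n = 2 * u n" using act_const[of 1 u n] by (metis const_hom(6) mult.right_neutral mult_1)
  ultimately show ?thesis
    by (simp add: zop_def act_mult act_diff)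
qed

section \<open>Plane waves and evaluation of symbols\<close>

definition mode :: "complex^3 \<Rightarrow> int^3 \<Rightarrow> complex" where
  "mode \<zeta> n = (\<Prod>i\<in>UNIV. \<zeta>$i powi (- n$i))"

text \<open>The negative exponents in \<open>mode\<close> turn translation by \<open>m\<close> into
  multiplication by the monomial with exponent \<open>m\<close>, so this is the value of the Laurent
  polynomial at \<open>\<zeta>\<close>.\<close>

definition ev :: "complex^3 \<Rightarrow> laurent \<Rightarrow> complex" where
  "ev \<zeta> a = act a (mode \<zeta>) 0"

lemma mode_add:
  assumes "\<And>i. \<zeta>$i \<noteq> 0"
  shows "mode \<zeta> (n + m) = mode \<zeta> n * mode \<zeta> m"
  using assms by (simp add: mode_def power_int_add[symmetric] prod.distrib[symmetric])

lemma mode_0 [simp]: "mode \<zeta> 0 = 1"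
  by (simp add: mode_def)

definition free :: "3 \<Rightarrow> laurent set" where
  "free c = {a. \<forall>m\<in>supp a. m$c = 0}"

lemma free_add [intro]: "a \<in> free c \<Longrightarrow> b \<in> free c \<Longrightarrow> a + b \<in> free c"
  using keys_add[of a b] by (auto simp: free_def)

lemma free_uminus [intro]: "a \<in> free c \<Longrightarrow> - a \<in> free c"
  by (auto simp: free_def in_keys_iff)

lemma free_diff [intro]: "a \<in> free c \<Longrightarrow> b \<in> free c \<Longrightarrow> a - b \<in> free c"
  using free_add[of a c "- b"] free_uminus[of b c] by simp

lemma free_mult [intro]: "a \<in> free c \<Longrightarrow> b \<in> free c \<Longrightarrow> a * b \<in> free c"
  using keys_mult[of a b] by (fastforce simp: free_def)

lemma free_const [simp, intro]: "const x \<in> free c"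
  by (auto simp: free_def const_def)

lemma free_numeral [simp, intro]: "numeral k \<in> free c" "0 \<in> free c" "1 \<in> free c"
  using free_const[of "numeral k" c] free_const[of 0 c] free_const[of 1 c]
  by (simp_all add: const_hom)

lemma free_shift [intro]: "j \<noteq> c \<Longrightarrow> shift j k \<in> free c"
  by (auto simp: free_def shift_def axis_def)

lemma free_zop [intro]: "j \<noteq> c \<Longrightarrow> zop j \<in> free c"
  unfolding zop_def by auto

text \<open>Translations that fix the coordinate \<open>c\<close> do not see the profile
  \<open>f\<close>, so a plane wave in two variables may carry any dependence on the third.\<close>

lemma act_free_mode:
  assumes "a \<in> free c" "\<And>i. \<zeta>$i \<noteq> 0"
  shows "act a (\<lambda>n. mode \<zeta> n * f (n$c)) n = ev \<zeta> a * (mode \<zeta> n * f (n$c))"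
proof -
  have "mode \<zeta> (n - m) = mode \<zeta> n * mode \<zeta> (- m)" for m
    using mode_add[OF assms(2), where n = n and m = "- m"] by simp
  then show ?thesis using assms(1)
    by (simp add: act_def ev_def sum_distrib_left sum_distrib_right free_def mult_ac)
qed

lemma act_mode:
  assumes "\<And>i. \<zeta>$i \<noteq> 0"
  shows "act a (mode \<zeta>) n = ev \<zeta> a * mode \<zeta> n"
proof -
  have "mode \<zeta> (n - m) = mode \<zeta> n * mode \<zeta> (- m)" for m
    using mode_add[OF assms, where n = n and m = "- m"] by simp
  then show ?thesis
    by (simp add: act_def ev_def sum_distrib_left sum_distrib_right mult_ac)
qed

lemma ev_mult:
  assumes "\<And>i. \<zeta>$i \<noteq> 0"
  shows "ev \<zeta> (a * b) = ev \<zeta> a * ev \<zeta> b"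
proof -
  have "act b (mode \<zeta>) = (\<lambda>n. ev \<zeta> b * mode \<zeta> n)"
    using act_mode[OF assms] by auto
  then have "ev \<zeta> (a * b) = act a (\<lambda>n. ev \<zeta> b * mode \<zeta> n) 0"
    by (simp add: ev_def[of _ "a * b"] act_mult)
  then show ?thesis
    by (simp add: act_scale_right ev_def[of _ a])
qed

lemma ev_hom [simp]:
  "ev \<zeta> (a + b) = ev \<zeta> a + ev \<zeta> b" "ev \<zeta> (a - b) = ev \<zeta> a - ev \<zeta> b"
  "ev \<zeta> (- a) = - ev \<zeta> a" "ev \<zeta> (const x) = x" "ev \<zeta> 0 = 0"
  by (simp_all add: ev_def act_add act_diff act_uminus)

lemma ev_numeral [simp]: "ev \<zeta> 1 = 1" "ev \<zeta> (numeral k) = numeral k"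
  using ev_hom(4)[of \<zeta> 1] ev_hom(4)[of \<zeta> "numeral k"] by (simp_all add: const_hom)

lemma ev_shift [simp]: "ev \<zeta> (shift j k) = \<zeta>$j powi k"
proof -
  have "\<zeta>$i powi (axis j k $ i) = (if i = j then \<zeta>$j powi k else 1)" for i
    by (auto simp: axis_def)
  then show ?thesis by (simp add: ev_def mode_def)
qed

lemma ev_zop:
  assumes "\<And>i. \<zeta>$i \<noteq> 0"
  shows "ev \<zeta> (zop j) = (2 - (\<zeta>$j)^2 - 1 / (\<zeta>$j)^2) / 4"
  by (simp add: zop_def ev_mult[OF assms] power_int_minus field_simps)

lemma ev_zop_cis:
  assumes "\<And>i. \<zeta>$i \<noteq> 0" "\<zeta>$j = cis t"
  shows "ev \<zeta> (zop j) = of_real ((sin t)^2)"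
proof -
  have sq: "(\<zeta>$j)^2 = cis (2 * t)"
    using assms(2) by (simp add: Complex.DeMoivre)
  have inv: "1 / cis (2 * t) = cis (- (2 * t))"
    by (metis cis_inverse inverse_eq_divide)
  show ?thesis
    unfolding ev_zop[OF assms(1)] sq inv by (simp add: complex_eq_iff cos_double_sin)
qed

lemma ev_free_cong:
  assumes "a \<in> free c" "\<And>i. i \<noteq> c \<Longrightarrow> \<zeta>$i = \<xi>$i"
  shows "ev \<zeta> a = ev \<xi> a"
proof -
  have "mode \<zeta> (- m) = mode \<xi> (- m)" if "m \<in> supp a" for m
    unfolding mode_def
  proof (rule prod.cong)
    fix i
    show "\<zeta> $ i powi - (- m) $ i = \<xi> $ i powi - (- m) $ i"
      using assms that by (cases "i = c") (auto simp: free_def)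
  qed auto
  then show ?thesis by (simp add: ev_def act_def)
qed

section \<open>The space of slowly growing sequences and its pairing\<close>

abbreviation l1ball :: "real \<Rightarrow> (int^3) set" where
  "l1ball R \<equiv> {n. real_of_int (l1norm n) < R}"

definition Bstar :: "(int^3 \<Rightarrow> complex) set" where
  "Bstar = {v. ((\<lambda>R::real. 1 / R * (\<Sum>n\<in>l1ball R. (cmod (v n))\<^sup>2)) \<longlongrightarrow> 0) at_top}"

lemma l1norm_nonneg: "0 \<le> l1norm n"
  by (simp add: l1norm_def sum_nonneg)

lemma l1norm_minus [simp]: "l1norm (- n) = l1norm n"
  by (simp add: l1norm_def)

lemma l1norm_triangle: "l1norm (n + m) \<le> l1norm n + l1norm m"
  unfolding l1norm_def sum.distrib[symmetric] by (intro sum_mono) simp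

lemma l1norm_diff: "l1norm n - l1norm m \<le> l1norm (n - m)"
  using l1norm_triangle[of "n - m" m] by simp

lemma l1norm_bound:
  assumes "finite S"
  obtains K where "K > 0" "\<And>m. m \<in> S \<Longrightarrow> real_of_int (l1norm m) \<le> K"
proof -
  have "real_of_int (l1norm m) \<le> (\<Sum>m\<in>S. real_of_int (l1norm m)) + 1" if "m \<in> S" for m
    using member_le_sum[of m S "\<lambda>m. real_of_int (l1norm m)"] that assms
    by (simp add: l1norm_nonneg)
  moreover have "(\<Sum>m\<in>S. real_of_int (l1norm m)) + 1 > 0"
    by (intro add_nonneg_pos sum_nonneg) (auto simp: l1norm_nonneg)
  ultimately show ?thesis using that by blast
qed

lemma Bstar_dominated:
  assumes "\<And>R. R > R0 \<Longrightarrow> (\<Sum>n\<in>l1ball R. (cmod (v n))\<^sup>2) \<le> S R"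
    and "((\<lambda>R::real. 1 / R * S R) \<longlongrightarrow> 0) at_top"
  shows "v \<in> Bstar"
  unfolding Bstar_def mem_Collect_eq
proof (rule tendsto_sandwich[OF _ _ tendsto_const assms(2)])
  show "\<forall>\<^sub>F R in at_top. 0 \<le> 1 / R * (\<Sum>n\<in>l1ball R. (cmod (v n))\<^sup>2)"
    using eventually_gt_at_top[of 0]
    by eventually_elim (simp add: sum_nonneg)
  show "\<forall>\<^sub>F R in at_top. 1 / R * (\<Sum>n\<in>l1ball R. (cmod (v n))\<^sup>2) \<le> 1 / R * S R"
    using eventually_gt_at_top[of "max 0 R0"]
    by eventually_elim (use assms(1) in \<open>simp add: divide_right_mono\<close>)
qed

lemma Bstar_add:
  assumes "u \<in> Bstar" "v \<in> Bstar"
  shows "(\<lambda>n. u n + v n) \<in> Bstar"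
proof (rule Bstar_dominated)
  fix R :: real
  have "(cmod (u n + v n))\<^sup>2 \<le> 2 * (cmod (u n))\<^sup>2 + 2 * (cmod (v n))\<^sup>2" for n
  proof -
    have "(cmod (u n + v n))\<^sup>2 \<le> (cmod (u n) + cmod (v n))\<^sup>2"
      by (intro power_mono norm_triangle_ineq) simp
    also have "\<dots> \<le> 2 * (cmod (u n))\<^sup>2 + 2 * (cmod (v n))\<^sup>2"
      using zero_le_power2[of "cmod (u n) - cmod (v n)"]
      by (simp add: power2_eq_square algebra_simps)
    finally show ?thesis .
  qed
  then show "(\<Sum>n\<in>l1ball R. (cmod (u n + v n))\<^sup>2) \<le>
      2 * (\<Sum>n\<in>l1ball R. (cmod (u n))\<^sup>2) + 2 * (\<Sum>n\<in>l1ball R. (cmod (v n))\<^sup>2)"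
    by (simp add: sum_distrib_left sum.distrib[symmetric] sum_mono)
next
  have "((\<lambda>R::real. 2 * (1 / R * (\<Sum>n\<in>l1ball R. (cmod (u n))\<^sup>2)) +
      2 * (1 / R * (\<Sum>n\<in>l1ball R. (cmod (v n))\<^sup>2))) \<longlongrightarrow> 2 * 0 + 2 * 0) at_top"
    using assms unfolding Bstar_def by (intro tendsto_intros) auto
  then show "((\<lambda>R. 1 / R * (2 * (\<Sum>n\<in>l1ball R. (cmod (u n))\<^sup>2) +
      2 * (\<Sum>n\<in>l1ball R. (cmod (v n))\<^sup>2))) \<longlongrightarrow> 0) at_top"
    by (simp add: algebra_simps)
qed

lemma Bstar_scale:
  assumes "u \<in> Bstar"
  shows "(\<lambda>n. c * u n) \<in> Bstar"
proof -
  have "((\<lambda>R::real. (cmod c)\<^sup>2 * (1 / R * (\<Sum>n\<in>l1ball R. (cmod (u n))\<^sup>2))) \<longlongrightarrow> (cmod c)\<^sup>2 * 0) at_top"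
    using assms unfolding Bstar_def by (intro tendsto_intros) auto
  then show ?thesis
    by (simp add: Bstar_def norm_mult power_mult_distrib sum_distrib_left mult_ac)
qed

lemma Bstar_shift:
  assumes "u \<in> Bstar"
  shows "(\<lambda>n. u (n - m)) \<in> Bstar"
proof (rule Bstar_dominated)
  fix R :: real
  let ?k = "real_of_int (l1norm m)"
  have "(\<Sum>n\<in>l1ball R. (cmod (u (n - m)))\<^sup>2) = (\<Sum>n\<in>(\<lambda>n. n - m) ` l1ball R. (cmod (u n))\<^sup>2)"
    by (subst sum.reindex) (auto simp: inj_on_def)
  also have "\<dots> \<le> (\<Sum>n\<in>l1ball (R + ?k). (cmod (u n))\<^sup>2)"
  proof (intro sum_mono2 finite_l1norm_ball)
    have "real_of_int (l1norm (n - m)) < R + ?k" if "real_of_int (l1norm n) < R" for n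
      using l1norm_triangle[of n "- m"] that by simp
    then show "(\<lambda>n. n - m) ` l1ball R \<subseteq> l1ball (R + ?k)"
      by blast
  qed simp
  finally show "(\<Sum>n\<in>l1ball R. (cmod (u (n - m)))\<^sup>2) \<le>
      (\<Sum>n\<in>l1ball (R + ?k). (cmod (u n))\<^sup>2)" .
next
  let ?k = "real_of_int (l1norm m)"
  let ?S = "\<lambda>R. \<Sum>n\<in>l1ball R. (cmod (u n))\<^sup>2"
  have "((\<lambda>R. 1 / R * ?S R) \<longlongrightarrow> 0) at_top"
    using assms by (simp add: Bstar_def)
  moreover have lim: "filterlim (\<lambda>R. R + ?k) at_top at_top"
    by (subst add.commute) (rule filterlim_tendsto_add_at_top[OF tendsto_const filterlim_ident])
  ultimately have "((\<lambda>R. 1 / (R + ?k) * ?S (R + ?k)) \<longlongrightarrow> 0) at_top"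
    by (rule filterlim_compose)
  moreover have "((\<lambda>R. 1 + ?k / R) \<longlongrightarrow> 1 + 0) at_top"
    by (intro tendsto_intros tendsto_divide_0[OF tendsto_const] filterlim_at_top_imp_at_infinity filterlim_ident)
  ultimately have "((\<lambda>R. 1 / (R + ?k) * ?S (R + ?k) * (1 + ?k / R)) \<longlongrightarrow> 0 * (1 + 0)) at_top"
    by (rule tendsto_mult)
  then have "((\<lambda>R. 1 / (R + ?k) * ?S (R + ?k) * (1 + ?k / R)) \<longlongrightarrow> 0) at_top"
    by simp
  then show "((\<lambda>R. 1 / R * ?S (R + ?k)) \<longlongrightarrow> 0) at_top"
  proof (rule Lim_transform_eventually)
    show "\<forall>\<^sub>F R in at_top. 1 / (R + ?k) * ?S (R + ?k) * (1 + ?k / R) = 1 / R * ?S (R + ?k)"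
      using eventually_gt_at_top[of 0]
    proof eventually_elim
      case (elim R)
      then have "R + ?k > 0" using l1norm_nonneg[of m] by linarith
      then have "1 / (R + ?k) * (1 + ?k / R) = 1 / R" using elim by (simp add: field_simps)
      moreover have "a * c * b = a' * c" if "a * b = a'" for a b a' c :: real
        using that by (metis mult.assoc mult.commute)
      ultimately show ?case by blast
    qed
  qed
qed

lemma Bstar_act:
  assumes "u \<in> Bstar"
  shows "act a u \<in> Bstar"
proof (induction a rule: laurent_induct)
  case (single m c)
  have "act (Poly_Mapping.single m c) u = (\<lambda>n. c * u (n - m))" by auto
  then show ?case using assms by (simp add: Bstar_scale Bstar_shift)
next
  case (add a b)
  have "act (a + b) u = (\<lambda>n. act a u n + act b u n)" by (auto simp: act_add)
  then show ?case using add by (simp add: Bstar_add)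
qed

lemma Bstar_coef: "coef a \<in> Bstar"
proof (rule Bstar_dominated)
  fix R :: real
  show "(\<Sum>n\<in>l1ball R. (cmod (coef a n))\<^sup>2) \<le> (\<Sum>n\<in>supp a. (cmod (coef a n))\<^sup>2)"
  proof -
    have "(\<Sum>n\<in>l1ball R. (cmod (coef a n))\<^sup>2) = (\<Sum>n\<in>l1ball R \<inter> supp a. (cmod (coef a n))\<^sup>2)"
      by (intro sum.mono_neutral_right finite_l1norm_ball) (auto simp: in_keys_iff)
    also have "\<dots> \<le> (\<Sum>n\<in>supp a. (cmod (coef a n))\<^sup>2)"
      by (intro sum_mono2) auto
    finally show ?thesis .
  qed
next
  have "((\<lambda>R. (\<Sum>n\<in>supp a. (cmod (coef a n))\<^sup>2) / R) \<longlongrightarrow> 0) at_top"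
    by (intro tendsto_divide_0[OF tendsto_const] filterlim_at_top_imp_at_infinity filterlim_ident)
  then show "((\<lambda>R. 1 / R * (\<Sum>n\<in>supp a. (cmod (coef a n))\<^sup>2)) \<longlongrightarrow> 0) at_top"
    by simp
qed

lemma Bstar_diff_coef:
  assumes "u \<in> Bstar"
  shows "(\<lambda>n. u n - coef a n) \<in> Bstar"
  using Bstar_add[OF assms Bstar_coef[of "- a"]] by simp

lemma Bstar_small:
  assumes "v \<in> Bstar" "\<delta> > 0"
  obtains R0 where "R0 > 0" "\<And>R. R \<ge> R0 \<Longrightarrow> (\<Sum>n\<in>l1ball R. (cmod (v n))\<^sup>2) \<le> \<delta> * R"
proof -
  have "\<forall>\<^sub>F R in at_top. dist (1 / R * (\<Sum>n\<in>l1ball R. (cmod (v n))\<^sup>2)) 0 < \<delta>"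
    using assms by (simp only: Bstar_def mem_Collect_eq tendsto_iff)
  then obtain R1 where R1: "\<And>R. R \<ge> R1 \<Longrightarrow> dist (1 / R * (\<Sum>n\<in>l1ball R. (cmod (v n))\<^sup>2)) 0 < \<delta>"
    by (auto simp: eventually_at_top_linorder)
  show ?thesis
  proof (rule that[of "max 1 R1"])
    fix R assume R: "max 1 R1 \<le> R"
    then have "1 / R * (\<Sum>n\<in>l1ball R. (cmod (v n))\<^sup>2) < \<delta>"
      using R1[of R] unfolding dist_real_def by linarith
    then show "(\<Sum>n\<in>l1ball R. (cmod (v n))\<^sup>2) \<le> \<delta> * R"
      using R by (simp add: field_simps)
  qed simp
qed

definition cutoff :: "real \<Rightarrow> int^3 \<Rightarrow> real" where
  "cutoff R n = max 0 (min 1 (2 - real_of_int (l1norm n) / R))"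

lemma cutoff_eq_1: "R > 0 \<Longrightarrow> real_of_int (l1norm n) \<le> R \<Longrightarrow> cutoff R n = 1"
  by (simp add: cutoff_def field_simps)

lemma cutoff_eq_0: "R > 0 \<Longrightarrow> real_of_int (l1norm n) \<ge> 2 * R \<Longrightarrow> cutoff R n = 0"
  by (simp add: cutoff_def field_simps)

lemma cutoff_lipschitz:
  assumes "R > 0"
  shows "\<bar>cutoff R (n - m) - cutoff R n\<bar> \<le> real_of_int (l1norm m) / R"
proof -
  have "\<bar>real_of_int (l1norm (n - m)) - real_of_int (l1norm n)\<bar> \<le> real_of_int (l1norm m)"
    using l1norm_diff[of n m] l1norm_triangle[of n "- m"] by simp
  then have "\<bar>real_of_int (l1norm (n - m)) / R - real_of_int (l1norm n) / R\<bar> \<le> real_of_int (l1norm m) / R"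
    using assms by (simp add: divide_right_mono flip: diff_divide_distrib)
  then show ?thesis unfolding cutoff_def by linarith
qed

text \<open>The cut-off sequence \<open>W\<close> has finite support, so commutativity of the ring
  moves \<open>P\<close> from \<open>W\<close> to \<open>v\<close> exactly. What remains,
  \<open>P W - d\<close>, is a commutator bounded by \<open>K / R\<close> times translates of
  \<open>|w|\<close>, and Cauchy-Schwarz with the square sums \<open>C R\<close> and
  \<open>3 \<delta> R\<close> bounds its pairing with \<open>v\<close> by a multiple of
  \<open>sqrt \<delta>\<close>, uniformly in \<open>R\<close>. The pairing is bilinear and is read
  off as a value at 0. Since the equation is required only on a ball and \<open>R0\<close> does not
  depend on \<open>w\<close>, the test sequence may vary with \<open>R\<close>.\<close>

lemma pairing:
  assumes v: "v \<in> Bstar" and Pv: "act P v = coef g" and "\<epsilon> > 0" and C: "C \<ge> 0"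
  obtains R0 where "R0 > 0"
    "\<And>R w. R \<ge> R0 \<Longrightarrow> (\<Sum>n\<in>l1ball (3 * R). (cmod (w n))\<^sup>2) \<le> C * R \<Longrightarrow>
       (\<And>n. n \<in> l1ball (3 * R) \<Longrightarrow> act P w n = coef d n) \<Longrightarrow>
       cmod (act d v 0 - act g w 0) \<le> \<epsilon>"
proof -
  obtain K where K: "K > 0"
    "\<And>m. m \<in> supp P \<union> supp g \<union> supp d \<Longrightarrow> real_of_int (l1norm m) \<le> K"
    using l1norm_bound[of "supp P \<union> supp g \<union> supp d"] by auto
  define nP where "nP = (\<Sum>m\<in>supp P. cmod (coef P m))"
  define X where "X = K * nP * sqrt (3 * C)"
  have "X \<ge> 0" unfolding X_def nP_def using K C by (simp add: sum_nonneg)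
  \<comment> \<open>Chosen so that the final bound is
    \<open>X * sqrt \<delta> = X * \<epsilon> / (X + 1)\<close>; the summand 1 covers
    \<open>X = 0\<close>.\<close>
  define \<delta> where "\<delta> = (\<epsilon> / (X + 1))\<^sup>2"
  have "\<delta> > 0" using \<open>\<epsilon> > 0\<close> \<open>X \<ge> 0\<close> by (simp add: \<delta>_def)
  obtain R1 where R1: "R1 > 0" "\<And>R. R \<ge> R1 \<Longrightarrow> (\<Sum>n\<in>l1ball R. (cmod (v n))\<^sup>2) \<le> \<delta> * R"
    using Bstar_small[OF v \<open>\<delta> > 0\<close>] by blast
  show ?thesis
  proof (rule that[of "max R1 K"])
    show "max R1 K > 0" using K by simp
    fix R w
    assume "R \<ge> max R1 K"
      and w: "(\<Sum>n\<in>l1ball (3 * R). (cmod (w n))\<^sup>2) \<le> C * R"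
      and Pw: "\<And>n. n \<in> l1ball (3 * R) \<Longrightarrow> act P w n = coef d n"
    then have R: "R \<ge> R1" "R \<ge> K" "R > 0" using K by auto
    define S where "S = l1ball (3 * R)"
    have finS: "finite S" unfolding S_def by (rule finite_l1norm_ball)
    define \<kappa> where "\<kappa> = (\<lambda>n. complex_of_real (cutoff R n))"
    define W where "W = Abs_poly_mapping (\<lambda>n. \<kappa> n * w n)"
    have "{n. \<kappa> n * w n \<noteq> 0} \<subseteq> l1ball (2 * R)"
      using cutoff_eq_0[OF \<open>R > 0\<close>] by (force simp: \<kappa>_def)
    then have fin: "finite {n. \<kappa> n * w n \<noteq> 0}"
      using finite_l1norm_ball finite_subset by blast
    have cW: "coef W n = \<kappa> n * w n" for n
      using fin by (simp add: W_def)
    have suppW: "supp W \<subseteq> l1ball (2 * R)"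
      using \<open>{n. \<kappa> n * w n \<noteq> 0} \<subseteq> l1ball (2 * R)\<close> by (auto simp: in_keys_iff cW)
    have \<kappa>1: "\<kappa> m = 1" "\<kappa> (- m) = 1" if "m \<in> supp P \<union> supp g \<union> supp d" for m
      using K(2)[OF that] R cutoff_eq_1[OF \<open>R > 0\<close>, of m] cutoff_eq_1[OF \<open>R > 0\<close>, of "- m"]
      by (auto simp: \<kappa>_def)
    have "act (P * W) v 0 = act W (act P v) 0"
      by (simp only: mult.commute[of P W] act_mult)
    also have "\<dots> = coef (g * W) 0"
      by (simp only: Pv mult.commute[of g W] coef_mult)
    also have "\<dots> = act g (coef W) 0"
      by (simp only: coef_mult)
    also have "\<dots> = act g w 0"
      by (simp add: act_def cW \<kappa>1)
    finally have gw: "act (P * W) v 0 = act g w 0" .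
    have "supp (P * W) \<subseteq> S"
    proof
      fix n assume "n \<in> supp (P * W)"
      then obtain a b where ab: "a \<in> supp P" "b \<in> supp W" "n = a + b"
        using keys_mult[of P W] by blast
      then have "real_of_int (l1norm a) \<le> K" "real_of_int (l1norm b) < 2 * R"
        using K(2) suppW by auto
      then show "n \<in> S"
        using l1norm_triangle[of a b] R unfolding S_def ab(3) mem_Collect_eq by linarith
    qed
    then have 1: "act (P * W) v 0 = (\<Sum>n\<in>S. coef (P * W) n * v (0 - n))"
      by (intro act_superset finS)
    have "supp d \<subseteq> S"
      using K(2) R unfolding S_def by fastforce
    then have 2: "act d v 0 = (\<Sum>n\<in>S. coef d n * v (0 - n))"
      by (intro act_superset finS)
    define e where "e = (\<lambda>n. coef (P * W) n - coef d n)"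
    define w' where "w' = (\<lambda>n. if n \<in> S then cmod (w n) else 0)"
    have e: "cmod (e n) \<le> (\<Sum>m\<in>supp P. cmod (coef P m) * (K / R) * w' (n - m))" if "n \<in> S" for n
    proof -
      \<comment> \<open>The cutoff is 1 on the support of \<open>d\<close>, so it may be inserted
        here and the difference becomes a commutator.\<close>
      have "coef d n = \<kappa> n * coef d n"
        using \<kappa>1[of n] by (cases "n \<in> supp d") (auto simp: in_keys_iff)
      also have "\<dots> = \<kappa> n * act P w n"
        using Pw that by (simp add: S_def)
      finally have "e n = act P (coef W) n - \<kappa> n * act P w n"
        by (simp add: e_def coef_mult)
      also have "\<dots> = (\<Sum>m\<in>supp P. coef P m * (\<kappa> (n - m) - \<kappa> n) * w (n - m))"
        by (simp add: act_def cW sum_distrib_left sum_subtractf[symmetric] algebra_simps)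
      also have "cmod \<dots> \<le> (\<Sum>m\<in>supp P. cmod (coef P m) * (K / R) * w' (n - m))"
      proof (rule sum_norm_le)
        fix m assume m: "m \<in> supp P"
        have dchi: "cmod (\<kappa> (n - m) - \<kappa> n) \<le> K / R"
        proof -
          have "cmod (\<kappa> (n - m) - \<kappa> n) = \<bar>cutoff R (n - m) - cutoff R n\<bar>"
            unfolding \<kappa>_def by (metis norm_of_real of_real_diff)
          also have "\<dots> \<le> real_of_int (l1norm m) / R" by (rule cutoff_lipschitz[OF \<open>R > 0\<close>])
          also have "\<dots> \<le> K / R" using K(2)[of m] m \<open>R > 0\<close> by (simp add: divide_right_mono)
          finally show ?thesis .
        qed
        show "cmod (coef P m * (\<kappa> (n - m) - \<kappa> n) * w (n - m)) \<le>
            cmod (coef P m) * (K / R) * w' (n - m)"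
        proof (cases "n - m \<in> S")
          case True
          have "cmod (coef P m) * cmod (\<kappa> (n - m) - \<kappa> n) * cmod (w (n - m)) \<le>
              cmod (coef P m) * (K / R) * cmod (w (n - m))"
            by (intro mult_right_mono mult_left_mono dchi norm_ge_zero)
          then show ?thesis
            by (simp only: w'_def True if_True norm_mult)
        next
          case False
          \<comment> \<open>Since \<open>|m| \<le> K \<le> R\<close>, both \<open>n\<close> and
            \<open>n - m\<close> lie beyond radius \<open>2 R\<close>, where the cutoff
            vanishes.\<close>
          then have big: "real_of_int (l1norm (n - m)) \<ge> 3 * R" by (simp add: S_def)
          have "real_of_int (l1norm m) \<le> R" using K(2)[of m] m R by simp
          then have "real_of_int (l1norm n) \<ge> 2 * R"
            using l1norm_triangle[of n "- m"] big by simp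
          then show ?thesis
            using big \<open>R > 0\<close> False by (simp add: \<kappa>_def cutoff_eq_0 w'_def)
        qed
      qed
      finally show ?thesis .
    qed
    have pair: "(\<Sum>n\<in>S. w' (n - m) * cmod (v (- n))) \<le> sqrt (C * R) * sqrt (\<delta> * (3 * R))" for m
    proof -
      have "(\<Sum>n\<in>S. w' (n - m) * cmod (v (- n))) = (\<Sum>n\<in>S. \<bar>w' (n - m)\<bar> * \<bar>cmod (v (- n))\<bar>)"
        by (intro sum.cong) (auto simp: w'_def)
      also have "\<dots> \<le> L2_set (\<lambda>n. w' (n - m)) S * L2_set (\<lambda>n. cmod (v (- n))) S"
        by (rule L2_set_mult_ineq)
      also have "\<dots> \<le> sqrt (C * R) * sqrt (\<delta> * (3 * R))"
      proof (rule mult_mono)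
        have "(\<Sum>n\<in>S. (w' (n - m))\<^sup>2) = (\<Sum>k\<in>(\<lambda>n. n - m) ` S. (w' k)\<^sup>2)"
          by (subst sum.reindex) (auto simp: inj_on_def)
        also have "\<dots> = (\<Sum>k\<in>(\<lambda>n. n - m) ` S \<inter> S. (w' k)\<^sup>2)"
          using finS by (intro sum.mono_neutral_right) (auto simp: w'_def)
        also have "\<dots> \<le> (\<Sum>k\<in>S. (w' k)\<^sup>2)"
          using finS by (intro sum_mono2) auto
        also have "\<dots> \<le> C * R"
          using w by (simp add: S_def w'_def)
        finally show "L2_set (\<lambda>n. w' (n - m)) S \<le> sqrt (C * R)"
          by (simp add: L2_set_def)
        have "(\<Sum>n\<in>S. (cmod (v (- n)))\<^sup>2) = (\<Sum>n\<in>S. (cmod (v n))\<^sup>2)"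
          by (rule sum.reindex_bij_witness[of _ uminus uminus]) (auto simp: S_def)
        also have "\<dots> \<le> \<delta> * (3 * R)"
          using R1(2)[of "3 * R"] R by (simp add: S_def)
        finally show "L2_set (\<lambda>n. cmod (v (- n))) S \<le> sqrt (\<delta> * (3 * R))"
          by (simp add: L2_set_def)
      qed (auto simp: R C \<open>R > 0\<close> less_imp_le)
      finally show ?thesis .
    qed
    have "cmod (act d v 0 - act g w 0) = cmod (\<Sum>n\<in>S. e n * v (- n))"
      unfolding gw[symmetric] 1 2 e_def
      by (subst norm_minus_commute) (simp add: sum_subtractf[symmetric] algebra_simps)
    also have "\<dots> \<le> (\<Sum>n\<in>S. cmod (e n) * cmod (v (- n)))"
      by (rule order_trans[OF norm_sum]) (simp add: norm_mult)
    also have "\<dots> \<le> (\<Sum>n\<in>S. (\<Sum>m\<in>supp P. cmod (coef P m) * (K / R) * w' (n - m)) * cmod (v (- n)))"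
      by (intro sum_mono mult_right_mono e) auto
    also have "\<dots> = (\<Sum>m\<in>supp P. cmod (coef P m) * (K / R) * (\<Sum>n\<in>S. w' (n - m) * cmod (v (- n))))"
      unfolding sum_distrib_left sum_distrib_right
      by (subst sum.swap) (simp add: mult_ac)
    also have "\<dots> \<le> (\<Sum>m\<in>supp P. cmod (coef P m) * (K / R) * (sqrt (C * R) * sqrt (\<delta> * (3 * R))))"
      using K R by (intro sum_mono mult_left_mono pair) auto
    also have "\<dots> = nP * (K / R) * (sqrt (C * R) * sqrt (\<delta> * (3 * R)))"
      by (simp only: nP_def sum_distrib_right)
    also have "sqrt (C * R) * sqrt (\<delta> * (3 * R)) = sqrt (3 * C) * R * sqrt \<delta>"
      using \<open>R > 0\<close> by (simp add: real_sqrt_mult)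
    also have "nP * (K / R) * (sqrt (3 * C) * R * sqrt \<delta>) = X * sqrt \<delta>"
      using \<open>R > 0\<close> by (simp add: X_def)
    also have "\<dots> = X * (\<epsilon> / (X + 1))"
      using \<open>\<epsilon> > 0\<close> \<open>X \<ge> 0\<close> by (simp add: \<delta>_def)
    also have "\<dots> \<le> \<epsilon>"
      using \<open>\<epsilon> > 0\<close> \<open>X \<ge> 0\<close> by (simp add: field_simps)
    finally show "cmod (act d v 0 - act g w 0) \<le> \<epsilon>" .
  qed
qed

section \<open>Finite superpositions of plane waves\<close>

lemma cis_orthogonality:
  assumes "k < N" "l < N"
  shows "(\<Sum>x<N. cis (- (2 * pi * (real k - real l) * real x / real N))) =
    (if k = l then of_nat N else 0)"
proof (cases "k = l")
  case False
  define z where "z = cis (- (2 * pi * (real k - real l) / real N))"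
  have pow: "cis (- (2 * pi * (real k - real l) * real x / real N)) = z ^ x" for x
    by (simp add: z_def Complex.DeMoivre mult_ac)
  have "z \<noteq> 1"
  proof
    assume "z = 1"
    then have "cos (2 * pi * (real k - real l) / real N) = 1"
      by (simp add: z_def complex_eq_iff)
    then obtain j :: int where "2 * pi * (real k - real l) / real N = of_int j * 2 * pi"
      by (auto simp: cos_one_2pi_int)
    then have "2 * pi * (real k - real l) = 2 * pi * (of_int j * real N)"
      using assms by (simp add: field_simps)
    then have "real k - real l = of_int j * real N"
      by (simp only: mult_cancel_left) simp
    then have "real_of_int (int k - int l) = real_of_int (j * int N)" by simp
    then have "int k - int l = j * int N" by (simp only: of_int_eq_iff)
    then have "int N dvd int k - int l" by simp
    moreover have "\<bar>int k - int l\<bar> < int N" "int k - int l \<noteq> 0" using assms False by auto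
    ultimately show False by (metis abs_of_nat dvd_imp_le_int not_le)
  qed
  moreover have "z ^ N = 1"
  proof -
    have "z ^ N = cis (2 * pi * of_int (int l - int k))"
    proof -
      have "real N * - (2 * pi * (real k - real l) / real N) = 2 * pi * of_int (int l - int k)"
        using assms by (simp add: field_simps)
      then show ?thesis by (simp only: z_def Complex.DeMoivre)
    qed
    then show ?thesis by (simp only: cis_multiple_2pi Ints_of_int)
  qed
  ultimately show ?thesis
    using False by (simp add: pow geometric_sum)
qed simp

lemma parseval_nat:
  "(\<Sum>x<N. (cmod (\<Sum>k<N. c k * cis (- (2 * pi * real k * real x / real N))))\<^sup>2) =
    real N * (\<Sum>k<N. (cmod (c k))\<^sup>2)"
proof -
  let ?e = "\<lambda>k x. cis (- (2 * pi * real k * real x / real N))"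
  have "complex_of_real (\<Sum>x<N. (cmod (\<Sum>k<N. c k * ?e k x))\<^sup>2) =
      (\<Sum>x<N. (\<Sum>k<N. c k * ?e k x) * cnj (\<Sum>l<N. c l * ?e l x))"
    by (simp only: of_real_sum complex_norm_square)
  also have "\<dots> = (\<Sum>x<N. \<Sum>k<N. \<Sum>l<N. c k * cnj (c l) *
      cis (- (2 * pi * (real k - real l) * real x / real N)))"
    by (simp add: sum_product cis_cnj cis_mult mult_ac diff_divide_distrib algebra_simps)
  also have "\<dots> = (\<Sum>k<N. \<Sum>l<N. c k * cnj (c l) *
      (\<Sum>x<N. cis (- (2 * pi * (real k - real l) * real x / real N))))"
    unfolding sum_distrib_left
    by (subst sum.swap, rule sum.cong[OF refl], rule sum.swap)
  also have "\<dots> = (\<Sum>k<N. \<Sum>l<N. c k * cnj (c l) * (if k = l then of_nat N else 0))"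
    by (intro sum.cong refl arg_cong2[where f = "(*)"] cis_orthogonality) auto
  also have "\<dots> = (\<Sum>k<N. c k * cnj (c k) * of_nat N)"
    by (simp add: if_distrib[of "\<lambda>x. _ * x"] cong: if_cong)
  also have "\<dots> = complex_of_real (real N * (\<Sum>k<N. (cmod (c k))\<^sup>2))"
    by (simp add: sum_distrib_left complex_norm_square mult_ac del: of_real_power)
  finally show ?thesis by (simp only: of_real_eq_iff)
qed

text \<open>A window of at most \<open>N\<close> consecutive integers lies in one period, and moving
  its left end to 0 only multiplies the coefficients by phases.\<close>

lemma parseval_window:
  assumes "2 * L + 1 \<le> N"
  shows "(\<Sum>n\<in>{- int L..int L}. (cmod (\<Sum>k<N. c k * cis (- (2 * pi * real k * of_int n / real N))))\<^sup>2)
    \<le> real N * (\<Sum>k<N. (cmod (c k))\<^sup>2)"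
proof -
  define c' where "c' = (\<lambda>k. c k * cis (2 * pi * real k * real L / real N))"
  have cc: "c k * cis (- (2 * pi * real k * of_int (int x - int L) / real N)) =
      c' k * cis (- (2 * pi * real k * real x / real N))" for k x
    by (simp add: c'_def mult.assoc cis_mult algebra_simps diff_divide_distrib)
  have sub: "{- int L..int L} \<subseteq> (\<lambda>x. int x - int L) ` {..<N}"
  proof
    fix n assume "n \<in> {- int L..int L}"
    then show "n \<in> (\<lambda>x. int x - int L) ` {..<N}"
      using assms by (intro image_eqI[where x = "nat (n + int L)"]) auto
  qed
  have "(\<Sum>n\<in>{- int L..int L}. (cmod (\<Sum>k<N. c k * cis (- (2 * pi * real k * of_int n / real N))))\<^sup>2)
      \<le> (\<Sum>n\<in>(\<lambda>x. int x - int L) ` {..<N}. (cmod (\<Sum>k<N. c k * cis (- (2 * pi * real k * of_int n / real N))))\<^sup>2)"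
    by (intro sum_mono2 sub) auto
  also have "\<dots> = (\<Sum>x<N. (cmod (\<Sum>k<N. c' k * cis (- (2 * pi * real k * real x / real N))))\<^sup>2)"
    by (subst sum.reindex) (simp_all add: inj_on_def cc del: of_int_diff)
  also have "\<dots> = real N * (\<Sum>k<N. (cmod (c k))\<^sup>2)"
    unfolding parseval_nat by (simp add: c'_def norm_mult)
  finally show ?thesis .
qed

lemma parseval_window2:
  assumes "2 * L + 1 \<le> N"
  shows "(\<Sum>n1\<in>{- int L..int L}. \<Sum>n2\<in>{- int L..int L}. (cmod (\<Sum>k1<N. \<Sum>k2<N. c k1 k2 *
      (cis (- (2 * pi * real k1 * of_int n1 / real N)) * cis (- (2 * pi * real k2 * of_int n2 / real N)))))\<^sup>2)
    \<le> (real N)\<^sup>2 * (\<Sum>k1<N. \<Sum>k2<N. (cmod (c k1 k2))\<^sup>2)"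
proof -
  let ?I = "{- int L..int L}"
  let ?e = "\<lambda>k n. cis (- (2 * pi * real k * of_int n / real N))"
  have "(\<Sum>n1\<in>?I. \<Sum>n2\<in>?I. (cmod (\<Sum>k1<N. \<Sum>k2<N. c k1 k2 * (?e k1 n1 * ?e k2 n2)))\<^sup>2)
     = (\<Sum>n2\<in>?I. \<Sum>n1\<in>?I. (cmod (\<Sum>k1<N. (\<Sum>k2<N. c k1 k2 * ?e k2 n2) * ?e k1 n1))\<^sup>2)"
    by (rule trans[OF sum.swap]) (simp add: sum_distrib_left sum_distrib_right mult_ac)
  also have "\<dots> \<le> (\<Sum>n2\<in>?I. real N * (\<Sum>k1<N. (cmod (\<Sum>k2<N. c k1 k2 * ?e k2 n2))\<^sup>2))"
    by (intro sum_mono parseval_window assms)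
  also have "\<dots> = real N * (\<Sum>k1<N. \<Sum>n2\<in>?I. (cmod (\<Sum>k2<N. c k1 k2 * ?e k2 n2))\<^sup>2)"
    by (subst sum.swap) (simp only: sum_distrib_left)
  also have "\<dots> \<le> real N * (\<Sum>k1<N. real N * (\<Sum>k2<N. (cmod (c k1 k2))\<^sup>2))"
    by (intro mult_left_mono sum_mono parseval_window assms) simp
  also have "\<dots> = (real N)\<^sup>2 * (\<Sum>k1<N. \<Sum>k2<N. (cmod (c k1 k2))\<^sup>2)"
    by (simp add: sum_distrib_left power2_eq_square mult_ac)
  finally show ?thesis .
qed

text \<open>A grid of mesh \<open>2 pi / N\<close> in the variables \<open>a\<close> and
  \<open>b\<close> with corner \<open>(\<theta>1, \<theta>2)\<close>. The remaining coordinate is 1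
  because \<open>wave\<close> carries that dependence in its profile; the factor
  \<open>1 / N^2\<close> there makes the sum a Riemann sum.\<close>

definition freq :: "3 \<Rightarrow> 3 \<Rightarrow> nat \<Rightarrow> real \<Rightarrow> real \<Rightarrow> nat \<Rightarrow> nat \<Rightarrow> complex^3" where
  "freq a b N \<theta>1 \<theta>2 k1 k2 = (\<chi> i. if i = a then cis (\<theta>1 + 2 * pi * real k1 / real N)
     else if i = b then cis (\<theta>2 + 2 * pi * real k2 / real N) else 1)"

definition wave :: "3 \<Rightarrow> 3 \<Rightarrow> 3 \<Rightarrow> nat \<Rightarrow> real \<Rightarrow> real \<Rightarrow> (nat \<Rightarrow> nat \<Rightarrow> int \<Rightarrow> complex) \<Rightarrow> int^3 \<Rightarrow> complex" where
  "wave a b c N \<theta>1 \<theta>2 f n = (\<Sum>k1<N. \<Sum>k2<N.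
     1 / (of_nat N)^2 * (mode (freq a b N \<theta>1 \<theta>2 k1 k2) n * f k1 k2 (n$c)))"

definition coords :: "3 \<Rightarrow> 3 \<Rightarrow> 3 \<Rightarrow> bool" where
  "coords a b c \<longleftrightarrow> a \<noteq> b \<and> b \<noteq> c \<and> a \<noteq> c"

lemma coords_UNIV:
  assumes "coords a b c"
  shows "(UNIV :: 3 set) = {a, b, c}"
  using assms by (intro card_subset_eq[symmetric]) (auto simp: coords_def)

lemma freq_nz [simp]: "freq a b N \<theta>1 \<theta>2 k1 k2 $ i \<noteq> 0"
  by (simp add: freq_def)

lemma cis_powi: "cis t powi k = cis (of_int k * t)"
  by (cases "k \<ge> 0") (auto simp: power_int_def Complex.DeMoivre cis_inverse)

lemma mode_freq:
  assumes "coords a b c" "N > 0"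
  shows "mode (freq a b N \<theta>1 \<theta>2 k1 k2) n = cis (- (\<theta>1 * of_int (n$a) + \<theta>2 * of_int (n$b))) *
    (cis (- (2 * pi * real k1 * of_int (n$a) / real N)) * cis (- (2 * pi * real k2 * of_int (n$b) / real N)))"
proof -
  have "a \<noteq> b" "b \<noteq> a" "b \<noteq> c" "c \<noteq> b" "a \<noteq> c" "c \<noteq> a"
    using assms(1) by (auto simp: coords_def)
  then show ?thesis
    unfolding mode_def coords_UNIV[OF assms(1)] using assms(2)
    by (simp add: freq_def cis_powi cis_mult algebra_simps)
qed

text \<open>On each slice with \<open>n$c\<close> fixed, Parseval gives at most
  \<open>N^2 * N^2 * (M / N^2)^2 = M^2\<close>, however large the window within a period. Only the
  number \<open>2 L + 1\<close> of slices grows, which is the rate \<open>O(R)\<close>, uniform in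
  \<open>N\<close>.\<close>

lemma wave_bound:
  assumes abc: "coords a b c" and N: "2 * L + 1 \<le> N" and \<rho>: "\<rho> \<le> real L + 1"
    and M: "\<And>k1 k2 m. cmod (f k1 k2 m) \<le> M"
  shows "(\<Sum>n\<in>l1ball \<rho>. (cmod (wave a b c N \<theta>1 \<theta>2 f n))\<^sup>2) \<le> (2 * real L + 1) * M\<^sup>2"
proof -
  let ?I = "{- int L..int L}"
  let ?e = "\<lambda>k n. cis (- (2 * pi * real k * of_int n / real N))"
  define g where "g = (\<lambda>m k1 k2. f k1 k2 m / (of_nat N)^2)"
  define W where "W = (\<lambda>m n1 n2. \<Sum>k1<N. \<Sum>k2<N. g m k1 k2 * (?e k1 n1 * ?e k2 n2))"
  define vec where "vec = (\<lambda>(m, n1, n2). (\<chi> i. if i = a then n1 else if i = b then n2 else m) :: int^3)"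
  have vec_nth: "vec (m, n1, n2) $ a = n1" "vec (m, n1, n2) $ b = n2" "vec (m, n1, n2) $ c = m" for m n1 n2
    using abc by (auto simp: vec_def coords_def)
  have inj: "inj_on vec X" for X
  proof (rule inj_onI)
    fix x y assume "vec x = vec y"
    then show "x = y"
      using vec_nth by (cases x; cases y) metis
  qed
  have sub: "l1ball \<rho> \<subseteq> vec ` (?I \<times> ?I \<times> ?I)"
  proof
    fix n :: "int^3" assume "n \<in> l1ball \<rho>"
    then have "real_of_int (\<bar>n$a\<bar> + \<bar>n$b\<bar> + \<bar>n$c\<bar>) < real L + 1"
      using \<rho> abc by (simp add: l1norm_def coords_UNIV[OF abc] coords_def)
    then have "\<bar>n$a\<bar> + \<bar>n$b\<bar> + \<bar>n$c\<bar> < int L + 1"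
      by linarith
    moreover have "n = vec (n$c, n$a, n$b)"
      using coords_UNIV[OF abc] by (auto simp: vec_def vec_eq_iff)
    ultimately show "n \<in> vec ` (?I \<times> ?I \<times> ?I)"
      by (intro image_eqI[where x = "(n$c, n$a, n$b)"]) auto
  qed
  have norm_wave: "cmod (wave a b c N \<theta>1 \<theta>2 f (vec (m, n1, n2))) = cmod (W m n1 n2)" for m n1 n2
  proof -
    have "wave a b c N \<theta>1 \<theta>2 f (vec (m, n1, n2)) = cis (- (\<theta>1 * of_int n1 + \<theta>2 * of_int n2)) * W m n1 n2"
      using N by (simp add: wave_def W_def g_def mode_freq[OF abc] vec_nth sum_distrib_left mult_ac)
    then show ?thesis by (simp add: norm_mult)
  qed
  have "(\<Sum>n\<in>l1ball \<rho>. (cmod (wave a b c N \<theta>1 \<theta>2 f n))\<^sup>2) \<le>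
      (\<Sum>n\<in>vec ` (?I \<times> ?I \<times> ?I). (cmod (wave a b c N \<theta>1 \<theta>2 f n))\<^sup>2)"
    by (intro sum_mono2 sub) auto
  also have "\<dots> = (\<Sum>(m, n1, n2)\<in>?I \<times> ?I \<times> ?I. (cmod (W m n1 n2))\<^sup>2)"
    by (subst sum.reindex[OF inj]) (auto simp: norm_wave intro!: sum.cong)
  also have "\<dots> = (\<Sum>m\<in>?I. \<Sum>n1\<in>?I. \<Sum>n2\<in>?I. (cmod (W m n1 n2))\<^sup>2)"
    by (simp add: sum.cartesian_product)
  also have "\<dots> \<le> (\<Sum>m\<in>?I. M\<^sup>2)"
  proof (rule sum_mono)
    fix m
    have "(\<Sum>n1\<in>?I. \<Sum>n2\<in>?I. (cmod (W m n1 n2))\<^sup>2) \<le> (real N)\<^sup>2 * (\<Sum>k1<N. \<Sum>k2<N. (cmod (g m k1 k2))\<^sup>2)"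
      unfolding W_def by (rule parseval_window2[OF N])
    also have "\<dots> \<le> (real N)\<^sup>2 * (\<Sum>k1<N. \<Sum>k2<N. M\<^sup>2 / (real N)^4)"
    proof (intro mult_left_mono sum_mono)
      fix k1 k2
      have "(cmod (g m k1 k2))\<^sup>2 = (cmod (f k1 k2 m))\<^sup>2 / (real N)^4"
        by (simp add: g_def norm_divide norm_power power_divide flip: power_mult)
      also have "\<dots> \<le> M\<^sup>2 / (real N)^4"
        by (intro divide_right_mono power_mono M) auto
      finally show "(cmod (g m k1 k2))\<^sup>2 \<le> M\<^sup>2 / (real N)^4" .
    qed simp
    also have "\<dots> = M\<^sup>2"
      using N by (simp add: field_simps power2_eq_square power4_eq_xxxx)
    finally show "(\<Sum>n1\<in>?I. \<Sum>n2\<in>?I. (cmod (W m n1 n2))\<^sup>2) \<le> M\<^sup>2" .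
  qed
  also have "\<dots> = (2 * real L + 1) * M\<^sup>2" by simp
  finally show ?thesis .
qed

text \<open>Among the data of the wave the threshold depends on \<open>M\<close> alone, so grid and
  profiles can be chosen after it. Within radius \<open>3 R\<close> each axis has at most
  \<open>6 R + 1 \<le> 9 R\<close> points, which explains both the constant in the bound and the
  condition on \<open>N\<close>.\<close>

lemma wave_pairing:
  assumes v: "v \<in> Bstar" "act P v = coef g" and "\<epsilon> > 0" and "M \<ge> 0"
  obtains R0 where "R0 \<ge> 1"
    "\<And>R a b c N \<theta>1 \<theta>2 f. R \<ge> R0 \<Longrightarrow> real N \<ge> 9 * R \<Longrightarrow> coords a b c \<Longrightarrow>
       (\<And>k1 k2 m. cmod (f k1 k2 m) \<le> M) \<Longrightarrow>
       (\<And>n. n \<in> l1ball (3 * R) \<Longrightarrow> act P (wave a b c N \<theta>1 \<theta>2 f) n = coef d n) \<Longrightarrow>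
       cmod (act d v 0 - act g (wave a b c N \<theta>1 \<theta>2 f) 0) \<le> \<epsilon>"
proof -
  obtain R0 where R0: "R0 > 0"
    "\<And>R w. R \<ge> R0 \<Longrightarrow> (\<Sum>n\<in>l1ball (3 * R). (cmod (w n))\<^sup>2) \<le> 9 * M\<^sup>2 * R \<Longrightarrow>
       (\<And>n. n \<in> l1ball (3 * R) \<Longrightarrow> act P w n = coef d n) \<Longrightarrow>
       cmod (act d v 0 - act g w 0) \<le> \<epsilon>"
    using pairing[OF v \<open>\<epsilon> > 0\<close>, of "9 * M\<^sup>2" d] by auto
  show ?thesis
  proof (rule that[of "max R0 1"])
    fix R a b c N \<theta>1 \<theta>2 f
    assume R: "R \<ge> max R0 1" "real N \<ge> 9 * R" and abc: "coords a b c"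
      and f: "\<And>k1 k2 m. cmod (f k1 k2 m) \<le> M"
      and P: "\<And>n. n \<in> l1ball (3 * R) \<Longrightarrow> act P (wave a b c N \<theta>1 \<theta>2 f) n = coef d n"
    define L where "L = nat \<lfloor>3 * R\<rfloor>"
    have L: "real L \<le> 3 * R" "3 * R \<le> real L + 1"
      using R by (auto simp: L_def)
    have "(\<Sum>n\<in>l1ball (3 * R). (cmod (wave a b c N \<theta>1 \<theta>2 f n))\<^sup>2) \<le> (2 * real L + 1) * M\<^sup>2"
      using L R f by (intro wave_bound abc) auto
    also have "\<dots> \<le> (9 * R) * M\<^sup>2"
      using L R by (intro mult_right_mono) auto
    finally show "cmod (act d v 0 - act g (wave a b c N \<theta>1 \<theta>2 f) 0) \<le> \<epsilon>"
      using R P by (intro R0) (auto simp: mult_ac)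
  qed simp
qed

section \<open>Elimination of one variable\<close>

definition no_kernel :: "laurent \<Rightarrow> bool" where
  "no_kernel a \<longleftrightarrow> (\<forall>v\<in>Bstar. act a v = (\<lambda>n. 0) \<longrightarrow> v = (\<lambda>n. 0))"

lemma no_kernel_mult: "no_kernel a \<Longrightarrow> no_kernel b \<Longrightarrow> no_kernel (a * b)"
  unfolding no_kernel_def act_mult using Bstar_act by blast

lemma no_kernel_factor: "no_kernel (b * a) \<Longrightarrow> no_kernel a"
  by (simp add: no_kernel_def act_mult)

lemma no_kernel_const: "c \<noteq> 0 \<Longrightarrow> no_kernel (const c)"
  by (auto simp: no_kernel_def fun_eq_iff)

text \<open>A half-line puts about \<open>R\<close> points into the ball of radius \<open>R\<close>,
  so a sequence bounded below on it has square sum of order \<open>R\<close> already.\<close>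

lemma Bstar_no_ray:
  assumes v: "v \<in> Bstar" and s: "\<bar>s\<bar> = 1" and "\<delta> > 0"
    and ray: "\<And>k::nat. cmod (v (n + axis j (s * int k))) \<ge> \<delta>"
  shows False
proof -
  have "\<delta>\<^sup>2 / 2 > 0" using \<open>\<delta> > 0\<close> by simp
  then obtain R0 where R0: "R0 > 0" "\<And>R. R \<ge> R0 \<Longrightarrow> (\<Sum>n\<in>l1ball R. (cmod (v n))\<^sup>2) \<le> \<delta>\<^sup>2 / 2 * R"
    using Bstar_small[OF v] by blast
  \<comment> \<open>The first summand gives \<open>R \<le> 2 K + 1\<close>, so the
    \<open>K + 1\<close> points of the ray outnumber \<open>R / 2\<close>; the second makes
    \<open>R\<close> reach \<open>R0\<close>.\<close>
  define K where "K = nat (l1norm n) + nat \<lceil>R0\<rceil>"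
  define R where "R = real_of_int (l1norm n) + real K + 1"
  have K: "real_of_int (l1norm n) \<le> real K"
    using l1norm_nonneg[of n] by (simp add: K_def)
  have "R \<ge> R0"
    using l1norm_nonneg[of n] R0(1) unfolding R_def K_def by linarith
  have inj: "inj_on (\<lambda>k. n + axis j (s * int k)) {..K}"
    using s by (auto simp: inj_on_def axis_eq_axis)
  have "real (K + 1) * \<delta>\<^sup>2 = (\<Sum>k\<in>{..K}. \<delta>\<^sup>2)" by simp
  also have "\<dots> \<le> (\<Sum>k\<in>{..K}. (cmod (v (n + axis j (s * int k))))\<^sup>2)"
    using \<open>\<delta> > 0\<close> by (intro sum_mono power_mono ray) auto
  also have "\<dots> = (\<Sum>m\<in>(\<lambda>k. n + axis j (s * int k)) ` {..K}. (cmod (v m))\<^sup>2)"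
    by (simp add: sum.reindex[OF inj])
  also have "\<dots> \<le> (\<Sum>m\<in>l1ball R. (cmod (v m))\<^sup>2)"
  proof (intro sum_mono2 finite_l1norm_ball)
    have "l1norm (axis j x) = \<bar>x\<bar>" for x :: int
      by (simp add: l1norm_def axis_def if_distrib[of abs] cong: if_cong)
    then have "l1norm (n + axis j (s * int k)) \<le> l1norm n + int k" for k
      using l1norm_triangle[of n "axis j (s * int k)"] s by (simp add: abs_mult)
    then have "real_of_int (l1norm (n + axis j (s * int k))) \<le> real_of_int (l1norm n + int k)" for k
      by (simp only: of_int_le_iff)
    then have "real_of_int (l1norm (n + axis j (s * int k))) \<le> real_of_int (l1norm n) + real k" for k
      by simp
    then have "real_of_int (l1norm (n + axis j (s * int k))) < R" if "k \<le> K" for k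
      using that unfolding R_def by (smt (verit) of_nat_le_iff)
    then show "(\<lambda>k. n + axis j (s * int k)) ` {..K} \<subseteq> l1ball R" by auto
  qed simp
  also have "\<dots> \<le> \<delta>\<^sup>2 / 2 * R" by (rule R0(2)[OF \<open>R \<ge> R0\<close>])
  also have "\<dots> = R / 2 * \<delta>\<^sup>2" by simp
  finally have "real (K + 1) \<le> R / 2"
    using \<open>\<delta> > 0\<close> by (subst (asm) mult_le_cancel_right_pos) auto
  then show False using K by (simp add: R_def)
qed

text \<open>A solution is geometric along the axis. It does not decay backwards if
  \<open>|c| \<ge> 1\<close> and forwards otherwise, so it is bounded below on a half-line unless it
  is zero.\<close>

lemma no_kernel_shift: "no_kernel (shift j 1 - const c)"
  unfolding no_kernel_def
proof (intro ballI impI, rule ccontr)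
  fix v assume v: "v \<in> Bstar" "act (shift j 1 - const c) v = (\<lambda>n. 0)" "v \<noteq> (\<lambda>n. 0)"
  then obtain n where n: "v n \<noteq> 0" by auto
  have step: "v (m - axis j 1) = c * v m" for m
    using fun_cong[OF v(2), of m] by (simp add: act_diff)
  have down: "v (m + axis j (- int k)) = c ^ k * v m" for k m
  proof (induction k)
    case (Suc k)
    have "axis j (- int (Suc k)) = axis j (- int k) - (axis j 1 :: int^3)"
      by (simp add: vec_eq_iff axis_def)
    then show ?case using step[of "m + axis j (- int k)"] Suc by (simp add: add_diff_eq)
  qed (simp add: axis_def flip: zero_vec_def)
  show False
  proof (cases "cmod c \<ge> 1")
    case True
    then have "cmod (v (n + axis j (- 1 * int k))) \<ge> cmod (v n)" for k
      using down[of n k] by (simp add: norm_mult norm_power mult_left_le one_le_power mult_le_cancel_right1)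
    then show False using Bstar_no_ray[OF v(1), of "- 1" "cmod (v n)" n j] n by simp
  next
    case False
    have "cmod (v (n + axis j (1 * int k))) \<ge> cmod (v n)" for k
    proof -
      have "v n = c ^ k * v (n + axis j (int k))"
        using down[of "n + axis j (int k)" k] by (simp add: add.assoc flip: axis_add) (simp add: axis_def flip: zero_vec_def)
      then have "cmod (v n) = cmod c ^ k * cmod (v (n + axis j (int k)))"
        by (metis norm_mult norm_power)
      also have "\<dots> \<le> 1 * cmod (v (n + axis j (int k)))"
        using False by (intro mult_right_mono power_le_one) auto
      finally show ?thesis by simp
    qed
    then show False using Bstar_no_ray[OF v(1), of 1 "cmod (v n)" n j] n by simp
  qed
qed

lemma quadratic_roots:
  fixes a b c :: complex
  assumes "a \<noteq> 0"
  obtains r1 r2 where "b = - a * (r1 + r2)" "c = a * r1 * r2"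
proof (rule that)
  define s where "s = csqrt (b\<^sup>2 - 4 * a * c)"
  have "s * s = b\<^sup>2 - 4 * a * c" by (simp add: s_def flip: power2_eq_square)
  show "b = - a * ((- b + s) / (2 * a) + (- b - s) / (2 * a))"
    using assms by (simp add: field_simps)
  show "c = a * ((- b + s) / (2 * a)) * ((- b - s) / (2 * a))"
  proof -
    have "a * ((- b + s) / (2 * a)) * ((- b - s) / (2 * a)) = (b\<^sup>2 - s * s) / (4 * a)"
      using assms by (simp add: field_simps power2_eq_square)
    then show ?thesis using assms \<open>s * s = _\<close> by simp
  qed
qed

text \<open>The roots of \<open>w^2 - c w + 1\<close> have product 1, so one of them lies in the
  closed unit disc.\<close>

lemma joukowski:
  obtains w :: complex where "w \<noteq> 0" "cmod w \<le> 1" "w + 1 / w = c"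
proof -
  obtain r1 r2 where "- c = - 1 * (r1 + r2)" "1 = 1 * r1 * r2"
    using quadratic_roots[of 1 "- c" 1] by auto
  then have r: "r1 + r2 = c" "r1 * r2 = 1"
    by (auto simp: algebra_simps minus_equation_iff[of c])
  then have nz: "r1 \<noteq> 0" "r2 \<noteq> 0" by auto
  then have inv: "r2 = 1 / r1" "r1 = 1 / r2"
    using r by (simp_all add: eq_divide_eq mult.commute)
  have "cmod r1 \<le> 1 \<or> cmod r2 \<le> 1"
  proof (rule ccontr)
    assume "\<not> ?thesis"
    then have "1 * 1 < cmod r1 * cmod r2" by (intro mult_strict_mono) auto
    also have "cmod r1 * cmod r2 = 1" by (simp flip: norm_mult add: r)
    finally show False by simp
  qed
  then show ?thesis
  proof
    assume "cmod r1 \<le> 1"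
    then show ?thesis using that[of r1] nz(1) r(1) unfolding inv(1) by blast
  next
    assume "cmod r2 \<le> 1"
    moreover have "r2 + 1 / r2 = c" using r(1) inv(2) by (metis add.commute)
    ultimately show ?thesis using that[of r2] nz(2) by blast
  qed
qed

text \<open>With \<open>S = shift j 1\<close>, multiplication by \<open>- 4 S^2\<close> gives
  \<open>S^4 - (2 - 4 \<rho>) S^2 + 1\<close>, which splits into first-order factors with roots
  \<open>\<eta>\<close>, \<open>- \<eta>\<close>, \<open>1 / \<eta>\<close>,
  \<open>- 1 / \<eta>\<close>.\<close>

lemma no_kernel_zop: "no_kernel (zop j - const \<rho>)"
proof -
  obtain w where w: "w \<noteq> 0" "w + 1 / w = 2 - 4 * \<rho>" using joukowski by metis
  define \<eta> where "\<eta> = csqrt w"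
  have \<eta>: "\<eta> * \<eta> = w" by (simp add: \<eta>_def flip: power2_eq_square)
  define f where "f = (\<lambda>c. shift j 1 - const c)"
  have ff: "f c * f (- c) = shift j 2 - const (c * c)" for c
  proof -
    have "shift j 2 = shift j 1 * shift j 1" by (simp flip: shift_add)
    then show ?thesis by (simp add: f_def const_hom algebra_simps)
  qed
  have "f \<eta> * f (- \<eta>) * (f (1 / \<eta>) * f (- (1 / \<eta>))) = (shift j 2 - const w) * (shift j 2 - const (1 / w))"
    unfolding ff using \<eta> by simp
  also have "\<dots> = shift j 2 * shift j 2 - const (w + 1 / w) * shift j 2 + const (w * (1 / w))"
    unfolding const_hom(1,2) by (simp add: algebra_simps)
  also have "\<dots> = shift j 2 * shift j 2 - const (2 - 4 * \<rho>) * shift j 2 + 1"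
    using w by (simp add: const_hom)
  also have "\<dots> = (- const 4 * shift j 2) * (zop j - const \<rho>)"
  proof -
    have c4: "const 4 * const (1 / 4) = 1"
      by (simp flip: const_hom)
    have "(- const 4 * shift j 2) * (zop j - const \<rho>) =
       - (const 4 * const (1 / 4)) * (2 * shift j 2 - shift j 2 * shift j 2 - shift j 2 * shift j (- 2))
       + const 4 * const \<rho> * shift j 2"
      unfolding zop_def by (simp add: algebra_simps)
    then show ?thesis
      unfolding c4 by (simp add: shift_inverse const_hom algebra_simps)
  qed
  finally have "f \<eta> * f (- \<eta>) * (f (1 / \<eta>) * f (- (1 / \<eta>))) = (- const 4 * shift j 2) * (zop j - const \<rho>)" .
  moreover have "no_kernel (f \<eta> * f (- \<eta>) * (f (1 / \<eta>) * f (- (1 / \<eta>))))"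
    unfolding f_def by (intro no_kernel_mult no_kernel_shift)
  ultimately show ?thesis using no_kernel_factor by metis
qed

lemma no_kernel_quadratic:
  assumes "a \<noteq> 0"
  shows "no_kernel (const a * zop j * zop j + const b * zop j + const c)"
proof -
  obtain r1 r2 where r: "b = - a * (r1 + r2)" "c = a * r1 * r2"
    using quadratic_roots[OF assms] by blast
  have "const a * zop j * zop j + const b * zop j + const c =
      const a * ((zop j - const r1) * (zop j - const r2))"
    unfolding r by (simp add: const_hom algebra_simps)
  then show ?thesis
    using assms by (simp add: no_kernel_mult no_kernel_const no_kernel_zop)
qed

text \<open>The action of \<open>zop\<close> on a profile of one coordinate, that is, multiplication
  by \<open>sin^2\<close> on the Fourier side.\<close>

definition second_diff :: "(int \<Rightarrow> complex) \<Rightarrow> int \<Rightarrow> complex" where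
  "second_diff f m = (2 * f m - f (m - 2) - f (m + 2)) / 4"

definition delta :: "int \<Rightarrow> complex" where
  "delta m = (if m = 0 then 1 else 0)"

text \<open>
  The decaying exponential \<open>w ^ \<bar>m div 2\<bar>\<close> with \<open>w + 1 / w = 2 - 4 \<rho>\<close>, \<open>\<bar>w\<bar> \<le> 1\<close>; the factor \<open>\<rho> (1 - \<rho>)\<close> is a
  multiple of \<open>(w - 1 / w)\<^sup>2\<close> and makes the bound uniform up to the double roots \<open>w = 1\<close> and \<open>w = -1\<close>.
\<close>

lemma linear_kernel:
  obtains E where "\<And>m. cmod (E m) \<le> 1 + cmod \<rho>"
    "\<And>m. second_diff E m = \<rho> * E m + \<rho> * (1 - \<rho>) * delta m"
proof -
  obtain w where w: "w \<noteq> 0" "cmod w \<le> 1" "w + 1 / w = 2 - 4 * \<rho>" using joukowski by metis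
  define E where "E = (\<lambda>m. if even m then w ^ nat \<bar>m div 2\<bar> * (w - 1 / w) / 4 else 0)"
  have "cmod (w - 1 / w) \<le> 4 + 4 * cmod \<rho>"
  proof -
    \<comment> \<open>\<open>1 / w\<close> is unbounded as \<open>w\<close> approaches 0; the
      equation for \<open>w\<close> trades it for \<open>\<rho>\<close>.\<close>
    have "w - 1 / w = 2 * w - 2 + 4 * \<rho>" using w(3) by (simp add: algebra_simps)
    also have "cmod \<dots> \<le> cmod (2 * w) + cmod 2 + cmod (4 * \<rho>)"
      by (intro norm_triangle_le add_right_mono norm_triangle_ineq4)
    finally show ?thesis using w(2) by (simp add: norm_mult)
  qed
  then have "cmod (w ^ k) * cmod (w - 1 / w) \<le> 1 * (4 + 4 * cmod \<rho>)" for k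
    using w(2) by (intro mult_mono) (auto simp: norm_power power_le_one)
  then have bd: "cmod (w ^ k) * cmod (w - 1 / w) \<le> 4 + 4 * cmod \<rho>" for k
    by simp
  show ?thesis
  proof (rule that[of E])
    fix m
    show "cmod (E m) \<le> 1 + cmod \<rho>"
      using bd[of "nat \<bar>m div 2\<bar>"] by (auto simp: E_def norm_mult norm_divide)
    show "second_diff E m = \<rho> * E m + \<rho> * (1 - \<rho>) * delta m"
    proof (cases "even m")
      case False
      then show ?thesis by (auto simp: second_diff_def E_def delta_def)
    next
      case True
      then obtain l where l: "m = 2 * l" by auto
      have Em: "E (2 * x) = w ^ nat \<bar>x\<bar> * (w - 1 / w) / 4" for x
        by (simp add: E_def)
      have "2 * l - 2 = 2 * (l - 1)" "2 * l + 2 = 2 * (l + 1)" by auto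
      then have sd: "second_diff E (2 * l) = (2 * E (2 * l) - E (2 * (l - 1)) - E (2 * (l + 1))) / 4"
        by (simp only: second_diff_def)
      have \<rho>: "\<rho> = (2 - (w + 1 / w)) / 4" using w(3) by simp
      consider "l = 0" | k where "l = int (Suc k)" | k where "l = - int (Suc k)"
        by (cases l rule: int_cases3) (auto dest: gr0_implies_Suc)
      then show ?thesis
      proof cases
        case 1
        then show ?thesis
          unfolding l sd Em \<rho> using w(1) by (simp add: delta_def field_simps)
      next
        case (2 k)
        have *: "nat \<bar>l\<bar> = Suc k" "nat \<bar>l - 1\<bar> = k" "nat \<bar>l + 1\<bar> = Suc (Suc k)" "2 * l \<noteq> 0"
          using 2 by auto
        show ?thesis
          unfolding l sd Em * \<rho> delta_def using w(1) *(4) by (simp add: field_simps)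
      next
        case (3 k)
        have *: "nat \<bar>l\<bar> = Suc k" "nat \<bar>l + 1\<bar> = k" "nat \<bar>l - 1\<bar> = Suc (Suc k)" "2 * l \<noteq> 0"
          using 3 by auto
        show ?thesis
          unfolding l sd Em * \<rho> delta_def using w(1) *(4) by (simp add: field_simps)
      qed
    qed
  qed
qed

text \<open>Cauchy's bound. In the application \<open>q\<close> does not depend on the Fourier
  parameters, so the roots stay bounded over the whole torus.\<close>

lemma root_bound:
  fixes q Q1 Q0 \<rho> :: complex
  assumes "q \<noteq> 0" "q * \<rho> * \<rho> + Q1 * \<rho> + Q0 = 0" "cmod Q1 \<le> B" "cmod Q0 \<le> B"
  shows "cmod \<rho> \<le> 1 + 2 * B / cmod q"
proof (cases "cmod \<rho> \<le> 1")
  case True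
  have "B \<ge> 0" using assms(3) norm_ge_zero order_trans by blast
  then show ?thesis using True by (simp add: add_increasing2)
next
  case False
  have "q * \<rho> * \<rho> = - (Q1 * \<rho>) - Q0" using assms(2) by (simp add: algebra_simps eq_neg_iff_add_eq_0)
  then have "cmod (q * \<rho> * \<rho>) \<le> cmod (Q1 * \<rho>) + cmod Q0"
    using norm_triangle_ineq4[of "- (Q1 * \<rho>)" Q0] by simp
  also have "\<dots> \<le> B * cmod \<rho> + B * cmod \<rho>"
  proof (intro add_mono)
    show "cmod (Q1 * \<rho>) \<le> B * cmod \<rho>" using assms(3) by (simp add: norm_mult mult_right_mono)
    have "0 \<le> B" using assms(3) norm_ge_zero order_trans by blast
    then have "B * 1 \<le> B * cmod \<rho>"
      using False by (intro mult_left_mono) auto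
    then show "cmod Q0 \<le> B * cmod \<rho>" using assms(4) by simp
  qed
  finally have "(cmod q * cmod \<rho>) * cmod \<rho> \<le> (2 * B) * cmod \<rho>" by (simp add: norm_mult algebra_simps)
  then have "cmod q * cmod \<rho> \<le> 2 * B" using False by (subst (asm) mult_le_cancel_right) auto
  then have "cmod \<rho> \<le> 2 * B / cmod q" using assms(1) by (simp add: field_simps)
  then show ?thesis by simp
qed

text \<open>In terms of the roots the right-hand factor is
  \<open>q^4 (r1 - r2)^2 r1 r2 (1 - r1) (1 - r2)\<close>. Being symmetric it is a polynomial in the
  coefficients, hence later the symbol of an operator; and it vanishes exactly where the fundamental
  solution blows up, at a double root and at the end points 0 and 1 of the range of
  \<open>sin^2\<close>. This makes \<open>M\<close> uniform.\<close>

lemma quadratic_kernel: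
  fixes q :: complex
  assumes "q \<noteq> 0"
  obtains M where "M \<ge> 0" "\<And>Q1 Q0. cmod Q1 \<le> B \<Longrightarrow> cmod Q0 \<le> B \<Longrightarrow>
    \<exists>\<omega>. (\<forall>m. cmod (\<omega> m) \<le> M) \<and> (\<forall>m. q * second_diff (second_diff \<omega>) m + Q1 * second_diff \<omega> m + Q0 * \<omega> m =
      (Q1 * Q1 - 4 * q * Q0) * Q0 * (q + Q1 + Q0) * delta m)"
proof -
  define T where "T = 1 + 2 * \<bar>B\<bar> / cmod q"
  have "T \<ge> 0" by (simp add: T_def)
  define M where "M = cmod q ^ 3 * (2 * T) * (2 * (T * (1 + T) * (1 + T)))"
  show ?thesis
  proof (rule that[of M])
    show "M \<ge> 0" using \<open>T \<ge> 0\<close> by (simp add: M_def)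
    fix Q1 Q0 assume Q: "cmod Q1 \<le> B" "cmod Q0 \<le> B"
    obtain r1 r2 where r: "Q1 = - q * (r1 + r2)" "Q0 = q * r1 * r2"
      using quadratic_roots[OF assms] by blast
    have "q * r1 * r1 + Q1 * r1 + Q0 = 0" "q * r2 * r2 + Q1 * r2 + Q0 = 0"
      by (simp_all add: r algebra_simps)
    then have rT: "cmod r1 \<le> T" "cmod r2 \<le> T"
      using root_bound[OF assms _ Q] unfolding T_def
      by (smt (verit, best) divide_right_mono norm_ge_zero)+
    obtain E1 where E1: "\<And>m. cmod (E1 m) \<le> 1 + cmod r1"
      "\<And>m. second_diff E1 m = r1 * E1 m + r1 * (1 - r1) * delta m"
      using linear_kernel by blast
    obtain E2 where E2: "\<And>m. cmod (E2 m) \<le> 1 + cmod r2"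
      "\<And>m. second_diff E2 m = r2 * E2 m + r2 * (1 - r2) * delta m"
      using linear_kernel by blast
    define L where "L = (\<lambda>a b m. a * E1 m + b * E2 m)"
    have sdL: "second_diff (L a b) m = L (a * r1) (b * r2) m +
        (a * (r1 * (1 - r1)) + b * (r2 * (1 - r2))) * delta m" for a b m
    proof -
      have "second_diff (L a b) m = a * second_diff E1 m + b * second_diff E2 m"
        by (simp add: second_diff_def L_def field_simps)
      then show ?thesis by (simp add: E1 E2 L_def algebra_simps)
    qed
    \<comment> \<open>Partial fractions: the weights \<open>A\<close> and \<open>B'\<close> make the
      impulses of \<open>E1\<close> and \<open>E2\<close> cancel in the first
      \<open>second_diff\<close>, so that an impulse appears only in the second. The prefactor
      completes the symmetric right-hand side.\<close>
    define k where "k = q ^ 3 * (r1 - r2)"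
    define A where "A = k * (r2 * (1 - r2))"
    define B' where "B' = - k * (r1 * (1 - r1))"
    have sd1: "second_diff (L A B') = L (A * r1) (B' * r2)"
      by (rule ext) (simp add: sdL, simp add: A_def B'_def)
    have "cmod (L A B' m) \<le> M" for m
    proof -
      have bd: "cmod (k * (r * (1 - r)) * e) \<le> cmod q ^ 3 * (2 * T) * (T * (1 + T) * (1 + T))"
        if "cmod r \<le> T" "cmod e \<le> 1 + T" for r e
      proof -
        have "cmod (r1 - r2) \<le> 2 * T" using rT norm_triangle_ineq4[of r1 r2] by simp
        moreover have "cmod (1 - r) \<le> 1 + T" using that norm_triangle_ineq4[of 1 r] by simp
        ultimately have "cmod q ^ 3 * cmod (r1 - r2) * (cmod r * cmod (1 - r)) * cmod e \<le>
            cmod q ^ 3 * (2 * T) * (T * (1 + T)) * (1 + T)"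
          using that \<open>T \<ge> 0\<close> by (intro mult_mono mult_nonneg_nonneg) auto
        then show ?thesis by (simp add: k_def norm_mult norm_power mult_ac)
      qed
      have "cmod (L A B' m) \<le> cmod (k * (r2 * (1 - r2)) * E1 m) + cmod (k * (r1 * (1 - r1)) * E2 m)"
        unfolding L_def A_def B'_def using norm_triangle_ineq4 by (simp add: norm_triangle_ineq4)
      also have "\<dots> \<le> M"
        using bd[of r2 "E1 m"] bd[of r1 "E2 m"] rT E1(1)[of m] E2(1)[of m] by (simp add: M_def)
      finally show ?thesis .
    qed
    moreover have "q * second_diff (second_diff (L A B')) m + Q1 * second_diff (L A B') m + Q0 * L A B' m =
      (Q1 * Q1 - 4 * q * Q0) * Q0 * (q + Q1 + Q0) * delta m" for m
      unfolding sd1 sdL unfolding L_def A_def B'_def k_def r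
      by (simp add: power3_eq_cube) algebra
    ultimately show "\<exists>\<omega>. (\<forall>m. cmod (\<omega> m) \<le> M) \<and> (\<forall>m. q * second_diff (second_diff \<omega>) m +
      Q1 * second_diff \<omega> m + Q0 * \<omega> m = (Q1 * Q1 - 4 * q * Q0) * Q0 * (q + Q1 + Q0) * delta m)"
      by blast
  qed
qed

lemma norm_ev_le:
  assumes "\<And>i. cmod (\<zeta>$i) = 1"
  shows "cmod (ev \<zeta> a) \<le> (\<Sum>m\<in>supp a. cmod (coef a m))"
  unfolding ev_def act_def
  by (rule sum_norm_le) (simp add: norm_mult mode_def norm_power_int assms flip: prod_norm)

lemma norm_freq: "cmod (freq a b N \<theta>1 \<theta>2 k1 k2 $ i) = 1"
  by (simp add: freq_def)

lemma act_zop_mode: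
  assumes "\<And>i. \<zeta>$i \<noteq> 0" "\<zeta>$c = 1"
  shows "act (zop c) (\<lambda>n. mode \<zeta> n * f (n$c)) n = mode \<zeta> n * second_diff f (n$c)"
proof -
  have "mode \<zeta> (axis c k) = 1" for k
    unfolding mode_def by (rule prod.neutral) (auto simp: axis_def assms(2))
  then have "mode \<zeta> (n + axis c k) = mode \<zeta> n" for k
    by (simp add: mode_add[OF assms(1)])
  moreover have minus: "axis c (- 2) = - (axis c 2 :: int^3)"
    by (simp add: vec_eq_iff axis_def)
  ultimately
  have "mode \<zeta> (n + axis c 2) = mode \<zeta> n" "mode \<zeta> (n - axis c 2) = mode \<zeta> n"
    by (metis, metis add_uminus_conv_diff)
  then show ?thesis
    by (simp add: act_zop second_diff_def axis_def field_simps)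
qed

lemma act_wave:
  "act a (wave i j c N \<theta>1 \<theta>2 f) n = (\<Sum>k1<N. \<Sum>k2<N. 1 / (of_nat N)^2 *
     act a (\<lambda>n. mode (freq i j N \<theta>1 \<theta>2 k1 k2) n * f k1 k2 (n$c)) n)"
  unfolding wave_def[abs_def] by (simp only: act_sum_right act_scale_right)

text \<open>Averaging over the full grid gives an impulse that is \<open>N\<close>-periodic in
  \<open>a\<close> and \<open>b\<close>; only its copy at 0 lies in the ball.\<close>

lemma periodic_delta:
  assumes abc: "coords a b c" and N: "N > 0" and n: "l1norm n < int N"
  shows "wave a b c N 0 0 (\<lambda>_ _. delta) n = (if n = 0 then 1 else 0)"
proof -
  have sum1: "(\<Sum>k<N. cis (- (2 * pi * real k * of_int x / real N))) = (if x = 0 then of_nat N else 0)"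
    if "\<bar>x\<bar> < int N" for x
  proof (cases "x \<ge> 0")
    case True
    have "(\<Sum>k<N. cis (- (2 * pi * real k * of_int x / real N))) =
        (\<Sum>k<N. cis (- (2 * pi * (real (nat x) - real 0) * real k / real N)))"
      using True by (intro sum.cong refl) (simp add: mult_ac)
    also have "\<dots> = (if nat x = 0 then of_nat N else 0)"
      using that by (intro cis_orthogonality) auto
    finally show ?thesis using True by auto
  next
    case False
    have "(\<Sum>k<N. cis (- (2 * pi * real k * of_int x / real N))) =
        (\<Sum>k<N. cis (- (2 * pi * (real 0 - real (nat (- x))) * real k / real N)))"
      using False by (intro sum.cong refl) (simp add: mult_ac)
    also have "\<dots> = (if 0 = nat (- x) then of_nat N else 0)"
      using that by (intro cis_orthogonality) auto
    finally show ?thesis using False by auto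
  qed
  have le: "\<bar>n$i\<bar> \<le> l1norm n" for i
    unfolding l1norm_def by (rule member_le_sum) auto
  have "wave a b c N 0 0 (\<lambda>_ _. delta) n = delta (n$c) / (of_nat N)^2 *
      ((\<Sum>k<N. cis (- (2 * pi * real k * of_int (n$a) / real N))) *
       (\<Sum>k<N. cis (- (2 * pi * real k * of_int (n$b) / real N))))"
    unfolding wave_def sum_product unfolding sum_distrib_left
    by (intro sum.cong refl) (simp add: mode_freq[OF abc N])
  also have "\<dots> = delta (n$c) / (of_nat N)^2 *
      ((if n$a = 0 then of_nat N else 0) * (if n$b = 0 then of_nat N else 0))"
    using le[of a] le[of b] n by (intro arg_cong2[where f = "(*)"] refl sum1) linarith+
  also have "\<dots> = (if n$a = 0 \<and> n$b = 0 \<and> n$c = 0 then 1 else 0)"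
    using N by (simp add: delta_def power2_eq_square)
  also have "(n$a = 0 \<and> n$b = 0 \<and> n$c = 0) = (n = 0)"
    using coords_UNIV[OF abc] by (auto simp: vec_eq_iff)
  finally show ?thesis .
qed

lemma act_periodic_delta:
  assumes "coords a b c" "N > 0" "\<And>m. m \<in> supp D \<Longrightarrow> real_of_int (l1norm m) \<le> K"
    and "real_of_int (l1norm n) + K < real N"
  shows "act D (wave a b c N 0 0 (\<lambda>_ _. delta)) n = coef D n"
proof -
  have "act D (wave a b c N 0 0 (\<lambda>_ _. delta)) n = (\<Sum>m\<in>supp D. coef D m * (if n - m = 0 then 1 else 0))"
    unfolding act_def
  proof (intro sum.cong refl arg_cong2[where f = "(*)"] periodic_delta assms(1,2))
    fix m assume "m \<in> supp D"
    then have "real_of_int (l1norm (n - m)) < real N"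
      using l1norm_triangle[of n "- m"] assms(3)[of m] assms(4) by simp
    then show "l1norm (n - m) < int N" by linarith
  qed
  also have "\<dots> = (\<Sum>m\<in>supp D. if m = n then coef D n else 0)"
    by (intro sum.cong) auto
  also have "\<dots> = coef D n" by (simp add: in_keys_iff)
  finally show ?thesis .
qed

text \<open>At a fixed frequency in \<open>a\<close> and \<open>b\<close> the operator is a scalar
  quadratic in \<open>zop c\<close>, and \<open>quadratic_kernel\<close> solves it with the symbol
  of \<open>D\<close> times an impulse on the right. Averaging the solutions over the grid yields
  \<open>w\<close> with \<open>P w = D\<close> near the origin; pairing with \<open>P v = 0\<close>
  leaves \<open>D v\<close> at 0.\<close>

lemma elimination_step:
  assumes abc: "coords a b c" and q: "q \<noteq> 0" and free: "q1 \<in> free c" "q0 \<in> free c"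
    and v: "v \<in> Bstar" "act (const q * zop c * zop c + q1 * zop c + q0) v = (\<lambda>n. 0)"
  shows "act ((q1 * q1 - 4 * const q * q0) * q0 * (const q + q1 + q0)) v 0 = 0"
proof -
  define P where "P = const q * zop c * zop c + q1 * zop c + q0"
  define D where "D = (q1 * q1 - 4 * const q * q0) * q0 * (const q + q1 + q0)"
  have Dfree: "D \<in> free c"
    unfolding D_def using free by (intro free_mult free_add free_diff free_const free_numeral)
  \<comment> \<open>Coefficient sums bound the symbols on the whole torus, so \<open>M\<close> is
    independent of the grid chosen later.\<close>
  define B where "B = max (\<Sum>m\<in>supp q1. cmod (coef q1 m)) (\<Sum>m\<in>supp q0. cmod (coef q0 m))"
  obtain M where M: "M \<ge> 0" "\<And>Q1 Q0. cmod Q1 \<le> B \<Longrightarrow> cmod Q0 \<le> B \<Longrightarrow>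
    \<exists>\<omega>. (\<forall>m. cmod (\<omega> m) \<le> M) \<and> (\<forall>m. q * second_diff (second_diff \<omega>) m + Q1 * second_diff \<omega> m + Q0 * \<omega> m =
      (Q1 * Q1 - 4 * q * Q0) * Q0 * (q + Q1 + Q0) * delta m)"
    using quadratic_kernel[OF q] by blast
  have act0: "act P v = coef 0" using v(2) by (simp add: P_def fun_eq_iff)
  have small: "cmod (act D v 0) \<le> \<epsilon>" if eps: "\<epsilon> > 0" for \<epsilon>
  proof -
    obtain R0 where R0: "R0 \<ge> 1"
      "\<And>R a b c N \<theta>1 \<theta>2 f. R \<ge> R0 \<Longrightarrow> real N \<ge> 9 * R \<Longrightarrow> coords a b c \<Longrightarrow>
       (\<And>k1 k2 m. cmod (f k1 k2 m) \<le> M) \<Longrightarrow>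
       (\<And>n. n \<in> l1ball (3 * R) \<Longrightarrow> act P (wave a b c N \<theta>1 \<theta>2 f) n = coef D n) \<Longrightarrow>
       cmod (act D v 0 - act 0 (wave a b c N \<theta>1 \<theta>2 f) 0) \<le> \<epsilon>"
      using wave_pairing[OF v(1) act0 eps M(1), of D] by blast
    obtain K where K: "K > 0" "\<And>m. m \<in> supp D \<Longrightarrow> real_of_int (l1norm m) \<le> K"
      using l1norm_bound[of "supp D"] by auto
    define R where "R = max R0 K"
    \<comment> \<open>\<open>9 R\<close> also exceeds \<open>3 R + K\<close>, so the periodic copies
      of \<open>D\<close> stay outside the ball of radius \<open>3 R\<close>.\<close>
    define N where "N = nat \<lceil>9 * R\<rceil>"
    have R: "R \<ge> R0" "R \<ge> K" "R \<ge> 1" using R0(1) by (auto simp: R_def)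
    have N: "real N \<ge> 9 * R" using R by (simp add: N_def)
    then have "N > 0" using R by (cases N) auto
    define \<zeta> where "\<zeta> = freq a b N 0 0"
    have nz: "\<zeta> k1 k2 $ i \<noteq> 0" for k1 k2 i by (simp add: \<zeta>_def)
    have \<zeta>c: "\<zeta> k1 k2 $ c = 1" for k1 k2 using abc by (auto simp: \<zeta>_def freq_def coords_def)
    have evB: "cmod (ev (\<zeta> k1 k2) q1) \<le> B" "cmod (ev (\<zeta> k1 k2) q0) \<le> B" for k1 k2
      using norm_ev_le[of "\<zeta> k1 k2" q1] norm_ev_le[of "\<zeta> k1 k2" q0]
      by (auto simp: \<zeta>_def norm_freq B_def)
    define spec where "spec = (\<lambda>k1 k2 \<omega>. (\<forall>m. cmod (\<omega> m) \<le> M) \<and>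
       (\<forall>m. q * second_diff (second_diff \<omega>) m + ev (\<zeta> k1 k2) q1 * second_diff \<omega> m + ev (\<zeta> k1 k2) q0 * \<omega> m =
          ev (\<zeta> k1 k2) D * delta m))"
    have "\<exists>\<omega>. spec k1 k2 \<omega>" for k1 k2
      unfolding spec_def D_def using M(2)[OF evB] by (simp add: ev_mult[OF nz])
    then obtain f where "\<And>k1 k2. spec k1 k2 (f k1 k2)" by metis
    then have f: "cmod (f k1 k2 m) \<le> M"
       "q * second_diff (second_diff (f k1 k2)) m + ev (\<zeta> k1 k2) q1 * second_diff (f k1 k2) m + ev (\<zeta> k1 k2) q0 * f k1 k2 m =
          ev (\<zeta> k1 k2) D * delta m" for k1 k2 m
      unfolding spec_def by blast+
    have mode_eq: "act P (\<lambda>n. mode (\<zeta> k1 k2) n * f k1 k2 (n$c)) n =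
        act D (\<lambda>n. mode (\<zeta> k1 k2) n * delta (n$c)) n" for k1 k2 n
    proof -
      let ?m = "\<lambda>g n. mode (\<zeta> k1 k2) n * g (n$c)"
      have z: "act (zop c) (?m g) = ?m (second_diff g)" for g
        using act_zop_mode[of "\<zeta> k1 k2" c g] nz \<zeta>c by auto
      have "act P (?m (f k1 k2)) n = q * ?m (second_diff (second_diff (f k1 k2))) n +
          ev (\<zeta> k1 k2) q1 * ?m (second_diff (f k1 k2)) n + ev (\<zeta> k1 k2) q0 * ?m (f k1 k2) n"
        by (simp only: P_def act_add act_mult z act_const act_free_mode[OF free(1) nz]
            act_free_mode[OF free(2) nz])
      also have "\<dots> = mode (\<zeta> k1 k2) n * (q * second_diff (second_diff (f k1 k2)) (n$c) +
          ev (\<zeta> k1 k2) q1 * second_diff (f k1 k2) (n$c) + ev (\<zeta> k1 k2) q0 * f k1 k2 (n$c))"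
        by (simp add: algebra_simps)
      also have "\<dots> = ev (\<zeta> k1 k2) D * ?m delta n"
        unfolding f(2) by (simp add: mult_ac)
      also have "\<dots> = act D (?m delta) n"
        by (simp only: act_free_mode[OF Dfree nz])
      finally show ?thesis .
    qed
    have "act P (wave a b c N 0 0 f) n = coef D n" if n: "n \<in> l1ball (3 * R)" for n
    proof -
      have "act P (wave a b c N 0 0 f) n = act D (wave a b c N 0 0 (\<lambda>_ _. delta)) n"
        unfolding act_wave by (simp add: mode_eq[unfolded \<zeta>_def])
      also have "\<dots> = coef D n"
        using n R N by (intro act_periodic_delta[OF abc \<open>N > 0\<close> K(2)]) auto
      finally show ?thesis .
    qed
    then show ?thesis
      using R0(2)[of R N a b c f 0 0] R N abc f(1) by simp
  qed
  have "act D v 0 = 0"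
  proof (rule ccontr)
    assume "act D v 0 \<noteq> 0"
    then show False using small[of "cmod (act D v 0) / 2"] by simp
  qed
  then show ?thesis by (simp add: D_def)
qed

lemma no_kernel_elimination:
  assumes "coords a b c" "q \<noteq> 0" "q1 \<in> free c" "q0 \<in> free c"
    and nk: "no_kernel (q1 * q1 - 4 * const q * q0)" "no_kernel q0" "no_kernel (const q + q1 + q0)"
  shows "no_kernel (const q * zop c * zop c + q1 * zop c + q0)"
  unfolding no_kernel_def
proof (intro ballI impI)
  define P where "P = const q * zop c * zop c + q1 * zop c + q0"
  define D where "D = (q1 * q1 - 4 * const q * q0) * q0 * (const q + q1 + q0)"
  fix v assume v: "v \<in> Bstar" "act (const q * zop c * zop c + q1 * zop c + q0) v = (\<lambda>n. 0)"
  have "act D v n = 0" for n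
  proof -
    \<comment> \<open>Translation invariance carries the value at 0 to \<open>n\<close>.\<close>
    define v' where "v' = (\<lambda>m. v (m - (- n)))"
    have tr: "act a v' m = act a v (m + n)" for a m
      by (simp add: v'_def act_def algebra_simps)
    have "act P v' = (\<lambda>n. 0)" using v(2) by (simp add: fun_eq_iff tr P_def)
    moreover have "v' \<in> Bstar" unfolding v'_def by (rule Bstar_shift[OF v(1)])
    ultimately have "act D v' 0 = 0"
      using elimination_step[OF assms(1-4)] by (simp add: P_def D_def)
    then show ?thesis by (simp add: tr)
  qed
  moreover have "no_kernel D"
    unfolding D_def by (intro no_kernel_mult nk)
  ultimately show "v = (\<lambda>n. 0)"
    using v(1) unfolding no_kernel_def by blast
qed

section \<open>The Fresnel polynomial\<close>

text \<open>
  The auxiliary factor \<open>zop c - 2\<close> makes the polynomial quadratic, so that the elimination lemma applies.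
\<close>

lemma no_kernel_affine_step:
  assumes abc: "coords a b c" and A: "A \<in> free c" "\<And>k. no_kernel (A + const k)" and q: "q \<noteq> 0"
  shows "no_kernel (A + const q * zop c + const k)"
proof -
  define A' where "A' = A + const k"
  have A': "A' \<in> free c" unfolding A'_def using A(1) by auto
  have nk: "no_kernel (A' + const x)" for x
    using A(2)[of "k + x"] by (simp add: A'_def const_hom add.assoc)
  \<comment> \<open>The added root 2 differs from 0 and 1, so neither of the last two eliminated
    factors vanishes identically. Up to constants the three factors are the square of
    \<open>A' + 2 q\<close>, then \<open>A'\<close> and \<open>A' + q\<close>.\<close>
  have "no_kernel (const q * zop c * zop c + (A' - 2 * const q) * zop c + (- const 2 * A'))"
  proof (rule no_kernel_elimination[OF abc q])
    show "A' - 2 * const q \<in> free c" "- const 2 * A' \<in> free c" using A' by auto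
    have "(A' - 2 * const q) * (A' - 2 * const q) - 4 * const q * (- const 2 * A') =
        (A' + const (2 * q)) * (A' + const (2 * q))"
      by (simp add: const_hom algebra_simps)
    then show "no_kernel ((A' - 2 * const q) * (A' - 2 * const q) - 4 * const q * (- const 2 * A'))"
      by (simp add: no_kernel_mult nk)
    have "- const 2 * A' = const (- 2) * (A' + const 0)" by (simp add: const_hom)
    moreover have "no_kernel (const (- 2) * (A' + const 0))"
      by (intro no_kernel_mult no_kernel_const nk) simp
    ultimately show "no_kernel (- const 2 * A')" by metis
    have "const q + (A' - 2 * const q) + - const 2 * A' = const (- 1) * (A' + const q)"
      by (simp add: const_hom algebra_simps)
    then show "no_kernel (const q + (A' - 2 * const q) + - const 2 * A')"
      by (simp add: no_kernel_mult no_kernel_const nk)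
  qed
  also have "const q * zop c * zop c + (A' - 2 * const q) * zop c + (- const 2 * A') =
      (zop c - const 2) * (A' + const q * zop c)"
    by (simp add: const_hom algebra_simps)
  finally have "no_kernel (A' + const q * zop c)" by (rule no_kernel_factor)
  then show ?thesis by (simp add: A'_def add_ac)
qed

lemma no_kernel_linear:
  assumes "c1 \<noteq> 0" "c2 \<noteq> 0" "c3 \<noteq> 0"
  shows "no_kernel (const c1 * zop 1 + const c2 * zop 2 + const c3 * zop 3 + const k)"
proof -
  have 1: "no_kernel (const c1 * zop 1 + const k)" for k
  proof -
    have "const c1 * zop 1 + const k = const c1 * (zop 1 - const (- k / c1))"
      using assms by (simp add: right_diff_distrib flip: const_hom)
    then show ?thesis
      using no_kernel_mult[OF no_kernel_const[OF assms(1)] no_kernel_zop[of 1 "- k / c1"]] by metis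
  qed
  have 2: "no_kernel (const c1 * zop 1 + const c2 * zop 2 + const k)" for k
    using assms by (intro no_kernel_affine_step[of 1 3] 1) (auto simp: coords_def intro!: free_mult free_const free_zop)
  show ?thesis
    using assms by (intro no_kernel_affine_step[of 1 2] 2) (auto simp: coords_def intro!: free_add free_mult free_const free_zop)
qed

lemma no_kernel_poly2:
  assumes "a \<noteq> 0 \<or> b \<noteq> 0 \<or> c \<noteq> 0"
  shows "no_kernel (const a * zop j * zop j + const b * zop j + const c)"
proof (cases "a = 0")
  case a: True
  show ?thesis
  proof (cases "b = 0")
    case True
    then show ?thesis using a assms by (simp add: const_hom no_kernel_const)
  next
    case False
    have "const b * zop j + const c = const b * (zop j - const (- c / b))"
      using False by (simp add: right_diff_distrib flip: const_hom)
    then have "no_kernel (const b * zop j + const c)"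
      using no_kernel_mult[OF no_kernel_const[OF False] no_kernel_zop[of j "- c / b"]] by metis
    then show ?thesis using a by (simp add: const_hom)
  qed
qed (rule no_kernel_quadratic)

text \<open>Eliminating \<open>zop 2\<close> leaves three polynomials in \<open>zop 1\<close> alone.
  Two of them have leading coefficient \<open>c2\<close>; the disjunction says that the third, the
  discriminant, is not zero.\<close>

lemma no_kernel_conic:
  assumes "a \<noteq> 0"
    and "b1 * b1 - 4 * a * c2 \<noteq> 0 \<or> 2 * b1 * b0 - 4 * a * c1 \<noteq> 0 \<or> b0 * b0 - 4 * a * c0 \<noteq> 0"
    and "c2 \<noteq> 0"
  shows "no_kernel (const a * zop 2 * zop 2 + (const b1 * zop 1 + const b0) * zop 2 +
    (const c2 * zop 1 * zop 1 + const c1 * zop 1 + const c0))"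
proof (rule no_kernel_elimination[of 1 3])
  let ?b = "const b1 * zop 1 + const b0" and ?c = "const c2 * zop 1 * zop 1 + const c1 * zop 1 + const c0"
  show "coords 1 3 2" by (simp add: coords_def)
  show "?b \<in> free 2" "?c \<in> free 2" by (auto intro!: free_add free_mult free_const free_zop)
  have "?b * ?b - 4 * const a * ?c = const (b1 * b1 - 4 * a * c2) * zop 1 * zop 1 +
      const (2 * b1 * b0 - 4 * a * c1) * zop 1 + const (b0 * b0 - 4 * a * c0)"
    by (simp add: const_hom algebra_simps)
  then show "no_kernel (?b * ?b - 4 * const a * ?c)"
    using no_kernel_poly2[OF assms(2)] by simp
  show "no_kernel ?c" using no_kernel_poly2 assms(3) by simp
  have "const a + ?b + ?c = const c2 * zop 1 * zop 1 + const (b1 + c1) * zop 1 + const (a + b0 + c0)"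
    by (simp add: const_hom algebra_simps)
  then show "no_kernel (const a + ?b + ?c)"
    using no_kernel_poly2[of c2] assms(3) by metis
qed (use assms in auto)

text \<open>
  With \<open>l = \<lambda>\<^sup>2\<close> and \<open>z\<^sub>j = sin\<^sup>2 x\<^sub>j\<close>, \<open>\<lambda>\<^sup>2\<close> times \<open>fresnel\<close> is the determinant of the symbol of \<open>H\<^sup>D - \<lambda>\<close>.
  The definitions are polymorphic in order to serve for numbers as well as for Laurent polynomials.
\<close>

definition fresnel2 :: "'a \<Rightarrow> 'a \<Rightarrow> 'a \<Rightarrow> 'a \<Rightarrow> 'a::comm_ring_1" where
  "fresnel2 e1 e2 m1 m2 = e1 * e2 * m1 * m2"

definition fresnel1 :: "'a \<Rightarrow> 'a \<Rightarrow> 'a \<Rightarrow> 'a \<Rightarrow> 'a \<Rightarrow> 'a \<Rightarrow> 'a \<Rightarrow> 'a \<Rightarrow> 'a \<Rightarrow> 'a::comm_ring_1" where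
  "fresnel1 e1 e2 e3 m1 m2 m3 l z1 z2 =
     e1 * e2 * (m2 * m3 * z1 + m1 * m3 * z2) + m1 * m2 * (e2 * e3 * z1 + e1 * e3 * z2) - l * (e1 * m2 + e2 * m1)"

definition fresnel0 :: "'a \<Rightarrow> 'a \<Rightarrow> 'a \<Rightarrow> 'a \<Rightarrow> 'a \<Rightarrow> 'a \<Rightarrow> 'a \<Rightarrow> 'a \<Rightarrow> 'a \<Rightarrow> 'a::comm_ring_1" where
  "fresnel0 e1 e2 e3 m1 m2 m3 l z1 z2 =
     l * l - l * ((e2 * m3 + e3 * m2) * z1 + (e3 * m1 + e1 * m3) * z2) +
     (e2 * e3 * z1 + e1 * e3 * z2) * (m2 * m3 * z1 + m1 * m3 * z2)"

definition fresnel :: "'a \<Rightarrow> 'a \<Rightarrow> 'a \<Rightarrow> 'a \<Rightarrow> 'a \<Rightarrow> 'a \<Rightarrow> 'a \<Rightarrow> 'a \<Rightarrow> 'a \<Rightarrow> 'a \<Rightarrow> 'a::comm_ring_1" where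
  "fresnel e1 e2 e3 m1 m2 m3 l z1 z2 z3 =
     l * l - l * ((e2 * m3 + e3 * m2) * z1 + (e3 * m1 + e1 * m3) * z2 + (e1 * m2 + e2 * m1) * z3) +
     (e2 * e3 * z1 + e1 * e3 * z2 + e1 * e2 * z3) * (m2 * m3 * z1 + m1 * m3 * z2 + m1 * m2 * z3)"

lemma fresnel_quadratic:
  "fresnel e1 e2 e3 m1 m2 m3 l z1 z2 z3 = fresnel2 e1 e2 m1 m2 * z3 * z3 +
     fresnel1 e1 e2 e3 m1 m2 m3 l z1 z2 * z3 + fresnel0 e1 e2 e3 m1 m2 m3 l z1 z2"
  unfolding fresnel_def fresnel2_def fresnel1_def fresnel0_def by (simp add: algebra_simps)

text \<open>As a quadratic in \<open>Y\<close> this has discriminant \<open>16 * L * X\<close>, so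
  it is not a square unless \<open>L * X\<close> vanishes. Each of \<open>X\<close>,
  \<open>Y\<close>, \<open>L\<close> carries one component of \<beta>.\<close>

definition fresnel_disc :: "'a \<Rightarrow> 'a \<Rightarrow> 'a \<Rightarrow> 'a \<Rightarrow> 'a \<Rightarrow> 'a \<Rightarrow> 'a \<Rightarrow> 'a \<Rightarrow> 'a \<Rightarrow> 'a::comm_ring_1" where
  "fresnel_disc e1 e2 e3 m1 m2 m3 l z1 z2 =
     (let X = - (e2 * m2 * (e3 * m1 - e1 * m3) * z1); Y = e1 * m1 * (e2 * m3 - e3 * m2) * z2; L = l * (e1 * m2 - e2 * m1)
      in (X + Y + L) * (X + Y + L) - 4 * L * X)"

lemma fresnel_disc:
  "fresnel1 e1 e2 e3 m1 m2 m3 l z1 z2 * fresnel1 e1 e2 e3 m1 m2 m3 l z1 z2 -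
     4 * fresnel2 e1 e2 m1 m2 * fresnel0 e1 e2 e3 m1 m2 m3 l z1 z2 = fresnel_disc e1 e2 e3 m1 m2 m3 l z1 z2"
  unfolding fresnel2_def fresnel1_def fresnel0_def fresnel_disc_def Let_def by (simp add: algebra_simps)

lemma no_kernel_fresnel:
  fixes e1 e2 e3 m1 m2 m3 l :: complex
  assumes nz: "e1 \<noteq> 0" "e2 \<noteq> 0" "e3 \<noteq> 0" "m1 \<noteq> 0" "m2 \<noteq> 0" "m3 \<noteq> 0" "l \<noteq> 0"
    and b: "e2 * m3 - e3 * m2 \<noteq> 0" "e3 * m1 - e1 * m3 \<noteq> 0" "e1 * m2 - e2 * m1 \<noteq> 0"
  shows "no_kernel (fresnel (const e1) (const e2) (const e3) (const m1) (const m2) (const m3) (const l)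
    (zop 1) (zop 2) (zop 3))"
proof -
  define Q2 where "Q2 = fresnel2 e1 e2 m1 m2"
  define Q1 where "Q1 = fresnel1 (const e1) (const e2) (const e3) (const m1) (const m2) (const m3) (const l) (zop 1) (zop 2)"
  define Q0 where "Q0 = fresnel0 (const e1) (const e2) (const e3) (const m1) (const m2) (const m3) (const l) (zop 1) (zop 2)"
  have Q2: "const Q2 = fresnel2 (const e1) (const e2) (const m1) (const m2)"
    by (simp add: Q2_def fresnel2_def const_hom)
  \<comment> \<open>The values \<open>Q0\<close> at \<open>z3 = 0\<close> and
    \<open>Q2 + Q1 + Q0\<close> at \<open>z3 = 1\<close> have the same quadratic part in
    \<open>z1\<close> and \<open>z2\<close>, so one computation serves both.\<close>
  have lead: "(e1 * e3 * m2 * m3 + e2 * e3 * m1 * m3) * (e1 * e3 * m2 * m3 + e2 * e3 * m1 * m3) -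
      4 * (e1 * e3 * m1 * m3) * (e2 * e3 * m2 * m3) \<noteq> 0"
  proof -
    have "(e1 * e3 * m2 * m3 + e2 * e3 * m1 * m3) * (e1 * e3 * m2 * m3 + e2 * e3 * m1 * m3) -
      4 * (e1 * e3 * m1 * m3) * (e2 * e3 * m2 * m3) = (e3 * m3 * (e1 * m2 - e2 * m1))\<^sup>2"
      by algebra
    then show ?thesis using nz b by simp
  qed
  have "no_kernel (const Q2 * zop 3 * zop 3 + Q1 * zop 3 + Q0)"
  proof (rule no_kernel_elimination[of 1 2])
    show "coords 1 2 3" by (simp add: coords_def)
    show "Q2 \<noteq> 0" using nz by (simp add: Q2_def fresnel2_def)
    show "Q1 \<in> free 3" "Q0 \<in> free 3"
      unfolding Q1_def Q0_def fresnel1_def fresnel0_def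
      by (intro free_add free_diff free_mult free_const free_zop; simp)+
    have "Q0 = const (e1 * e3 * m1 * m3) * zop 2 * zop 2 +
       (const (e1 * e3 * m2 * m3 + e2 * e3 * m1 * m3) * zop 1 + const (- l * (e3 * m1 + e1 * m3))) * zop 2 +
       (const (e2 * e3 * m2 * m3) * zop 1 * zop 1 + const (- l * (e2 * m3 + e3 * m2)) * zop 1 + const (l * l))"
      unfolding Q0_def fresnel0_def by (simp add: const_hom algebra_simps)
    then show "no_kernel Q0"
      using no_kernel_conic[of "e1 * e3 * m1 * m3" "e1 * e3 * m2 * m3 + e2 * e3 * m1 * m3" "e2 * e3 * m2 * m3"]
        lead nz by simp
    have "const Q2 + Q1 + Q0 = const (e1 * e3 * m1 * m3) * zop 2 * zop 2 +
       (const (e1 * e3 * m2 * m3 + e2 * e3 * m1 * m3) * zop 1 +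
         const (- l * (e3 * m1 + e1 * m3) + e1 * e2 * m1 * m3 + m1 * m2 * e1 * e3)) * zop 2 +
       (const (e2 * e3 * m2 * m3) * zop 1 * zop 1 +
         const (- l * (e2 * m3 + e3 * m2) + e1 * e2 * m2 * m3 + m1 * m2 * e2 * e3) * zop 1 +
         const (l * l - l * (e1 * m2 + e2 * m1) + e1 * e2 * m1 * m2))"
      unfolding Q0_def fresnel0_def Q1_def fresnel1_def Q2 fresnel2_def by (simp add: const_hom algebra_simps)
    then show "no_kernel (const Q2 + Q1 + Q0)"
      using no_kernel_conic[of "e1 * e3 * m1 * m3" "e1 * e3 * m2 * m3 + e2 * e3 * m1 * m3" "e2 * e3 * m2 * m3"]
        lead nz by simp
    define x where "x = - (e2 * m2 * (e3 * m1 - e1 * m3))"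
    define y where "y = e1 * m1 * (e2 * m3 - e3 * m2)"
    define L where "L = l * (e1 * m2 - e2 * m1)"
    have xyL: "x \<noteq> 0" "y \<noteq> 0" "L \<noteq> 0" using nz b by (auto simp: x_def y_def L_def)
    have "Q1 * Q1 - 4 * const Q2 * Q0 = (const x * zop 1 + const y * zop 2 + const L) * (const x * zop 1 + const y * zop 2 + const L)
        - 4 * const L * (const x * zop 1)"
      unfolding Q1_def Q0_def Q2 fresnel_disc fresnel_disc_def Let_def
      by (simp add: x_def y_def L_def const_hom)
    also have "\<dots> = const (y * y) * zop 2 * zop 2 + (const (2 * x * y) * zop 1 + const (2 * y * L)) * zop 2 +
        (const (x * x) * zop 1 * zop 1 + const (- 2 * L * x) * zop 1 + const (L * L))"
      by (simp add: const_hom algebra_simps)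
    finally have disc: "Q1 * Q1 - 4 * const Q2 * Q0 = \<dots>" .
    \<comment> \<open>The quadratic part of this conic is a perfect square, so its discriminant has
      no term in \<open>zop 1\<close> squared and must be nonzero through the linear
      coefficient.\<close>
    have "2 * (2 * x * y) * (2 * y * L) - 4 * (y * y) * (- 2 * L * x) = 16 * x * y * y * L"
      by (simp add: algebra_simps)
    then show "no_kernel (Q1 * Q1 - 4 * const Q2 * Q0)"
      unfolding disc using xyL by (intro no_kernel_conic) auto
  qed
  then show ?thesis
    by (simp add: fresnel_quadratic Q2 Q1_def Q0_def)
qed

section \<open>Vanishing of the symbol on the characteristic surface\<close>

definition torus :: "real \<Rightarrow> real \<Rightarrow> real \<Rightarrow> complex^3" where
  "torus x1 x2 x3 = vector [cis x1, cis x2, cis x3]"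

lemma torus_nth [simp]:
  "torus x1 x2 x3 $ 1 = cis x1" "torus x1 x2 x3 $ 2 = cis x2" "torus x1 x2 x3 $ 3 = cis x3"
  by (simp_all add: torus_def)

lemma torus_nz [simp]: "torus x1 x2 x3 $ i \<noteq> 0"
  using exhaust_3[of i] by auto

lemma norm_torus [simp]: "cmod (torus x1 x2 x3 $ i) = 1"
  using exhaust_3[of i] by auto

lemma mode_torus:
  "mode (torus x1 x2 x3) n = cis (- (x1 * of_int (n$1) + x2 * of_int (n$2) + x3 * of_int (n$3)))"
  unfolding mode_def UNIV_3 by (simp add: cis_powi cis_mult) (rule arg_cong[where f = cis], simp add: mult.commute)

lemma ev_torus:
  "ev (torus x1 x2 x3) a = (\<Sum>m\<in>supp a. coef a m * cis (x1 * of_int (m$1) + x2 * of_int (m$2) + x3 * of_int (m$3)))"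
  by (simp add: ev_def act_def mode_torus algebra_simps)

lemma continuous_ev_torus:
  assumes "continuous_on U h"
  shows "continuous_on U (\<lambda>x. ev (torus (fst x) (snd x) (h x)) a)"
proof -
  have "continuous_on U (\<lambda>x. cis (f x))" if "continuous_on U f" for f :: "real \<times> real \<Rightarrow> real"
    using that unfolding cis_conv_exp by (intro continuous_intros) 
  then show ?thesis
    unfolding ev_torus using assms by (intro continuous_intros) auto
qed

text \<open>
  Superpositions of the plane waves at the points of a graph inside the zero set of \<open>P\<close> are solutions of
  \<open>P w = 0\<close>; pairing \<open>g = P v\<close> with the one whose weights are the conjugates of the values of \<open>g\<close> gives
  the mean square of \<open>g\<close> on that graph.
\<close>

lemma symbol_vanishes:
  fixes h :: "real \<times> real \<Rightarrow> real"
  assumes v: "v \<in> Bstar" "act P v = coef g"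
    and U: "open U" "continuous_on U h"
    and P: "\<And>x. x \<in> U \<Longrightarrow> ev (torus (fst x) (snd x) (h x)) P = 0"
    and p: "p \<in> U"
  shows "ev (torus (fst p) (snd p) (h p)) g = 0"
proof (rule ccontr)
  define F where "F = (\<lambda>x. ev (torus (fst x) (snd x) (h x)) g)"
  assume "ev (torus (fst p) (snd p) (h p)) g \<noteq> 0"
  then have Fp: "F p \<noteq> 0" by (simp add: F_def)
  define c where "c = cmod (F p) / 2"
  have c: "c > 0" using Fp by (simp add: c_def)
  have "isCont F p"
    using continuous_ev_torus[OF U(2), of g] U(1) p by (simp add: F_def continuous_on_eq_continuous_at)
  then obtain d1 where d1: "d1 > 0" "\<And>x. dist x p < d1 \<Longrightarrow> dist (F x) (F p) < c"
    using c unfolding continuous_at_eps_delta by blast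
  obtain d2 where d2: "d2 > 0" "ball p d2 \<subseteq> U"
    using U(1) p openE by blast
  define d where "d = min d1 d2 / 2"
  have "d > 0" using d1 d2 by (simp add: d_def)
  have near: "(fst p + s, snd p + t) \<in> U \<and> cmod (F (fst p + s, snd p + t)) \<ge> c"
    if "0 \<le> s" "s < d" "0 \<le> t" "t < d" for s t
  proof -
    have "dist (fst p + s, snd p + t) p \<le> \<bar>s\<bar> + \<bar>t\<bar>"
      by (cases p) (simp add: dist_Pair_Pair dist_real_def sqrt_sum_squares_le_sum_abs)
    then have *: "dist (fst p + s, snd p + t) p < min d1 d2" using that by (simp add: d_def)
    then have "(fst p + s, snd p + t) \<in> U"
      using d2(2) by (auto simp: dist_commute subset_iff)
    moreover have "dist (F (fst p + s, snd p + t)) (F p) < c" using d1(2) * by simp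
    then have "cmod (F p) - cmod (F (fst p + s, snd p + t)) < c"
      using norm_triangle_ineq2[of "F p" "F (fst p + s, snd p + t)"] by (simp add: dist_norm norm_minus_commute)
    ultimately show ?thesis by (simp add: c_def)
  qed
  obtain J :: nat where J: "2 * pi / d < real J" using reals_Archimedean2 by blast
  have "2 * pi / d > 0" using \<open>d > 0\<close> by simp
  then have J0: "J > 0" using J by (cases J) auto
  have Jd: "2 * pi / real J < d" using J \<open>d > 0\<close> J0 by (simp add: field_simps)
  define M where "M = (\<Sum>m\<in>supp g. cmod (coef g m))"
  have "M \<ge> 0" by (simp add: M_def sum_nonneg)
  \<comment> \<open>Half of the lower bound \<open>c^2 / J^2\<close> reached at the end. That bound
    does not depend on \<open>K\<close>, so \<open>\<epsilon>\<close> can be fixed before the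
    threshold \<open>R\<close> and the grid.\<close>
  define \<epsilon> where "\<epsilon> = c\<^sup>2 / (real J)\<^sup>2 / 2"
  have eps: "\<epsilon> > 0" using c J0 by (simp add: \<epsilon>_def)
  obtain R where R: "R \<ge> 1"
    "\<And>R' a b c N \<theta>1 \<theta>2 f. R' \<ge> R \<Longrightarrow> real N \<ge> 9 * R' \<Longrightarrow> coords a b c \<Longrightarrow>
     (\<And>k1 k2 m. cmod (f k1 k2 m) \<le> M) \<Longrightarrow>
     (\<And>n. n \<in> l1ball (3 * R') \<Longrightarrow> act P (wave a b c N \<theta>1 \<theta>2 f) n = coef 0 n) \<Longrightarrow>
     cmod (act 0 v 0 - act g (wave a b c N \<theta>1 \<theta>2 f) 0) \<le> \<epsilon>"
    using wave_pairing[OF v eps \<open>M \<ge> 0\<close>, of 0] by blast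
  define K where "K = nat \<lceil>9 * R\<rceil>"
  have K: "real K \<ge> 9 * R" using R(1) by (simp add: K_def)
  then have K0: "K > 0" using R(1) by (cases K) auto
  \<comment> \<open>The grid points with both indices below \<open>K\<close> fill a square of side
    \<open>2 pi / J < d\<close>, where \<open>|F| \<ge> c\<close>; they are the fraction
    \<open>1 / J^2\<close> of all points.\<close>
  define N where "N = J * K"
  have KN: "K \<le> N" using J0 by (simp add: N_def)
  then have "real K \<le> real N" by simp
  then have N: "real N \<ge> 9 * R" using K by linarith
  have N0: "N > 0" using J0 K0 by (simp add: N_def)
  define x where "x = (\<lambda>k1 k2. (fst p + 2 * pi * real k1 / real N, snd p + 2 * pi * real k2 / real N))"
  have small: "0 \<le> 2 * pi * real k / real N" "2 * pi * real k / real N < d" if "k < K" for k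
  proof -
    have "2 * pi * real k / real N \<le> 2 * pi * real K / real N"
      using that by (intro divide_right_mono mult_left_mono) auto
    also have "\<dots> = 2 * pi / real J" using K0 by (simp add: N_def)
    finally show "2 * pi * real k / real N < d" using Jd by simp
  qed simp
  have xU: "x k1 k2 \<in> U" and xF: "cmod (F (x k1 k2)) \<ge> c" if "k1 < K" "k2 < K" for k1 k2
    using near small that by (auto simp: x_def)
  define f where "f = (\<lambda>k1 k2 m. if k1 < K \<and> k2 < K then
     cnj (F (x k1 k2)) * cis (- (h (x k1 k2) * of_int m)) else 0)"
  have fM: "cmod (f k1 k2 m) \<le> M" for k1 k2 m
    using norm_ev_le[of "torus (fst (x k1 k2)) (snd (x k1 k2)) (h (x k1 k2))" g] \<open>M \<ge> 0\<close>
    by (simp add: f_def F_def M_def norm_mult)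
  have coords: "coords 1 2 3" by (simp add: coords_def)
  have term_eq: "act a (\<lambda>n. mode (freq 1 2 N (fst p) (snd p) k1 k2) n * f k1 k2 (n$3)) n =
      (if k1 < K \<and> k2 < K then cnj (F (x k1 k2)) *
        (ev (torus (fst (x k1 k2)) (snd (x k1 k2)) (h (x k1 k2))) a *
         mode (torus (fst (x k1 k2)) (snd (x k1 k2)) (h (x k1 k2))) n) else 0)" for a k1 k2 n
  proof (cases "k1 < K \<and> k2 < K")
    case True
    have "mode (freq 1 2 N (fst p) (snd p) k1 k2) n * f k1 k2 (n$3) =
       cnj (F (x k1 k2)) * mode (torus (fst (x k1 k2)) (snd (x k1 k2)) (h (x k1 k2))) n" for n
      unfolding mode_freq[OF coords N0] mode_torus f_def using True
      by (simp add: x_def cis_mult algebra_simps)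
    then show ?thesis using True by (simp add: act_scale_right act_mode)
  next
    case False
    then have "f k1 k2 m = 0" for m unfolding f_def by (simp only: if_False)
    with False show ?thesis by auto
  qed
  have "act P (wave 1 2 3 N (fst p) (snd p) f) n = coef 0 n" for n
    unfolding act_wave term_eq by (intro trans[OF sum.neutral] ballI) (auto simp: P xU intro!: sum.neutral)
  then have "cmod (act 0 v 0 - act g (wave 1 2 3 N (fst p) (snd p) f) 0) \<le> \<epsilon>"
    by (intro R(2)[OF order_refl N coords fM])
  then have le: "cmod (act g (wave 1 2 3 N (fst p) (snd p) f) 0) \<le> \<epsilon>" by simp
  have "act g (wave 1 2 3 N (fst p) (snd p) f) 0 =
      (\<Sum>k1<N. \<Sum>k2<N. 1 / (of_nat N)\<^sup>2 * (if k1 < K \<and> k2 < K then cnj (F (x k1 k2)) * F (x k1 k2) else 0))"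
    unfolding act_wave term_eq by (intro sum.cong refl) (simp add: F_def)
  also have "\<dots> = of_real (\<Sum>k1<N. \<Sum>k2<N. 1 / (real N)\<^sup>2 * (if k1 < K \<and> k2 < K then (cmod (F (x k1 k2)))\<^sup>2 else 0))"
    unfolding of_real_sum
    by (intro sum.cong refl) (auto simp: complex_norm_square[unfolded of_real_power] mult.commute)
  finally have "cmod (act g (wave 1 2 3 N (fst p) (snd p) f) 0) =
      (\<Sum>k1<N. \<Sum>k2<N. 1 / (real N)\<^sup>2 * (if k1 < K \<and> k2 < K then (cmod (F (x k1 k2)))\<^sup>2 else 0))"
    by (simp only: norm_of_real) (simp add: sum_nonneg)
  also have "\<dots> \<ge> (\<Sum>k1<N. \<Sum>k2<N. 1 / (real N)\<^sup>2 * (if k1 < K \<and> k2 < K then c\<^sup>2 else 0))"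
    using xF c by (intro sum_mono mult_left_mono) (auto intro: power_mono)
  also have "(\<Sum>k1<N. \<Sum>k2<N. 1 / (real N)\<^sup>2 * (if k1 < K \<and> k2 < K then c\<^sup>2 else 0)) =
      (\<Sum>k1<K. \<Sum>k2<K. c\<^sup>2 / (real N)\<^sup>2)"
  proof -
    have rs: "(\<Sum>k<N. if k < K then a k else 0) = (\<Sum>k<K. a k)" for a :: "nat \<Rightarrow> real"
      using KN by (intro sum.mono_neutral_cong_right) auto
    have "(\<Sum>k1<N. \<Sum>k2<N. 1 / (real N)\<^sup>2 * (if k1 < K \<and> k2 < K then c\<^sup>2 else 0)) =
        (\<Sum>k1<N. if k1 < K then (\<Sum>k2<N. if k2 < K then c\<^sup>2 / (real N)\<^sup>2 else 0) else 0)"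
      by (rule sum.cong[OF refl]) (auto intro!: sum.cong)
    then show ?thesis by (simp only: rs)
  qed
  also have "\<dots> = 2 * \<epsilon>"
    using K0 J0 by (simp add: \<epsilon>_def N_def power2_eq_square field_simps)
  finally show False using le eps by simp
qed

section \<open>Division by the characteristic polynomial\<close>

definition upd :: "complex^3 \<Rightarrow> 3 \<Rightarrow> complex \<Rightarrow> complex^3" where
  "upd \<zeta> j x = (\<chi> i. if i = j then x else \<zeta>$i)"

text \<open>A power of \<open>x\<close> clears the negative exponents. Allowing every larger power
  lets two Laurent polynomials share one.\<close>

lemma ev_polynomial:
  assumes "\<And>i. \<zeta>$i \<noteq> 0"
  shows "\<exists>M0. \<forall>M\<ge>M0. \<exists>p. \<forall>x. x \<noteq> 0 \<longrightarrow> poly p x = x ^ M * ev (upd \<zeta> j x) a"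
proof (induction a rule: laurent_induct)
  case (single m c)
  define C where "C = (\<Prod>i\<in>UNIV - {j}. \<zeta>$i powi (m$i))"
  show ?case
  proof (intro exI allI impI)
    fix M x assume M: "nat \<bar>m$j\<bar> \<le> M" and x: "(x::complex) \<noteq> 0"
    have "ev (upd \<zeta> j x) (Poly_Mapping.single m c) = c * (\<Prod>i\<in>UNIV. upd \<zeta> j x $ i powi (m$i))"
      by (simp add: ev_def mode_def)
    also have "(\<Prod>i\<in>UNIV. upd \<zeta> j x $ i powi (m$i)) = x powi (m$j) * C"
      unfolding C_def by (subst prod.remove[of _ j]) (auto simp: upd_def intro!: prod.cong)
    finally have "x ^ M * ev (upd \<zeta> j x) (Poly_Mapping.single m c) = c * C * (x powi int M * x powi (m$j))"
      by (simp add: mult_ac)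
    also have "x powi int M * x powi (m$j) = x powi (int M + m$j)"
      using x by (subst power_int_add) auto
    also have "\<dots> = x ^ nat (int M + m$j)"
      using M by (simp add: power_int_def)
    finally show "poly (monom (c * C) (nat (int M + m$j))) x = x ^ M * ev (upd \<zeta> j x) (Poly_Mapping.single m c)"
      by (simp add: poly_monom)
  qed
next
  case (add a b)
  then obtain Ma Mb where M:
    "\<And>M. M \<ge> Ma \<Longrightarrow> \<exists>p. \<forall>x. x \<noteq> 0 \<longrightarrow> poly p x = x ^ M * ev (upd \<zeta> j x) a"
    "\<And>M. M \<ge> Mb \<Longrightarrow> \<exists>p. \<forall>x. x \<noteq> 0 \<longrightarrow> poly p x = x ^ M * ev (upd \<zeta> j x) b" by blast
  show ?case
  proof (intro exI[of _ "max Ma Mb"] allI impI)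
    fix M assume "max Ma Mb \<le> M"
    then obtain p q where "\<forall>x. x \<noteq> 0 \<longrightarrow> poly p x = x ^ M * ev (upd \<zeta> j x) a"
      "\<forall>x. x \<noteq> 0 \<longrightarrow> poly q x = x ^ M * ev (upd \<zeta> j x) b" using M by fastforce
    then show "\<exists>p. \<forall>x. x \<noteq> 0 \<longrightarrow> poly p x = x ^ M * ev (upd \<zeta> j x) (a + b)"
      by (intro exI[of _ "p + q"]) (simp add: algebra_simps)
  qed
qed

lemma poly_eq_0_if_infinite:
  assumes "infinite X" "\<And>x. x \<in> X \<Longrightarrow> poly p x = (0::complex)"
  shows "p = 0"
proof (rule ccontr)
  assume "p \<noteq> 0"
  then have "finite {x. poly p x = 0}" by (rule poly_roots_finite)
  moreover have "X \<subseteq> {x. poly p x = 0}" using assms(2) by blast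
  ultimately show False using assms(1) finite_subset by blast
qed

lemma ev_vanishes_if_infinite:
  assumes "\<And>i. \<zeta>$i \<noteq> 0" "infinite X" "\<And>x. x \<in> X \<Longrightarrow> x \<noteq> 0 \<and> ev (upd \<zeta> j x) a = 0" "x \<noteq> 0"
  shows "ev (upd \<zeta> j x) a = 0"
proof -
  obtain M p where p: "\<forall>x. x \<noteq> 0 \<longrightarrow> poly p x = x ^ M * ev (upd \<zeta> j x) a"
    using ev_polynomial[OF assms(1)] by blast
  have "p = 0" using assms(2,3) p by (intro poly_eq_0_if_infinite[of X]) auto
  then show ?thesis using p assms(4) by (auto dest: spec[of _ x])
qed

text \<open>Discrete Fourier inversion recovers each coefficient as a finite average of values, once
  the period of the grid exceeds the support.\<close>

lemma laurent_eq_0: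
  assumes a: "a \<in> free 3" and ev: "\<And>\<zeta>. (\<And>i. \<zeta>$i \<noteq> 0) \<Longrightarrow> ev \<zeta> a = 0"
  shows "a = 0"
proof (rule poly_mapping_eqI)
  fix n
  obtain K where K: "K > 0" "\<And>m. m \<in> supp a \<Longrightarrow> real_of_int (l1norm m) \<le> K"
    using l1norm_bound[of "supp a"] by auto
  define N where "N = nat \<lceil>real_of_int (l1norm n) + K\<rceil> + 1"
  have "coords 1 2 3" "N > 0" "real_of_int (l1norm n) + K < real N"
    using K(1) by (auto simp: coords_def N_def) linarith
  then have "coef a n = act a (wave 1 2 3 N 0 0 (\<lambda>_ _. delta)) n"
    using act_periodic_delta K(2) by metis
  also have "\<dots> = 0"
    unfolding act_wave by (simp add: act_free_mode[OF a] ev)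
  finally show "coef a n = coef 0 n" by simp
qed

lemma free_eq_0:
  assumes a: "a \<in> free 3" and X: "infinite X" "0 \<notin> X"
    and Y: "\<And>x. x \<in> X \<Longrightarrow> \<exists>Y. infinite Y \<and> 0 \<notin> Y \<and> (\<forall>y\<in>Y. ev (vector [x, y, 1]) a = 0)"
  shows "a = 0"
proof (rule laurent_eq_0[OF a])
  have upd: "upd (vector [x, y, z]) 1 t = vector [t, y, z]" "upd (vector [x, y, z]) 2 t = vector [x, t, z]"
    for x y z t by (simp_all add: upd_def vec_eq_iff forall_3)
  have nz: "vector [x, y, z] $ i \<noteq> 0" if "x \<noteq> 0" "y \<noteq> 0" "z \<noteq> 0" for x y z :: complex and i :: 3
    using that exhaust_3[of i] by auto
  have 1: "ev (vector [x, y, 1]) a = 0" if "x \<in> X" "y \<noteq> 0" for x y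
  proof -
    obtain Y where "infinite Y" "0 \<notin> Y" "\<forall>y\<in>Y. ev (vector [x, y, 1]) a = 0" using Y \<open>x \<in> X\<close> by blast
    then have "ev (upd (vector [x, 1, 1]) 2 y) a = 0"
      using that X(2) by (intro ev_vanishes_if_infinite[of _ Y] nz) (auto simp: upd)
    then show ?thesis by (simp add: upd)
  qed
  have 2: "ev (vector [x, y, 1]) a = 0" if "x \<noteq> 0" "y \<noteq> 0" for x y
  proof -
    have "ev (upd (vector [1, y, 1]) 1 x) a = 0"
      using that X 1 by (intro ev_vanishes_if_infinite[of _ X] nz) (auto simp: upd)
    then show ?thesis by (simp add: upd)
  qed
  fix \<zeta> :: "complex^3" assume "\<And>i. \<zeta>$i \<noteq> 0"
  then have "ev (vector [\<zeta>$1, \<zeta>$2, 1]) a = 0" by (intro 2) auto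
  moreover have "ev \<zeta> a = ev (vector [\<zeta>$1, \<zeta>$2, 1]) a"
  proof (rule ev_free_cong[OF a])
    fix i :: 3 assume "i \<noteq> 3"
    then show "\<zeta>$i = vector [\<zeta>$1, \<zeta>$2, 1] $ i" using exhaust_3[of i] by auto
  qed
  ultimately show "ev \<zeta> a = 0" by simp
qed

lemma infinite_cis:
  assumes "a < b"
  shows "infinite (cis ` {a<..<b})"
proof -
  define b' where "b' = min b (a + pi)"
  have "inj_on cis {a<..<b'}"
  proof (rule inj_onI)
    fix s t assume st: "s \<in> {a<..<b'}" "t \<in> {a<..<b'}" "cis s = cis t"
    then have "cis (s - t) = 1" by (simp flip: cis_divide)
    then have "cos (s - t) = 1" by (simp add: complex_eq_iff)
    then obtain k :: int where k: "s - t = of_int k * 2 * pi" by (auto simp: cos_one_2pi_int)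
    have "\<bar>s - t\<bar> < 2 * pi" using st by (auto simp: b'_def) 
    then have "\<bar>of_int k\<bar> * (2 * pi) < 1 * (2 * pi)" unfolding k by (simp add: abs_mult mult.assoc)
    then have "\<bar>real_of_int k\<bar> < 1" by (subst (asm) mult_less_cancel_right_pos) auto
    then have "k = 0" by linarith
    then show "s = t" using k by simp
  qed
  moreover have "infinite {a<..<b'}" using assms by (simp add: b'_def infinite_Ioo)
  ultimately have "infinite (cis ` {a<..<b'})" by (simp add: finite_image_iff)
  moreover have "cis ` {a<..<b'} \<subseteq> cis ` {a<..<b}" by (auto simp: b'_def)
  ultimately show ?thesis using finite_subset by blast
qed

text \<open>An open piece of the real torus contains infinitely many points in each variable
  separately, enough to determine a Laurent polynomial. The third coordinate \<open>h x\<close> lets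
  facts about points of a graph be used directly.\<close>

lemma free_eq_0_torus:
  assumes a: "a \<in> free 3" and U: "open U" "p \<in> U"
    and ev: "\<And>x. x \<in> U \<Longrightarrow> ev (torus (fst x) (snd x) (h x)) a = 0"
  shows "a = 0"
proof -
  obtain d where d: "d > 0" "ball p d \<subseteq> U" using U openE by blast
  have inU: "(fst p + s, snd p + t) \<in> U" if "\<bar>s\<bar> < d / 2" "\<bar>t\<bar> < d / 2" for s t
  proof -
    have "dist (fst p + s, snd p + t) p \<le> \<bar>s\<bar> + \<bar>t\<bar>"
      by (cases p) (simp add: dist_Pair_Pair dist_real_def sqrt_sum_squares_le_sum_abs)
    then show ?thesis using that d(2) by (auto simp: dist_commute subset_iff)
  qed
  have ev0: "ev (vector [cis s, cis t, 1]) a = 0" if "(s, t) \<in> U" for s t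
  proof -
    have "ev (vector [cis s, cis t, 1]) a = ev (torus s t (h (s, t))) a"
    proof (rule ev_free_cong[OF a])
      fix i :: 3 assume "i \<noteq> 3"
      then show "vector [cis s, cis t, 1] $ i = torus s t (h (s, t)) $ i" using exhaust_3[of i] by auto
    qed
    then show ?thesis using ev[OF that] by simp
  qed
  show ?thesis
  proof (rule free_eq_0[OF a])
    show "infinite (cis ` {fst p<..<fst p + d / 2})" using d by (intro infinite_cis) simp
    fix x assume "x \<in> cis ` {fst p<..<fst p + d / 2}"
    then obtain s where s: "x = cis s" "s - fst p > 0" "s - fst p < d / 2" by auto
    show "\<exists>Y. infinite Y \<and> 0 \<notin> Y \<and> (\<forall>y\<in>Y. ev (vector [x, y, 1]) a = 0)"
    proof (intro exI[of _ "cis ` {snd p<..<snd p + d / 2}"] conjI ballI)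
      show "infinite (cis ` {snd p<..<snd p + d / 2})" using d by (intro infinite_cis) simp
      fix y assume "y \<in> cis ` {snd p<..<snd p + d / 2}"
      then obtain t where t: "y = cis t" "t - snd p > 0" "t - snd p < d / 2" by auto
      show "ev (vector [x, y, 1]) a = 0"
        using inU[of "s - fst p" "t - snd p"] s t by (simp add: ev0)
    qed auto
  qed auto
qed

text \<open>Over the polynomials in \<open>zop 3\<close> the shift \<open>S\<close> satisfies a
  monic equation of degree four with constant term 1. Hence \<open>S\<close> and its inverse
  preserve combinations of \<open>1\<close>, \<open>S\<close>, \<open>S^2\<close>,
  \<open>S^3\<close>.\<close>

lemma shift3_4: "shift 3 1 * (shift 3 1 * (shift 3 1 * shift 3 1)) = (2 - 4 * zop 3) * (shift 3 1 * shift 3 1) - 1"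
proof -
  have s2: "shift 3 1 * shift 3 1 = shift 3 2" by (simp flip: shift_add)
  have c: "4 * const (1 / 4) = 1"
    by (simp flip: const_hom(7) const_hom(2)) (simp add: const_hom)
  have "(2 - 4 * zop 3) * (shift 3 1 * shift 3 1) - 1 =
      (2 - (4 * const (1 / 4)) * (2 - shift 3 2 - shift 3 (- 2))) * shift 3 2 - 1"
    unfolding zop_def s2 by (simp add: mult.assoc)
  also have "\<dots> = shift 3 2 * shift 3 2 + shift 3 2 * shift 3 (- 2) - 1"
    unfolding c by (simp add: algebra_simps)
  also have "\<dots> = shift 3 2 * shift 3 2" by (simp add: shift_inverse)
  also have "\<dots> = shift 3 1 * (shift 3 1 * (shift 3 1 * shift 3 1))"
    by (simp add: mult.assoc flip: s2)
  finally show ?thesis by simp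
qed

text \<open>\<open>T\<close> stands for the remainders of division by \<open>P\<close> in
  \<open>zop 3\<close>: free of the third variable if \<open>P\<close> is linear in
  \<open>zop 3\<close>, affine in \<open>zop 3\<close> if \<open>P\<close> is quadratic. The last
  hypothesis is a single division step; it makes \<open>G\<close> stable under the shift and its
  inverse, so that \<open>G\<close> is everything.\<close>

lemma laurent_division:
  assumes T: "\<And>s t. s \<in> T \<Longrightarrow> t \<in> T \<Longrightarrow> s + t \<in> T" "\<And>a t. a \<in> free 3 \<Longrightarrow> t \<in> T \<Longrightarrow> a * t \<in> T"
      "1 \<in> T" "\<And>t. t \<in> T \<Longrightarrow> \<exists>t'\<in>T. \<exists>h. zop 3 * t = P * h + t'"
  shows "\<exists>h. \<exists>t0\<in>T. \<exists>t1\<in>T. \<exists>t2\<in>T. \<exists>t3\<in>T.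
    g = P * h + (t0 + t1 * shift 3 1 + t2 * (shift 3 1 * shift 3 1) + t3 * (shift 3 1 * (shift 3 1 * shift 3 1)))"
proof -
  let ?s = "shift 3 1"
  define G where "G = {g. \<exists>h. \<exists>t0\<in>T. \<exists>t1\<in>T. \<exists>t2\<in>T. \<exists>t3\<in>T.
    g = P * h + (t0 + t1 * ?s + t2 * (?s * ?s) + t3 * (?s * (?s * ?s)))}"
  have GI: "P * h + (t0 + t1 * ?s + t2 * (?s * ?s) + t3 * (?s * (?s * ?s))) \<in> G"
    if "t0 \<in> T" "t1 \<in> T" "t2 \<in> T" "t3 \<in> T" for h t0 t1 t2 t3
    using that unfolding G_def by blast
  have T0: "0 \<in> T" using T(2)[of 0 1] T(3) by simp
  have Tm: "- t \<in> T" if "t \<in> T" for t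
  proof -
    have "const (- 1) * t \<in> T" by (rule T(2)[OF free_const that])
    then show ?thesis by (simp add: const_hom)
  qed
  have GE: "\<exists>h. \<exists>t0\<in>T. \<exists>t1\<in>T. \<exists>t2\<in>T. \<exists>t3\<in>T. g = P * h + (t0 + t1 * ?s + t2 * (?s * ?s) + t3 * (?s * (?s * ?s)))"
    if "g \<in> G" for g using that by (simp add: G_def)
  have Gadd: "a + b \<in> G" if ab: "a \<in> G" "b \<in> G" for a b
  proof -
    obtain h t0 t1 t2 t3 where 1: "t0 \<in> T" "t1 \<in> T" "t2 \<in> T" "t3 \<in> T"
      "a = P * h + (t0 + t1 * ?s + t2 * (?s * ?s) + t3 * (?s * (?s * ?s)))" using GE[OF ab(1)] by blast
    obtain h' t0' t1' t2' t3' where 2: "t0' \<in> T" "t1' \<in> T" "t2' \<in> T" "t3' \<in> T"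
      "b = P * h' + (t0' + t1' * ?s + t2' * (?s * ?s) + t3' * (?s * (?s * ?s)))" using GE[OF ab(2)] by blast
    have "a + b = P * (h + h') + ((t0 + t0') + (t1 + t1') * ?s + (t2 + t2') * (?s * ?s) + (t3 + t3') * (?s * (?s * ?s)))"
      unfolding 1(5) 2(5) by (simp add: algebra_simps)
    also have "\<dots> \<in> G" by (intro GI T(1) 1(1-4) 2(1-4))
    finally show ?thesis .
  qed
  have Gfree: "a * b \<in> G" if ab: "a \<in> free 3" "b \<in> G" for a b
  proof -
    obtain h t0 t1 t2 t3 where 1: "t0 \<in> T" "t1 \<in> T" "t2 \<in> T" "t3 \<in> T"
      "b = P * h + (t0 + t1 * ?s + t2 * (?s * ?s) + t3 * (?s * (?s * ?s)))" using GE[OF ab(2)] by blast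
    have "a * b = P * (a * h) + (a * t0 + a * t1 * ?s + a * t2 * (?s * ?s) + a * t3 * (?s * (?s * ?s)))"
      unfolding 1(5) by (simp add: algebra_simps)
    also have "\<dots> \<in> G" by (intro GI T(2)[OF ab(1)] 1(1-4))
    finally show ?thesis .
  qed
  have red: "\<exists>t'\<in>T. \<exists>h. t + (2 - 4 * zop 3) * s = P * h + t'" if st: "s \<in> T" "t \<in> T" for s t
  proof -
    obtain t' h where t': "t' \<in> T" "zop 3 * s = P * h + t'" using T(4)[OF st(1)] by blast
    have "t + (2 - 4 * zop 3) * s = t + 2 * s - 4 * (zop 3 * s)" by (simp add: algebra_simps)
    also have "\<dots> = P * (- 4 * h) + (t + 2 * s + - (4 * t'))" unfolding t'(2) by (simp add: algebra_simps)
    finally have "t + (2 - 4 * zop 3) * s = P * (- 4 * h) + (t + 2 * s + - (4 * t'))" .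
    moreover have "t + 2 * s + - (4 * t') \<in> T"
      by (intro T(1) Tm T(2)[OF free_numeral(1)] st t'(1))
    ultimately show ?thesis by metis
  qed
  have Gup: "?s * b \<in> G" if b: "b \<in> G" for b
  proof -
    obtain h t0 t1 t2 t3 where 1: "t0 \<in> T" "t1 \<in> T" "t2 \<in> T" "t3 \<in> T"
      "b = P * h + (t0 + t1 * ?s + t2 * (?s * ?s) + t3 * (?s * (?s * ?s)))" using GE[OF b] by blast
    obtain t' h' where t': "t' \<in> T" "t1 + (2 - 4 * zop 3) * t3 = P * h' + t'" using red[OF 1(4,2)] by blast
    have "?s * b = P * (?s * h) + (t0 * ?s + t1 * (?s * ?s) + t2 * (?s * (?s * ?s)) + t3 * (?s * (?s * (?s * ?s))))"
      unfolding 1(5) by (simp only: distrib_left mult_ac)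
    also have "\<dots> = P * (?s * h) + (- t3 + t0 * ?s + (t1 + (2 - 4 * zop 3) * t3) * (?s * ?s) + t2 * (?s * (?s * ?s)))"
      unfolding shift3_4 by (simp add: algebra_simps)
    also have "\<dots> = P * (?s * h + h' * (?s * ?s)) + (- t3 + t0 * ?s + t' * (?s * ?s) + t2 * (?s * (?s * ?s)))"
      unfolding t'(2) by (simp add: algebra_simps)
    also have "\<dots> \<in> G" by (intro GI Tm t'(1) 1(1-4))
    finally show ?thesis .
  qed
  have Gdown: "shift 3 (- 1) * b \<in> G" if b: "b \<in> G" for b
  proof -
    obtain h t0 t1 t2 t3 where 1: "t0 \<in> T" "t1 \<in> T" "t2 \<in> T" "t3 \<in> T"
      "b = P * h + (t0 + t1 * ?s + t2 * (?s * ?s) + t3 * (?s * (?s * ?s)))" using GE[OF b] by blast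
    obtain t' h' where t': "t' \<in> T" "t2 + (2 - 4 * zop 3) * t0 = P * h' + t'" using red[OF 1(1,3)] by blast
    define u where "u = shift 3 (- 1)"
    have us: "u * (?s * x) = x" for x
    proof -
      have "u * ?s = 1" unfolding u_def by (simp flip: shift_add)
      then show ?thesis by (metis mult.assoc mult_1_left)
    qed
    have us1: "u * ?s = 1" using us[of 1] by simp
    have u: "u = (2 - 4 * zop 3) * ?s - ?s * (?s * ?s)"
    proof -
      have "1 = (2 - 4 * zop 3) * (?s * ?s) - ?s * (?s * (?s * ?s))" unfolding shift3_4 by simp
      then have "u * 1 = u * ((2 - 4 * zop 3) * (?s * ?s) - ?s * (?s * (?s * ?s)))" by simp
      also have "\<dots> = (2 - 4 * zop 3) * (u * (?s * ?s)) - u * (?s * (?s * (?s * ?s)))"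
        by (simp add: right_diff_distrib mult_ac)
      also have "\<dots> = (2 - 4 * zop 3) * ?s - ?s * (?s * ?s)" unfolding us ..
      finally show ?thesis by simp
    qed
    have "u * b = P * (u * h) + (t0 * u + t1 * (u * ?s) + t2 * (u * (?s * ?s)) + t3 * (u * (?s * (?s * ?s))))"
      unfolding 1(5) by (simp only: distrib_left mult_ac)
    also have "\<dots> = P * (u * h) + (t0 * ((2 - 4 * zop 3) * ?s - ?s * (?s * ?s)) + t1 + t2 * ?s + t3 * (?s * ?s))"
      unfolding us us1 by (subst (2) u) (simp only: mult_1_right)
    also have "\<dots> = P * (u * h) + (t1 + (t2 + (2 - 4 * zop 3) * t0) * ?s + t3 * (?s * ?s) + - t0 * (?s * (?s * ?s)))"
      by (simp add: algebra_simps)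
    also have "\<dots> = P * (u * h + h' * ?s) + (t1 + t' * ?s + t3 * (?s * ?s) + - t0 * (?s * (?s * ?s)))"
      unfolding t'(2) by (simp add: algebra_simps)
    also have "\<dots> \<in> G" by (intro GI Tm t'(1) 1(1-4))
    finally show ?thesis by (simp only: u_def)
  qed
  have "1 \<in> G" using GI[of 1 0 0 0 0] T(3) T0 by simp
  have Gshift: "shift 3 k \<in> G" for k
  proof (induction k rule: int_induct[where k = 0])
    case base
    show ?case using \<open>1 \<in> G\<close> by simp
  next
    case (step1 i)
    then show ?case using Gup[of "shift 3 i"] by (simp add: add.commute flip: shift_add)
  next
    case (step2 i)
    have "shift 3 (i - 1) = shift 3 (- 1) * shift 3 i" by (simp flip: shift_add)
    then show ?case using Gdown[of "shift 3 i"] step2 by simp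
  qed
  have "g \<in> G"
  proof (induction g rule: laurent_induct)
    case (single m c)
    have "m = axis 1 (m$1) + (axis 2 (m$2) + axis 3 (m$3))"
      by (simp add: vec_eq_iff forall_3 axis_def)
    then have "Poly_Mapping.single m c = (const c * shift 1 (m$1) * shift 2 (m$2)) * shift 3 (m$3)"
      by (simp add: const_def shift_def mult_single add.assoc)
    moreover have "const c * shift 1 (m$1) * shift 2 (m$2) \<in> free 3"
      by (intro free_mult free_const free_shift) auto
    ultimately show ?case using Gfree Gshift by metis
  qed (rule Gadd)
  then show ?thesis by (rule GE)
qed

text \<open>These four points are the values of \<open>cis x3\<close> belonging to one value of
  \<open>sin^2\<close>. The two signs separate even and odd part, leaving affine functions of
  \<open>x^2\<close> with two distinct zeros.\<close>

lemma cubic_four_roots: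
  fixes t0 t1 t2 t3 \<eta> :: complex
  assumes "\<eta> \<noteq> 0" "\<eta> * \<eta> * \<eta> * \<eta> \<noteq> 1"
    and roots: "\<And>x. x \<in> {\<eta>, - \<eta>, 1 / \<eta>, - (1 / \<eta>)} \<Longrightarrow> t0 + t1 * x + t2 * (x * x) + t3 * (x * (x * x)) = 0"
  shows "t0 = 0 \<and> t1 = 0 \<and> t2 = 0 \<and> t3 = 0"
proof -
  have pm: "t0 + t2 * (x * x) = 0 \<and> t1 + t3 * (x * x) = 0" if x: "x \<in> {\<eta>, 1 / \<eta>}" for x
  proof -
    have "x \<noteq> 0" using x assms(1) by auto
    have 1: "t0 + t1 * x + t2 * (x * x) + t3 * (x * (x * x)) = 0" using roots[of x] x by auto
    have 2: "t0 - t1 * x + t2 * (x * x) - t3 * (x * (x * x)) = 0" using roots[of "- x"] x by auto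
    have "2 * (t0 + t2 * (x * x)) = (t0 + t1 * x + t2 * (x * x) + t3 * (x * (x * x))) +
        (t0 - t1 * x + t2 * (x * x) - t3 * (x * (x * x)))"
      "(2 * x) * (t1 + t3 * (x * x)) = (t0 + t1 * x + t2 * (x * x) + t3 * (x * (x * x))) -
        (t0 - t1 * x + t2 * (x * x) - t3 * (x * (x * x)))"
      by (simp_all add: algebra_simps)
    then have "2 * (t0 + t2 * (x * x)) = 0" "(2 * x) * (t1 + t3 * (x * x)) = 0"
      unfolding 1 2 by simp_all
    then show ?thesis using \<open>x \<noteq> 0\<close> by (metis mult_eq_0_iff zero_neq_numeral)
  qed
  have e: "\<eta> * \<eta> - 1 / \<eta> * (1 / \<eta>) \<noteq> 0"
    using assms(1,2) by (simp add: field_simps)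
  have 1: "t0 + t2 * (\<eta> * \<eta>) = 0" "t1 + t3 * (\<eta> * \<eta>) = 0"
    and 2: "t0 + t2 * (1 / \<eta> * (1 / \<eta>)) = 0" "t1 + t3 * (1 / \<eta> * (1 / \<eta>)) = 0"
    using pm[of \<eta>] pm[of "1 / \<eta>"] by blast+
  have "t2 * (\<eta> * \<eta> - 1 / \<eta> * (1 / \<eta>)) = 0" "t3 * (\<eta> * \<eta> - 1 / \<eta> * (1 / \<eta>)) = 0"
    using 1 2 by (simp_all add: right_diff_distrib add_eq_0_iff2)
  then have "t2 = 0" "t3 = 0" using e by auto
  then show ?thesis using 1 by simp
qed

text \<open>Parity of the order of vanishing. The map from \<open>x\<close> to \<open>z\<close>
  ramifies only over 0 and 1, values which the hypotheses keep away from the roots. Above the simple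
  root \<open>r1\<close> there is then a point at which the right-hand side has odd order, while a
  square has even order.\<close>

lemma square_times_nonsquare:
  fixes S T :: "complex poly"
  assumes d: "d2 \<noteq> 0" "d1 * d1 - 4 * d2 * d0 \<noteq> 0" "d0 \<noteq> 0" "d2 + d1 + d0 \<noteq> 0"
    and eq: "\<And>x z. x \<noteq> 0 \<Longrightarrow> z = (2 - x\<^sup>2 - 1 / x\<^sup>2) / 4 \<Longrightarrow>
      poly S x * poly S x = (d2 * z * z + d1 * z + d0) * (poly T x * poly T x)"
  shows "T = 0"
proof (rule ccontr)
  assume T: "T \<noteq> 0"
  obtain r1 r2 where r: "d1 = - d2 * (r1 + r2)" "d0 = d2 * r1 * r2"
    using quadratic_roots[OF d(1)] by blast
  have "d1 * d1 - 4 * d2 * d0 = (d2 * (r1 - r2))\<^sup>2" "d2 + d1 + d0 = d2 * (1 - r1) * (1 - r2)"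
    unfolding r by (simp_all add: power2_eq_square algebra_simps)
  then have neq: "r1 \<noteq> r2" "r1 \<noteq> 0" "r1 \<noteq> 1" using d r by auto
  obtain w where w: "w \<noteq> 0" "w + 1 / w = 2 - 4 * r1" using joukowski by metis
  define \<eta> where "\<eta> = csqrt w"
  have \<eta>: "\<eta> * \<eta> = w" "\<eta> \<noteq> 0" using w(1) by (simp_all add: \<eta>_def flip: power2_eq_square)
  have "w * w \<noteq> 1"
  proof
    assume "w * w = 1"
    then have "w = 1 \<or> w = - 1" by (simp add: square_eq_1_iff)
    then show False using w(2) neq by auto
  qed
  \<comment> \<open>\<open>G r\<close> equals \<open>- 4 x^2 (z - r)\<close>, with the denominators
    of \<open>z\<close> cleared.\<close>
  define G where "G = (\<lambda>r. [:1, 0, - (2 - 4 * r), 0, 1 :: complex:])"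
  have G: "poly (G r) x = x^4 - (2 - 4 * r) * x\<^sup>2 + 1" for r x
    by (simp add: G_def algebra_simps power2_eq_square power4_eq_xxxx)
  have polyeq: "[:0, 1:] ^ 4 * (S * S) = smult (d2 / 16) (G r1 * G r2) * (T * T)" (is "?l = ?r")
  proof -
    have "poly (?l - ?r) x = 0" if "x \<in> UNIV - {0}" for x
    proof -
      have x: "x \<noteq> 0" using that by simp
      define z where "z = (2 - x\<^sup>2 - 1 / x\<^sup>2) / 4"
      have zr: "x\<^sup>2 * (z - r) = - (poly (G r) x / 4)" for r
        unfolding G z_def using x by (simp add: field_simps power2_eq_square power4_eq_xxxx)
      have "x^4 * (poly S x * poly S x) = x^4 * ((d2 * z * z + d1 * z + d0) * (poly T x * poly T x))"
        using eq[OF x z_def] by simp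
      also have "\<dots> = d2 * (x\<^sup>2 * (z - r1)) * (x\<^sup>2 * (z - r2)) * (poly T x * poly T x)"
        unfolding r by (simp add: power2_eq_square power4_eq_xxxx algebra_simps)
      also have "\<dots> = d2 / 16 * (poly (G r1) x * poly (G r2) x) * (poly T x * poly T x)"
        unfolding zr by simp
      finally show ?thesis by simp
    qed
    then have "?l - ?r = 0"
      by (intro poly_eq_0_if_infinite[of "UNIV - {0}"]) (auto simp: infinite_UNIV_char_0)
    then show ?thesis by simp
  qed
  have Gnz: "G r \<noteq> 0" for r by (simp add: G_def)
  have "G r1 = [:- \<eta>, 1:] * ([:\<eta>, 1:] * [:- (1 / w), 0, 1:])"
    unfolding G_def w(2)[symmetric] using \<eta> w(1) by (simp add: algebra_simps)
  moreover have "order \<eta> ([:\<eta>, 1:] * [:- (1 / w), 0, 1:]) = 0"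
    using \<eta> w(1) \<open>w * w \<noteq> 1\<close> by (intro order_0I) (auto simp: field_simps)
  moreover have "order \<eta> [:- \<eta>, 1:] = 1" using order_power_n_n[of \<eta> 1] by simp
  ultimately have o1: "order \<eta> (G r1) = 1"
    using Gnz[of r1] order_mult by (metis add_0_right)
  have "poly (G r2) \<eta> = poly (G r1) \<eta> + 4 * (r2 - r1) * w"
    unfolding G by (simp add: algebra_simps power2_eq_square \<eta>)
  moreover have "poly (G r1) \<eta> = 0" using o1 by (metis order_root zero_neq_one)
  ultimately have o2: "order \<eta> (G r2) = 0"
    using neq w(1) by (intro order_0I) auto
  have "?l \<noteq> 0" using polyeq T Gnz d(1) by (simp only: polyeq) (simp add: no_zero_divisors)
  then have S: "S \<noteq> 0" by auto
  have "order \<eta> ([:0, 1:] ^ 4) = 0" using \<eta>(2) by (intro order_0I) simp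
  then have "order \<eta> ?l = 2 * order \<eta> S"
    using S by (simp add: order_mult)
  moreover have "order \<eta> ?r = 1 + 2 * order \<eta> T"
    using T Gnz d(1) o1 o2 by (simp add: order_mult order_smult)
  ultimately have "2 * order \<eta> S = 1 + 2 * order \<eta> T" by (simp only: polyeq)
  then show False by presburger
qed

section \<open>Scalar Rellich theorems\<close>

lemma sin_arcsin_sqrt: "0 \<le> z \<Longrightarrow> z \<le> 1 \<Longrightarrow> (sin (arcsin (sqrt z)))\<^sup>2 = z"
  by (subst sin_arcsin) (auto intro: order_trans[of _ 0])

text \<open>Over a point of \<open>U\<close> the four graphs \<open>\<theta>\<close>,
  \<open>\<theta> + pi\<close>, \<open>- \<theta>\<close>, \<open>pi - \<theta>\<close> have the
  same \<open>sin^2\<close>. Both \<open>P\<close> and, by \<open>symbol_vanishes\<close>,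
  \<open>g\<close> are zero on all of them, and each remainder coefficient has one common value
  there. These values are the coefficients of a cubic in \<open>cis x3\<close> with four
  roots.\<close>

lemma remainder_vanishes:
  fixes r :: "real \<times> real \<Rightarrow> real"
  assumes v: "v \<in> Bstar" "act P v = coef g"
    and U: "open U" "continuous_on U r" "\<And>x. x \<in> U \<Longrightarrow> 0 < r x \<and> r x < 1"
    and P: "\<And>x x3. x \<in> U \<Longrightarrow> (sin x3)\<^sup>2 = r x \<Longrightarrow> ev (torus (fst x) (snd x) x3) P = 0"
    and g: "g = P * h + (t0 + t1 * shift 3 1 + t2 * (shift 3 1 * shift 3 1) + t3 * (shift 3 1 * (shift 3 1 * shift 3 1)))"
    and T: "\<And>t x x3 x3'. t \<in> {t0, t1, t2, t3} \<Longrightarrow> (sin x3)\<^sup>2 = (sin x3')\<^sup>2 \<Longrightarrow>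
      ev (torus (fst x) (snd x) x3) t = ev (torus (fst x) (snd x) x3') t"
    and x: "x \<in> U" and t: "t \<in> {t0, t1, t2, t3}"
  shows "ev (torus (fst x) (snd x) (arcsin (sqrt (r x)))) t = 0"
proof -
  define \<theta> where "\<theta> = (\<lambda>x. arcsin (sqrt (r x)))"
  have sq: "0 < sqrt (r x)" "sqrt (r x) < 1" if "x \<in> U" for x using U(3)[OF that] by auto
  have sin\<theta>: "sin (\<theta> x) = sqrt (r x)" "(sin (\<theta> x))\<^sup>2 = r x" if "x \<in> U" for x
  proof -
    show "sin (\<theta> x) = sqrt (r x)"
      unfolding \<theta>_def using sq[OF that] by (intro sin_arcsin) linarith+
    then show "(sin (\<theta> x))\<^sup>2 = r x" using U(3)[OF that] by simp
  qed
  have cos\<theta>: "cos (\<theta> x) \<noteq> 0"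
    using sin\<theta>(2)[OF x] U(3)[OF x] by (auto simp: sin_squared_eq)
  have cont: "continuous_on U \<theta>"
  proof -
    have "\<forall>x\<in>U. - 1 \<le> sqrt (r x) \<and> sqrt (r x) \<le> 1"
    proof
      fix x assume "x \<in> U"
      then show "- 1 \<le> sqrt (r x) \<and> sqrt (r x) \<le> 1" using sq[of x] by linarith
    qed
    then show ?thesis unfolding \<theta>_def using U(2) by (intro continuous_intros)
  qed
  have ev_g: "ev (torus (fst x) (snd x) y) g = 0" if y: "y \<in> {\<theta> x, \<theta> x + pi, - \<theta> x, pi - \<theta> x}" for y
  proof -
    have van: "ev (torus (fst x) (snd x) (h' x)) g = 0"
      if "continuous_on U h'" "\<And>x. x \<in> U \<Longrightarrow> (sin (h' x))\<^sup>2 = r x" for h'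
      using symbol_vanishes[OF v U(1) that(1) _ x] P that(2) by blast
    have "continuous_on U (\<lambda>x. \<theta> x + pi)" "continuous_on U (\<lambda>x. - \<theta> x)" "continuous_on U (\<lambda>x. pi - \<theta> x)"
      by (intro continuous_intros cont)+
    then show ?thesis
      using y van[OF cont] van[of "\<lambda>x. \<theta> x + pi"] van[of "\<lambda>x. - \<theta> x"] van[of "\<lambda>x. pi - \<theta> x"] sin\<theta>(2)
      by fastforce
  qed
  have sin_y: "(sin y)\<^sup>2 = r x" if y: "y \<in> {\<theta> x, \<theta> x + pi, - \<theta> x, pi - \<theta> x}" for y
    using y sin\<theta>(2)[OF x] by auto
  define \<tau> where "\<tau> = (\<lambda>t. ev (torus (fst x) (snd x) (\<theta> x)) t)"
  have poly0: "\<tau> t0 + \<tau> t1 * cis y + \<tau> t2 * (cis y * cis y) + \<tau> t3 * (cis y * (cis y * cis y)) = 0"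
    if y: "y \<in> {\<theta> x, \<theta> x + pi, - \<theta> x, pi - \<theta> x}" for y
  proof -
    have "ev (torus (fst x) (snd x) y) t = \<tau> t" if "t \<in> {t0, t1, t2, t3}" for t
      unfolding \<tau>_def using that sin_y[OF y] sin\<theta>(2)[OF x] by (intro T) simp_all
    moreover have "ev (torus (fst x) (snd x) y) P = 0" using P[OF x sin_y[OF y]] .
    ultimately show ?thesis
      using ev_g[OF y] by (simp add: g ev_mult)
  qed
  have inv: "1 / cis (\<theta> x) = cis (- \<theta> x)" by (simp add: divide_conv_cnj cis_cnj)
  have neg: "cis (\<theta> x + pi) = - cis (\<theta> x)" "cis (pi - \<theta> x) = - cis (- \<theta> x)"
    by (simp_all add: complex_eq_iff)
  \<comment> \<open>The strict bounds \<open>0 < r x < 1\<close> keep the four roots apart.\<close>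
  have "cis (\<theta> x) * cis (\<theta> x) * cis (\<theta> x) * cis (\<theta> x) \<noteq> 1"
  proof
    assume "cis (\<theta> x) * cis (\<theta> x) * cis (\<theta> x) * cis (\<theta> x) = 1"
    then have "cis (2 * \<theta> x) * cis (2 * \<theta> x) = 1" by (simp add: cis_mult)
    then have "cis (2 * \<theta> x) = 1 \<or> cis (2 * \<theta> x) = - 1" by (simp add: square_eq_1_iff)
    then have "sin (2 * \<theta> x) = 0" by (auto simp: complex_eq_iff)
    then show False using cos\<theta> sin\<theta>(1)[OF x] sq(1)[OF x] by (simp add: sin_double)
  qed
  then have "\<tau> t0 = 0 \<and> \<tau> t1 = 0 \<and> \<tau> t2 = 0 \<and> \<tau> t3 = 0"
  proof (rule cubic_four_roots[rotated])
    fix z assume "z \<in> {cis (\<theta> x), - cis (\<theta> x), 1 / cis (\<theta> x), - (1 / cis (\<theta> x))}"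
    then have "z \<in> {cis (\<theta> x), cis (\<theta> x + pi), cis (- \<theta> x), cis (pi - \<theta> x)}"
      by (simp only: inv neg)
    then show "\<tau> t0 + \<tau> t1 * z + \<tau> t2 * (z * z) + \<tau> t3 * (z * (z * z)) = 0"
      using poly0 by blast
  qed simp
  then show ?thesis using t by (auto simp: \<tau>_def \<theta>_def)
qed

definition rellich :: "laurent \<Rightarrow> bool" where
  "rellich P \<longleftrightarrow> (\<forall>v\<in>Bstar. \<forall>g. act P v = coef g \<longrightarrow> (\<exists>h. v = coef h))"

lemma rellich_mult:
  assumes "rellich a" "rellich b"
  shows "rellich (a * b)"
  using assms unfolding rellich_def act_mult using Bstar_act by blast

lemma rellich_const:
  assumes "c \<noteq> 0"
  shows "rellich (const c)"
  unfolding rellich_def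
proof (intro ballI allI impI)
  fix v g assume "act (const c) v = coef g"
  then have cv: "c * v n = coef g n" for n by (simp add: fun_eq_iff)
  have "v n = coef (const (1 / c) * g) n" for n
    unfolding coef_mult act_const cv[symmetric] using assms by simp
  then show "\<exists>h. v = coef h" by auto
qed

lemma rellich_by_division:
  assumes "no_kernel P"
    and "\<And>v g. v \<in> Bstar \<Longrightarrow> act P v = coef g \<Longrightarrow> \<exists>h. g = P * h"
  shows "rellich P"
  unfolding rellich_def
proof (intro ballI allI impI)
  fix v g assume v: "v \<in> Bstar" "act P v = coef g"
  then obtain h where "g = P * h" using assms(2) by blast
  then have "act P (\<lambda>n. v n - coef h n) = (\<lambda>n. 0)"
    using v(2) by (simp add: fun_eq_iff act_diff_right coef_mult)
  then have "(\<lambda>n. v n - coef h n) = (\<lambda>n. 0)"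
    using assms(1) Bstar_diff_coef[OF v(1)] unfolding no_kernel_def by blast
  then show "\<exists>h. v = coef h" by (auto simp: fun_eq_iff)
qed

lemma ev_zop_torus:
  "ev (torus x1 x2 x3) (zop 1) = of_real ((sin x1)\<^sup>2)"
  "ev (torus x1 x2 x3) (zop 2) = of_real ((sin x2)\<^sup>2)"
  "ev (torus x1 x2 x3) (zop 3) = of_real ((sin x3)\<^sup>2)"
  by (simp_all add: ev_zop_cis del: of_real_power)

lemma ev_torus_mult [simp]:
  "ev (torus x1 x2 x3) (a * b) = ev (torus x1 x2 x3) a * ev (torus x1 x2 x3) b"
  by (simp add: ev_mult)

lemma ev_torus_free:
  assumes "a \<in> free 3"
  shows "ev (torus x1 x2 x3) a = ev (torus x1 x2 x3') a"
proof (rule ev_free_cong[OF assms])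
  fix i :: 3 assume "i \<noteq> 3"
  then show "torus x1 x2 x3 $ i = torus x1 x2 x3' $ i" using exhaust_3[of i] by auto
qed

text \<open>With positive coefficients the condition on \<open>k\<close> says that the plane meets
  the interior of the unit cube. The remainders are free of the third variable, so vanishing over an
  open set of the first two kills them.\<close>

lemma rellich_linear:
  fixes c1 c2 c3 k :: real
  assumes c: "c1 > 0" "c2 > 0" "c3 > 0" and k: "0 < k" "k < c1 + c2 + c3"
  shows "rellich (const (of_real c1) * zop 1 + const (of_real c2) * zop 2 + const (of_real c3) * zop 3 + const (of_real (- k)))"
    (is "rellich ?P")
proof (rule rellich_by_division)
  show "no_kernel ?P" using c by (intro no_kernel_linear) auto
  fix v g assume v: "v \<in> Bstar" "act ?P v = coef g"
  define A where "A = const (of_real c1) * zop 1 + const (of_real c2) * zop 2 + const (of_real (- k))"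
  have A: "A \<in> free 3" unfolding A_def by (auto intro!: free_add free_mult free_const free_zop)
  have "\<exists>h. \<exists>t0\<in>free 3. \<exists>t1\<in>free 3. \<exists>t2\<in>free 3. \<exists>t3\<in>free 3.
    g = ?P * h + (t0 + t1 * shift 3 1 + t2 * (shift 3 1 * shift 3 1) + t3 * (shift 3 1 * (shift 3 1 * shift 3 1)))"
  proof (rule laurent_division)
    fix t assume t: "t \<in> free 3"
    have inv: "const (of_real c3) * const (of_real (1 / c3)) = 1"
      using c by (simp flip: const_hom(2)) (simp add: const_hom)
    have "zop 3 * t = (const (of_real c3) * const (of_real (1 / c3))) * (zop 3 * t)" by (simp only: inv mult_1)
    also have "\<dots> = ?P * (const (of_real (1 / c3)) * t) + - (A * (const (of_real (1 / c3)) * t))"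
      unfolding A_def by (simp add: algebra_simps)
    finally show "\<exists>t'\<in>free 3. \<exists>h. zop 3 * t = ?P * h + t'"
      using t A by (intro bexI[of _ "- (A * (const (of_real (1 / c3)) * t))"]) auto
  qed auto
  then obtain h t0 t1 t2 t3 where t: "t0 \<in> free 3" "t1 \<in> free 3" "t2 \<in> free 3" "t3 \<in> free 3"
    and g: "g = ?P * h + (t0 + t1 * shift 3 1 + t2 * (shift 3 1 * shift 3 1) + t3 * (shift 3 1 * (shift 3 1 * shift 3 1)))"
    by blast
  define r where "r = (\<lambda>x::real \<times> real. (k - c1 * (sin (fst x))\<^sup>2 - c2 * (sin (snd x))\<^sup>2) / c3)"
  have cont: "continuous_on X r" for X unfolding r_def using c by (intro continuous_intros) auto
  define U where "U = {x. 0 < r x} \<inter> {x. r x < 1}"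
  have U: "open U" unfolding U_def
    by (intro open_Int open_Collect_less cont continuous_on_const)
  \<comment> \<open>The plane crosses the diagonal of the cube at \<open>(s, s, s)\<close>.\<close>
  define s where "s = k / (c1 + c2 + c3)"
  have s: "0 < s" "s < 1" using c k by (auto simp: s_def field_simps)
  have "k = s * (c1 + c2 + c3)" using c by (simp add: s_def)
  then have "r (arcsin (sqrt s), arcsin (sqrt s)) = s"
    using c s by (simp add: r_def sin_arcsin_sqrt field_simps del: sin_arcsin)
  then have p: "(arcsin (sqrt s), arcsin (sqrt s)) \<in> U" using s by (simp add: U_def)
  have evP: "ev (torus (fst x) (snd x) x3) ?P = 0" if "(sin x3)\<^sup>2 = r x" for x x3
  proof -
    have "c1 * (sin (fst x))\<^sup>2 + c2 * (sin (snd x))\<^sup>2 + c3 * (sin x3)\<^sup>2 - k = 0"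
      unfolding that r_def using c by simp
    then have "of_real (c1 * (sin (fst x))\<^sup>2 + c2 * (sin (snd x))\<^sup>2 + c3 * (sin x3)\<^sup>2 - k) = (0::complex)"
      by (simp only: of_real_0)
    then show ?thesis by (simp add: ev_zop_torus)
  qed
  have van: "t = 0" if "t \<in> {t0, t1, t2, t3}" for t
  proof (rule free_eq_0_torus[OF _ U p])
    show "t \<in> free 3" using that t by auto
    fix x assume "x \<in> U"
    then show "ev (torus (fst x) (snd x) (arcsin (sqrt (r x)))) t = 0"
      using t that by (intro remainder_vanishes[OF v U cont _ evP g]) (auto simp: U_def intro: ev_torus_free)
  qed
  then have "t0 = 0" "t1 = 0" "t2 = 0" "t3 = 0" by simp_all
  with g have "g = ?P * h" by simp
  then show "\<exists>h. g = ?P * h" ..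
qed

lemma of_real_fresnel:
  "fresnel2 (of_real e1) (of_real e2) (of_real m1) (of_real m2) = (of_real (fresnel2 e1 e2 m1 m2) :: complex)"
  "fresnel1 (of_real e1) (of_real e2) (of_real e3) (of_real m1) (of_real m2) (of_real m3) (of_real l) (of_real z1) (of_real z2) =
    (of_real (fresnel1 e1 e2 e3 m1 m2 m3 l z1 z2) :: complex)"
  "fresnel0 (of_real e1) (of_real e2) (of_real e3) (of_real m1) (of_real m2) (of_real m3) (of_real l) (of_real z1) (of_real z2) =
    (of_real (fresnel0 e1 e2 e3 m1 m2 m3 l z1 z2) :: complex)"
  by (simp_all add: fresnel2_def fresnel1_def fresnel0_def)

lemma ev_fresnel:
  assumes "\<And>i. \<zeta>$i \<noteq> 0"
  shows "ev \<zeta> (fresnel1 (const e1) (const e2) (const e3) (const m1) (const m2) (const m3) (const l) a b) =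
      fresnel1 e1 e2 e3 m1 m2 m3 l (ev \<zeta> a) (ev \<zeta> b)"
    "ev \<zeta> (fresnel0 (const e1) (const e2) (const e3) (const m1) (const m2) (const m3) (const l) a b) =
      fresnel0 e1 e2 e3 m1 m2 m3 l (ev \<zeta> a) (ev \<zeta> b)"
    "ev \<zeta> (fresnel_disc (const e1) (const e2) (const e3) (const m1) (const m2) (const m3) (const l) a b) =
      fresnel_disc e1 e2 e3 m1 m2 m3 l (ev \<zeta> a) (ev \<zeta> b)"
  by (simp_all add: fresnel1_def fresnel0_def fresnel_disc_def Let_def ev_mult[OF assms])

text \<open>
  \<open>S\<^sup>2 = \<Delta> T\<^sup>2\<close> forces \<open>T = 0\<close>: for generic \<open>z1\<close> the discriminant \<open>\<Delta>\<close>, as a function of the second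
  Fourier variable, has simple zeros. This is what makes the symbol irreducible although only one of its two
  sheets need meet the real torus.
\<close>

lemma fresnel_disc_not_square:
  fixes e1 e2 e3 m1 m2 m3 l :: complex
  assumes nz: "e1 \<noteq> 0" "e2 \<noteq> 0" "m1 \<noteq> 0" "m2 \<noteq> 0" "l \<noteq> 0"
    and b: "e2 * m3 - e3 * m2 \<noteq> 0" "e3 * m1 - e1 * m3 \<noteq> 0" "e1 * m2 - e2 * m1 \<noteq> 0"
    and t: "t \<in> free 3"
    and eq: "s * s = fresnel_disc (const e1) (const e2) (const e3) (const m1) (const m2) (const m3) (const l)
      (zop 1) (zop 2) * (t * t)"
  shows "t = 0"
proof -
  define a where "a = - (e2 * m2 * (e3 * m1 - e1 * m3))"
  define b where "b = e1 * m1 * (e2 * m3 - e3 * m2)"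
  define L where "L = l * (e1 * m2 - e2 * m1)"
  have abL: "a \<noteq> 0" "b \<noteq> 0" "L \<noteq> 0" using nz b by (auto simp: a_def b_def L_def)
  define z where "z = (\<lambda>x::complex. (2 - x\<^sup>2 - 1 / x\<^sup>2) / 4)"
  define d1 where "d1 = (\<lambda>w. 2 * b * (a * w + L))"
  define d0 where "d0 = (\<lambda>w. (a * w - L) * (a * w - L))"
  have disc: "fresnel_disc e1 e2 e3 m1 m2 m3 l w y = b * b * y * y + d1 w * y + d0 w" for w y
    unfolding fresnel_disc_def Let_def d1_def d0_def a_def b_def L_def by (simp add: algebra_simps)
  \<comment> \<open>Its zeros are the values of \<open>z1\<close> at which
    \<open>square_times_nonsquare\<close> does not apply: the discriminant there is
    \<open>16 b^2 a L z1\<close>, and the other two factors exclude the roots 0 and 1. Each value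
    has at most four preimages \<open>x\<close>, so infinitely many \<open>x\<close> remain.\<close>
  define q where "q = (\<lambda>w. w * (d0 w * (b * b + d1 w + d0 w)))"
  define p where "p = [:0, 1:] * (([:- L, a:] * [:- L, a:]) * ([:b * b:] + smult (2 * b) [:L, a:] + [:- L, a:] * [:- L, a:]))"
  have pq: "poly p w = q w" for w by (simp add: p_def q_def d1_def d0_def algebra_simps)
  have "p \<noteq> 0"
  proof -
    have "[:b * b:] + smult (2 * b) [:L, a:] + [:- L, a:] * [:- L, a:] = [:b * b + 2 * b * L + L * L, 2 * b * a - 2 * L * a, a * a:]"
      by (simp add: algebra_simps)
    also have "\<dots> \<noteq> 0" using abL by simp
    finally show ?thesis using abL by (simp add: p_def no_zero_divisors)
  qed
  then have finq: "finite {w. q w = 0}" using poly_roots_finite[of p] by (simp add: pq)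
  define X where "X = {x. x \<noteq> 0 \<and> q (z x) \<noteq> 0}"
  have "finite {x. x \<noteq> 0 \<and> z x = w}" for w
  proof (rule finite_subset)
    show "{x. x \<noteq> 0 \<and> z x = w} \<subseteq> {x. poly [:1, 0, - (2 - 4 * w), 0, 1:] x = 0}"
    proof clarify
      fix x :: complex assume "x \<noteq> 0"
      then have "4 * z x * x\<^sup>2 = 2 * x\<^sup>2 - x\<^sup>2 * x\<^sup>2 - 1"
        by (simp add: z_def left_diff_distrib)
      then show "poly [:1, 0, - (2 - 4 * z x), 0, 1:] x = 0"
        by (simp add: power2_eq_square algebra_simps)
    qed
    show "finite {x. poly [:1, 0, - (2 - 4 * w), 0, 1:] x = 0}" by (intro poly_roots_finite) simp
  qed
  then have fin: "finite (\<Union>w\<in>{w. q w = 0}. {x. x \<noteq> 0 \<and> z x = w})"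
    by (intro finite_UN_I finq)
  have infX: "infinite X"
  proof
    assume "finite X"
    then have "finite (X \<union> ({0} \<union> (\<Union>w\<in>{w. q w = 0}. {x. x \<noteq> 0 \<and> z x = w})))"
      by (intro finite_UnI fin finite.intros)
    moreover have "UNIV \<subseteq> X \<union> ({0} \<union> (\<Union>w\<in>{w. q w = 0}. {x. x \<noteq> 0 \<and> z x = w}))"
      unfolding X_def by blast
    ultimately have "finite (UNIV :: complex set)" by (rule rev_finite_subset)
    then show False by (simp add: infinite_UNIV_char_0)
  qed
  show ?thesis
  proof (rule free_eq_0[OF t infX])
    show "0 \<notin> X" by (simp add: X_def)
    fix x assume x: "x \<in> X"
    have nzv: "vector [x, y, 1] $ i \<noteq> 0" if "y \<noteq> 0" for y :: complex and i :: 3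
      using that x exhaust_3[of i] by (auto simp: X_def)
    have upd: "upd (vector [x, 1, 1]) 2 y = vector [x, y, 1]" for y
      by (simp add: upd_def vec_eq_iff forall_3)
    obtain Ms where Ms: "\<And>M. M \<ge> Ms \<Longrightarrow> \<exists>p. \<forall>y. y \<noteq> 0 \<longrightarrow> poly p y = y ^ M * ev (vector [x, y, 1]) s"
      using ev_polynomial[OF nzv[OF one_neq_zero], of 2 s] unfolding upd by blast
    obtain Mt where Mt: "\<And>M. M \<ge> Mt \<Longrightarrow> \<exists>p. \<forall>y. y \<noteq> 0 \<longrightarrow> poly p y = y ^ M * ev (vector [x, y, 1]) t"
      using ev_polynomial[OF nzv[OF one_neq_zero], of 2 t] unfolding upd by blast
    define M where "M = max Ms Mt"
    obtain S where S: "\<And>y. y \<noteq> 0 \<Longrightarrow> poly S y = y ^ M * ev (vector [x, y, 1]) s"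
      using Ms[of M] unfolding M_def by (meson max.cobounded1)
    obtain T where T: "\<And>y. y \<noteq> 0 \<Longrightarrow> poly T y = y ^ M * ev (vector [x, y, 1]) t"
      using Mt[of M] unfolding M_def by (meson max.cobounded2)
    have q: "z x \<noteq> 0" "d0 (z x) \<noteq> 0" "b * b + d1 (z x) + d0 (z x) \<noteq> 0"
      using x by (auto simp: X_def q_def)
    have "T = 0"
    proof (rule square_times_nonsquare[of "b * b" "d1 (z x)" "d0 (z x)" S T])
      have "d1 (z x) * d1 (z x) - 4 * (b * b) * d0 (z x) = 16 * b * b * a * L * z x"
        unfolding d1_def d0_def by (simp add: algebra_simps)
      then show "d1 (z x) * d1 (z x) - 4 * (b * b) * d0 (z x) \<noteq> 0" using abL q by simp
      show "b * b \<noteq> 0" using abL by simp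
      fix y w :: complex assume y: "y \<noteq> 0" "w = (2 - y\<^sup>2 - 1 / y\<^sup>2) / 4"
      let ?v = "vector [x, y, 1] :: complex^3"
      have "ev ?v (s * s) = fresnel_disc e1 e2 e3 m1 m2 m3 l (z x) w * (ev ?v t * ev ?v t)"
        unfolding eq by (simp add: ev_mult[OF nzv[OF y(1)]] ev_fresnel[OF nzv[OF y(1)]] ev_zop[OF nzv[OF y(1)]] y(2) z_def)
      then have "ev ?v s * ev ?v s = (b * b * w * w + d1 (z x) * w + d0 (z x)) * (ev ?v t * ev ?v t)"
        by (simp only: ev_mult[OF nzv[OF y(1)]] disc)
      then have "(y ^ M * y ^ M) * (ev ?v s * ev ?v s) =
          (y ^ M * y ^ M) * ((b * b * w * w + d1 (z x) * w + d0 (z x)) * (ev ?v t * ev ?v t))"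
        by (rule arg_cong)
      then show "poly S y * poly S y = (b * b * w * w + d1 (z x) * w + d0 (z x)) * (poly T y * poly T y)"
        unfolding S[OF y(1)] T[OF y(1)] by (simp only: mult_ac)
    qed (use q in auto)
    then have "ev (vector [x, y, 1]) t = 0" if "y \<noteq> 0" for y
      using T[OF that] that by simp
    then show "\<exists>Y. infinite Y \<and> 0 \<notin> Y \<and> (\<forall>y\<in>Y. ev (vector [x, y, 1]) t = 0)"
      by (intro exI[of _ "UNIV - {0}"]) (auto simp: infinite_UNIV_char_0)
  qed
qed

text \<open>The sign in \<open>slope\<close> says that \<open>w3\<close> is the smaller of two
  distinct roots in \<open>z3\<close>, so the zero set near it is the graph of the branch
  \<open>r\<close> with \<open>- sqrt D\<close>. A remainder \<open>s + t * zop 3\<close> is known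
  to vanish on this branch only; its norm over both branches is free of the third variable and
  therefore vanishes identically.\<close>

lemma rellich_fresnel:
  fixes e1 e2 e3 m1 m2 m3 l :: real
  assumes pos: "e1 > 0" "e2 > 0" "e3 > 0" "m1 > 0" "m2 > 0" "m3 > 0" "l > 0"
    and b: "e2 * m3 - e3 * m2 \<noteq> 0" "e3 * m1 - e1 * m3 \<noteq> 0" "e1 * m2 - e2 * m1 \<noteq> 0"
    and w: "0 < w1" "w1 < 1" "0 < w2" "w2 < 1" "0 < w3" "w3 < 1"
    and root: "fresnel e1 e2 e3 m1 m2 m3 l w1 w2 w3 = 0"
    and slope: "2 * fresnel2 e1 e2 m1 m2 * w3 + fresnel1 e1 e2 e3 m1 m2 m3 l w1 w2 < 0"
  shows "rellich (fresnel (const (of_real e1)) (const (of_real e2)) (const (of_real e3))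
    (const (of_real m1)) (const (of_real m2)) (const (of_real m3)) (const (of_real l)) (zop 1) (zop 2) (zop 3))"
    (is "rellich ?P")
proof (rule rellich_by_division)
  define Q2 where "Q2 = fresnel2 e1 e2 m1 m2"
  define q1 where "q1 = fresnel1 e1 e2 e3 m1 m2 m3 l"
  define q0 where "q0 = fresnel0 e1 e2 e3 m1 m2 m3 l"
  define c where "c = (\<lambda>x. const (complex_of_real x))"
  define Q1 where "Q1 = fresnel1 (c e1) (c e2) (c e3) (c m1) (c m2) (c m3) (c l) (zop 1) (zop 2)"
  define Q0 where "Q0 = fresnel0 (c e1) (c e2) (c e3) (c m1) (c m2) (c m3) (c l) (zop 1) (zop 2)"
  have Q2: "Q2 > 0" using pos by (simp add: Q2_def fresnel2_def)
  have c_inv: "c Q2 * c (1 / Q2) = 1"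
    using Q2 unfolding c_def by (simp flip: const_hom(2)) (simp add: const_hom)
  have cQ2: "c Q2 = fresnel2 (c e1) (c e2) (c m1) (c m2)"
    by (simp add: c_def Q2_def fresnel2_def const_hom)
  have P: "?P = c Q2 * zop 3 * zop 3 + Q1 * zop 3 + Q0"
    unfolding fresnel_quadratic cQ2 Q1_def Q0_def by (simp add: c_def)
  have free: "Q1 \<in> free 3" "Q0 \<in> free 3" "c x \<in> free 3" for x
    unfolding Q1_def Q0_def fresnel1_def fresnel0_def c_def
    by (intro free_add free_diff free_mult free_const free_zop; simp)+
  have cnz: "complex_of_real e2 * complex_of_real m3 - complex_of_real e3 * complex_of_real m2 \<noteq> 0"
    "complex_of_real e3 * complex_of_real m1 - complex_of_real e1 * complex_of_real m3 \<noteq> 0"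
    "complex_of_real e1 * complex_of_real m2 - complex_of_real e2 * complex_of_real m1 \<noteq> 0"
    using b by (simp_all flip: of_real_mult)
  show "no_kernel ?P" using pos cnz by (intro no_kernel_fresnel) auto
  fix v g assume v: "v \<in> Bstar" "act ?P v = coef g"
  define T where "T = {s + t * zop 3 |s t. s \<in> free 3 \<and> t \<in> free 3}"
  have TI: "s + t * zop 3 \<in> T" if "s \<in> free 3" "t \<in> free 3" for s t
    using that unfolding T_def by blast
  have "\<exists>h. \<exists>t0\<in>T. \<exists>t1\<in>T. \<exists>t2\<in>T. \<exists>t3\<in>T.
    g = ?P * h + (t0 + t1 * shift 3 1 + t2 * (shift 3 1 * shift 3 1) + t3 * (shift 3 1 * (shift 3 1 * shift 3 1)))"
  proof (rule laurent_division)
    show "1 \<in> T" using TI[of 1 0] by simp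
    fix x y assume x: "x \<in> T"
    then obtain s t where st: "x = s + t * zop 3" "s \<in> free 3" "t \<in> free 3" unfolding T_def by blast
    show "x + y \<in> T" if y: "y \<in> T"
    proof -
      obtain s' t' where st': "y = s' + t' * zop 3" "s' \<in> free 3" "t' \<in> free 3" using y unfolding T_def by blast
      have "x + y = (s + s') + (t + t') * zop 3" by (simp add: st st' algebra_simps)
      also have "\<dots> \<in> T" by (intro TI free_add st st')
      finally show ?thesis .
    qed
    show "a * x \<in> T" if a: "a \<in> free 3" for a
    proof -
      have "a * x = a * s + (a * t) * zop 3" by (simp add: st algebra_simps)
      also have "\<dots> \<in> T" by (intro TI free_mult a st)
      finally show ?thesis .
    qed
    define k where "k = c (1 / Q2) * t"
    have k: "k \<in> free 3" unfolding k_def by (intro free_mult free st)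
    have "c Q2 * k = t" unfolding k_def by (simp add: c_inv flip: mult.assoc)
    then have "zop 3 * x = s * zop 3 + (c Q2 * k) * (zop 3 * zop 3)" by (simp add: st(1) algebra_simps)
    also have "\<dots> = ?P * k + (- (Q0 * k) + (s - Q1 * k) * zop 3)"
      unfolding P by (simp add: algebra_simps)
    finally have "zop 3 * x = ?P * k + (- (Q0 * k) + (s - Q1 * k) * zop 3)" .
    moreover have "- (Q0 * k) + (s - Q1 * k) * zop 3 \<in> T"
      by (intro TI free_uminus free_diff free_mult free st k)
    ultimately show "\<exists>t'\<in>T. \<exists>h. zop 3 * x = ?P * h + t'" by blast
  qed
  then obtain h t0 t1 t2 t3 where t: "t0 \<in> T" "t1 \<in> T" "t2 \<in> T" "t3 \<in> T"
    and g: "g = ?P * h + (t0 + t1 * shift 3 1 + t2 * (shift 3 1 * shift 3 1) + t3 * (shift 3 1 * (shift 3 1 * shift 3 1)))"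
    by blast
  define Z where "Z = (\<lambda>x::real. (sin x)\<^sup>2)"
  define D where "D = (\<lambda>x::real \<times> real. (q1 (Z (fst x)) (Z (snd x)))\<^sup>2 - 4 * Q2 * q0 (Z (fst x)) (Z (snd x)))"
  define r where "r = (\<lambda>x. (- q1 (Z (fst x)) (Z (snd x)) - sqrt (D x)) / (2 * Q2))"
  have contD: "continuous_on X D" for X
    unfolding D_def q1_def q0_def Z_def fresnel1_def fresnel0_def by (intro continuous_intros)
  have cont: "continuous_on X r" for X
    using Q2 contD unfolding r_def q1_def Z_def fresnel1_def by (intro continuous_intros) auto
  have rootr: "Q2 * r x * r x + q1 (Z (fst x)) (Z (snd x)) * r x + q0 (Z (fst x)) (Z (snd x)) = 0" if "D x > 0" for x
  proof -
    let ?q1 = "q1 (Z (fst x)) (Z (snd x))" and ?q0 = "q0 (Z (fst x)) (Z (snd x))"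
    have "2 * Q2 * r x + ?q1 = - sqrt (D x)" using Q2 by (simp add: r_def field_simps)
    then have "(2 * Q2 * r x + ?q1)\<^sup>2 = D x" using that by simp
    then have "(2 * Q2 * r x + ?q1)\<^sup>2 = ?q1\<^sup>2 - 4 * Q2 * ?q0" by (simp add: D_def)
    then have "4 * Q2 * (Q2 * r x * r x + ?q1 * r x + ?q0) = 0"
      by (simp add: power2_eq_square algebra_simps)
    then show ?thesis using Q2 by simp
  qed
  define U where "U = {x. 0 < D x} \<inter> ({x. 0 < r x} \<inter> {x. r x < 1})"
  have U: "open U" unfolding U_def
    by (intro open_Int open_Collect_less cont contD continuous_on_const)
  define p where "p = (arcsin (sqrt w1), arcsin (sqrt w2))"
  have Zp: "Z (fst p) = w1" "Z (snd p) = w2"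
    using w by (simp_all add: Z_def p_def sin_arcsin_sqrt del: sin_arcsin)
  have "Q2 * w3 * w3 + q1 w1 w2 * w3 + q0 w1 w2 = 0"
    using root unfolding fresnel_quadratic Q2_def q1_def q0_def by simp
  then have "D p = (2 * Q2 * w3 + q1 w1 w2)\<^sup>2"
    unfolding D_def Zp power2_eq_square by algebra
  moreover have sl: "2 * Q2 * w3 + q1 w1 w2 < 0" using slope by (simp add: Q2_def q1_def)
  ultimately have "D p > 0" "sqrt (D p) = - (2 * Q2 * w3 + q1 w1 w2)" by auto
  moreover from this(2) have "r p = w3" using Q2 by (simp add: r_def Zp)
  ultimately have p: "p \<in> U" using w by (simp add: U_def)
  have evP: "ev (torus (fst x) (snd x) x3) ?P = 0" if "x \<in> U" "(sin x3)\<^sup>2 = r x" for x x3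
  proof -
    have "D x > 0" using that(1) by (simp add: U_def)
    from arg_cong[OF rootr[OF this], of complex_of_real] show ?thesis
      unfolding P Q1_def Q0_def c_def
      by (simp add: ev_fresnel ev_zop_torus of_real_fresnel that(2) q1_def q0_def Z_def flip: of_real_power)
  qed
  have van: "x = 0" if x: "x \<in> {t0, t1, t2, t3}" for x
  proof -
    have "x \<in> T" using x t by blast
    then obtain s t where st: "x = s + t * zop 3" "s \<in> free 3" "t \<in> free 3" unfolding T_def by blast
    have evT: "ev (torus y1 y2 y3) t' = ev (torus y1 y2 y3') t'"
      if t': "t' \<in> T" and eq: "(sin y3)\<^sup>2 = (sin y3')\<^sup>2" for t' y1 y2 y3 y3'
    proof -
      obtain s t where "t' = s + t * zop 3" "s \<in> free 3" "t \<in> free 3" using t' unfolding T_def by blast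
      then show ?thesis
        using ev_torus_free[of s y1 y2 y3 y3'] ev_torus_free[of t y1 y2 y3 y3'] eq
        by (simp add: ev_zop_torus del: of_real_power)
    qed
    have ev0: "ev (torus (fst y) (snd y) (arcsin (sqrt (r y)))) x = 0" if "y \<in> U" for y
      using t x that by (intro remainder_vanishes[OF v U cont _ evP g]) (auto simp: U_def intro: evT)
    \<comment> \<open>The norm: \<open>Q2\<close> times the product of \<open>s + t * r\<close> over
      both roots \<open>r\<close> of \<open>P\<close> in \<open>zop 3\<close>.\<close>
    define W where "W = c Q2 * s * s - Q1 * s * t + Q0 * t * t"
    have "W = 0"
    proof (rule free_eq_0_torus[OF _ U p])
      show "W \<in> free 3" unfolding W_def by (intro free_add free_diff free_mult free st)
      fix y assume y: "y \<in> U"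
      let ?\<zeta> = "torus (fst y) (snd y) (arcsin (sqrt (r y)))"
      have ry: "0 < r y" "r y < 1" "D y > 0" using y by (auto simp: U_def)
      have "ev ?\<zeta> (zop 3) = of_real (r y)"
        using ry sin_arcsin_sqrt[of "r y"] by (simp add: ev_zop_torus del: sin_arcsin of_real_power)
      then have s: "ev ?\<zeta> s = - (ev ?\<zeta> t * of_real (r y))"
        using ev0[OF y] by (simp add: st(1) eq_neg_iff_add_eq_0)
      have Q: "ev ?\<zeta> Q1 = of_real (q1 (Z (fst y)) (Z (snd y)))" "ev ?\<zeta> Q0 = of_real (q0 (Z (fst y)) (Z (snd y)))"
        "ev ?\<zeta> (c Q2) = of_real Q2"
        unfolding Q1_def Q0_def c_def
        by (simp_all add: ev_fresnel ev_zop_torus of_real_fresnel q1_def q0_def Z_def del: of_real_power)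
      have "ev ?\<zeta> W = (ev ?\<zeta> t * ev ?\<zeta> t) *
          of_real (Q2 * r y * r y + q1 (Z (fst y)) (Z (snd y)) * r y + q0 (Z (fst y)) (Z (snd y)))"
        by (simp add: W_def s Q algebra_simps)
      then show "ev ?\<zeta> W = 0" using rootr[OF ry(3)] by simp
    qed
    \<comment> \<open>Completing the square in \<open>s\<close> turns \<open>W = 0\<close> into a
      square equal to the discriminant times \<open>t * t\<close>.\<close>
    define S where "S = 2 * c Q2 * s - Q1 * t"
    have "S * S = (Q1 * Q1 - 4 * c Q2 * Q0) * (t * t) + 4 * c Q2 * W"
      unfolding S_def W_def by (simp add: algebra_simps)
    then have SS: "S * S = fresnel_disc (c e1) (c e2) (c e3) (c m1) (c m2) (c m3) (c l) (zop 1) (zop 2) * (t * t)"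
      unfolding \<open>W = 0\<close> cQ2 Q1_def Q0_def fresnel_disc by simp
    have "t = 0"
      using pos cnz by (intro fresnel_disc_not_square[OF _ _ _ _ _ _ _ _ st(3) SS[unfolded c_def]]) auto
    have "s = 0"
    proof (rule laurent_eq_0[OF st(2)])
      fix \<zeta> :: "complex^3" assume nz: "\<And>i. \<zeta>$i \<noteq> 0"
      have "S * S = 0" using SS \<open>t = 0\<close> by simp
      then have "ev \<zeta> (S * S) = 0" by simp
      then have "ev \<zeta> S = 0" by (simp add: ev_mult[OF nz])
      then show "ev \<zeta> s = 0" using Q2 \<open>t = 0\<close> by (simp add: S_def c_def ev_mult[OF nz])
    qed
    then show ?thesis using st(1) \<open>t = 0\<close> by simp
  qed
  then have "t0 = 0" "t1 = 0" "t2 = 0" "t3 = 0" by simp_all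
  with g have "g = ?P * h" by simp
  then show "\<exists>h. g = ?P * h" ..
qed

section \<open>Reduction of the Maxwell system\<close>

text \<open>Here \<open>K0\<close> is the square of the linear form with coefficients
  \<open>\<gamma>1\<close>, \<open>\<gamma>2\<close>, \<open>\<gamma>3\<close>, so the polynomial is
  the product of the two factors \<open>F 1\<close> and \<open>F (- 1)\<close>. Since each
  \<open>\<gamma>\<close> is smaller in modulus than the corresponding \<open>a\<close>, all linear
  coefficients are positive; and \<open>l\<close> lies below both linear forms at a point of the
  cube, so each plane satisfies the condition of \<open>rellich_linear\<close>.\<close>

lemma rellich_fresnel_degenerate:
  fixes e1 e2 e3 m1 m2 m3 l \<gamma>1 \<gamma>2 \<gamma>3 :: real
  assumes pos: "e1 > 0" "e2 > 0" "e3 > 0" "m1 > 0" "m2 > 0" "m3 > 0" "l > 0"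
    and b: "b1 = e2 * m3 - e3 * m2" "b2 = e3 * m1 - e1 * m3" "b3 = e1 * m2 - e2 * m1"
    and a: "a1 = (e2 * m3 + e3 * m2) / 2" "a2 = (e3 * m1 + e1 * m3) / 2" "a3 = (e1 * m2 + e2 * m1) / 2"
    and \<gamma>: "4 * \<gamma>1\<^sup>2 = b1\<^sup>2" "4 * \<gamma>2\<^sup>2 = b2\<^sup>2" "4 * \<gamma>3\<^sup>2 = b3\<^sup>2"
      "4 * (\<gamma>1 * \<gamma>2) = - (b1 * b2)" "4 * (\<gamma>1 * \<gamma>3) = - (b1 * b3)" "4 * (\<gamma>2 * \<gamma>3) = - (b2 * b3)"
    and w: "0 \<le> w1" "w1 \<le> 1" "0 \<le> w2" "w2 \<le> 1" "0 \<le> w3" "w3 \<le> 1"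
    and l: "l < a1 * w1 + a2 * w2 + a3 * w3 - \<bar>\<gamma>1 * w1 + \<gamma>2 * w2 + \<gamma>3 * w3\<bar>"
  shows "rellich (fresnel (const (of_real e1)) (const (of_real e2)) (const (of_real e3))
    (const (of_real m1)) (const (of_real m2)) (const (of_real m3)) (const (of_real l)) (zop 1) (zop 2) (zop 3))"
proof -
  have less: "\<bar>\<gamma>\<bar> < a" if "4 * \<gamma>\<^sup>2 = (x - y)\<^sup>2" "a = (x + y) / 2" "x > 0" "y > 0" for \<gamma> a x y :: real
  proof -
    have "4 * a\<^sup>2 = (x - y)\<^sup>2 + 4 * (x * y)" unfolding that(2) by (simp add: power2_eq_square field_simps)
    moreover have "x * y > 0" using that by simp
    ultimately have "\<bar>\<gamma>\<bar>\<^sup>2 < a\<^sup>2" unfolding power2_abs using that(1) by linarith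
    moreover have "0 \<le> a" using that(2-4) by simp
    ultimately show ?thesis by (rule power2_less_imp_less)
  qed
  have lt: "\<bar>\<gamma>1\<bar> < a1" "\<bar>\<gamma>2\<bar> < a2" "\<bar>\<gamma>3\<bar> < a3"
    by (rule less[OF \<gamma>(1)[unfolded b(1)] a(1)], simp_all add: pos)
      (rule less[OF \<gamma>(2)[unfolded b(2)] a(2)], simp_all add: pos,
       rule less[OF \<gamma>(3)[unfolded b(3)] a(3)], simp_all add: pos)
  define F where "F = (\<lambda>s. const (of_real (a1 + s * \<gamma>1)) * zop 1 + const (of_real (a2 + s * \<gamma>2)) * zop 2 +
      const (of_real (a3 + s * \<gamma>3)) * zop 3 + const (of_real (- l)))"
  have "rellich (F s)" if s: "s = 1 \<or> s = - 1" for s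
    unfolding F_def
  proof (rule rellich_linear)
    show p: "a1 + s * \<gamma>1 > 0" "a2 + s * \<gamma>2 > 0" "a3 + s * \<gamma>3 > 0" using lt s by auto
    have "l < (a1 + s * \<gamma>1) * w1 + (a2 + s * \<gamma>2) * w2 + (a3 + s * \<gamma>3) * w3"
      using l s by (auto simp: algebra_simps)
    also have "\<dots> \<le> (a1 + s * \<gamma>1) * 1 + (a2 + s * \<gamma>2) * 1 + (a3 + s * \<gamma>3) * 1"
      using p w by (intro add_mono mult_left_mono) auto
    finally show "l < (a1 + s * \<gamma>1) + (a2 + s * \<gamma>2) + (a3 + s * \<gamma>3)" by simp
  qed (use pos in auto)
  then have "rellich (F 1 * F (- 1))" by (intro rellich_mult) auto
  also have "F 1 * F (- 1) = fresnel (const (of_real e1)) (const (of_real e2)) (const (of_real e3))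
    (const (of_real m1)) (const (of_real m2)) (const (of_real m3)) (const (of_real l)) (zop 1) (zop 2) (zop 3)"
  proof -
    let ?c = "\<lambda>x. const (complex_of_real x)"
    have F: "F 1 * F (- 1) = ?c (a1 * a1 - \<gamma>1 * \<gamma>1) * (zop 1 * zop 1) + ?c (a2 * a2 - \<gamma>2 * \<gamma>2) * (zop 2 * zop 2) +
      ?c (a3 * a3 - \<gamma>3 * \<gamma>3) * (zop 3 * zop 3) + ?c (2 * a1 * a2 - 2 * (\<gamma>1 * \<gamma>2)) * (zop 1 * zop 2) +
      ?c (2 * a1 * a3 - 2 * (\<gamma>1 * \<gamma>3)) * (zop 1 * zop 3) + ?c (2 * a2 * a3 - 2 * (\<gamma>2 * \<gamma>3)) * (zop 2 * zop 3) +
      ?c (- 2 * l * a1) * zop 1 + ?c (- 2 * l * a2) * zop 2 + ?c (- 2 * l * a3) * zop 3 + ?c (l * l)"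
      unfolding F_def by (simp add: const_hom algebra_simps)
    have "a1 * a1 - \<gamma>1 * \<gamma>1 = e2 * e3 * m2 * m3" "a2 * a2 - \<gamma>2 * \<gamma>2 = e1 * e3 * m1 * m3"
      "a3 * a3 - \<gamma>3 * \<gamma>3 = e1 * e2 * m1 * m2"
      "2 * a1 * a2 - 2 * (\<gamma>1 * \<gamma>2) = e2 * e3 * m1 * m3 + e1 * e3 * m2 * m3"
      "2 * a1 * a3 - 2 * (\<gamma>1 * \<gamma>3) = e2 * e3 * m1 * m2 + e1 * e2 * m2 * m3"
      "2 * a2 * a3 - 2 * (\<gamma>2 * \<gamma>3) = e1 * e3 * m1 * m2 + e1 * e2 * m1 * m3"
      "- 2 * l * a1 = - l * (e2 * m3 + e3 * m2)" "- 2 * l * a2 = - l * (e3 * m1 + e1 * m3)"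
      "- 2 * l * a3 = - l * (e1 * m2 + e2 * m1)"
      using \<gamma> unfolding a b by (simp_all add: power2_eq_square field_simps)
    note co = this
    show ?thesis
      unfolding F co by (simp add: fresnel_def const_hom algebra_simps)
  qed
  finally show ?thesis .
qed

text \<open>The polynomial is \<open>(l - tau_plus) * (l - tau_minus)\<close>, so at
  \<open>l = tau_plus\<close> its slope in \<open>z3\<close> is \<open>- 2 * sqrt K\<close> times
  the derivative of \<open>tau_plus\<close>. The second claim thus expresses that
  \<open>K > 0\<close> and that \<open>tau_plus\<close> increases strictly in
  \<open>z3\<close>.\<close>

lemma fresnel_point:
  fixes e1 e2 e3 m1 m2 m3 l :: real
  assumes pos: "e1 > 0" "e2 > 0" "e3 > 0" "m1 > 0" "m2 > 0" "m3 > 0" "l > 0"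
    and b: "b1 = e2 * m3 - e3 * m2" "b2 = e3 * m1 - e1 * m3" "b3 = e1 * m2 - e2 * m1"
    and bnz: "b1 \<noteq> 0" "b2 \<noteq> 0" "b3 \<noteq> 0"
    and a: "a1 = (e2 * m3 + e3 * m2) / 2" "a2 = (e3 * m1 + e1 * m3) / 2" "a3 = (e1 * m2 + e2 * m1) / 2"
    and w: "0 < w1" "0 < w2" "0 < w3"
    and K: "K = 1/4 * ((b1 * w1)\<^sup>2 + (b2 * w2)\<^sup>2 + (b3 * w3)\<^sup>2) -
      1/2 * (b1 * b2 * w1 * w2 + b1 * b3 * w1 * w3 + b2 * b3 * w2 * w3)"
    and l: "l = a1 * w1 + a2 * w2 + a3 * w3 + sqrt K"
  shows "fresnel e1 e2 e3 m1 m2 m3 l w1 w2 w3 = 0"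
    "2 * fresnel2 e1 e2 m1 m2 * w3 + fresnel1 e1 e2 e3 m1 m2 m3 l w1 w2 < 0"
proof -
  define x y z where "x = b1 * w1" and "y = b2 * w2" and "z = b3 * w3"
  have K4: "4 * K = (z - x - y)\<^sup>2 - 4 * (x * y)" "4 * K = (x - y - z)\<^sup>2 - 4 * (y * z)" "4 * K = (y - x - z)\<^sup>2 - 4 * (x * z)"
    unfolding K x_def y_def z_def by (simp_all add: power2_eq_square algebra_simps)
  \<comment> \<open>\<open>b\<close> is a cross product, hence orthogonal to the positive vector of
    the \<open>e\<close>'s. Its components cannot all have one sign, and this makes \<open>K\<close>
    positive.\<close>
  have be: "b1 * e1 + b2 * e2 + b3 * e3 = 0" unfolding b by (simp add: algebra_simps)
  have signs: "b1 * b2 < 0 \<or> b2 * b3 < 0 \<or> b1 * b3 < 0"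
  proof (rule ccontr)
    assume "\<not> ?thesis"
    then have "b1 * b2 > 0" "b2 * b3 > 0" "b1 * b3 > 0" using bnz by (auto simp: not_less le_less)
    then have "(b1 > 0 \<and> b2 > 0 \<and> b3 > 0) \<or> (b1 < 0 \<and> b2 < 0 \<and> b3 < 0)"
      by (auto simp: zero_less_mult_iff)
    then show False
    proof
      assume "b1 > 0 \<and> b2 > 0 \<and> b3 > 0"
      then have "b1 * e1 + b2 * e2 + b3 * e3 > 0" using pos by (intro add_pos_pos mult_pos_pos) auto
      then show False using be by simp
    next
      assume "b1 < 0 \<and> b2 < 0 \<and> b3 < 0"
      then have "b1 * e1 + b2 * e2 + b3 * e3 < 0" using pos by (intro add_neg_neg mult_neg_pos) auto
      then show False using be by simp
    qed
  qed
  have "K > 0"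
  proof -
    have "x * y = (b1 * b2) * (w1 * w2)" "y * z = (b2 * b3) * (w2 * w3)" "x * z = (b1 * b3) * (w1 * w3)"
      by (simp_all add: x_def y_def z_def)
    then have "x * y < 0 \<or> y * z < 0 \<or> x * z < 0"
      using signs w by (auto simp: mult_neg_pos)
    then show ?thesis using K4 zero_le_power2[of "z - x - y"] zero_le_power2[of "x - y - z"] zero_le_power2[of "y - x - z"]
      by linarith
  qed
  define k where "k = sqrt K"
  have k: "k > 0" "k\<^sup>2 = K" using \<open>K > 0\<close> by (simp_all add: k_def)
  have lk: "l - (a1 * w1 + a2 * w2 + a3 * w3) = k" using l by (simp add: k_def)
  have "fresnel e1 e2 e3 m1 m2 m3 l w1 w2 w3 = (l - (a1 * w1 + a2 * w2 + a3 * w3))\<^sup>2 - K"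
    unfolding fresnel_def K a b by (simp add: power2_eq_square field_simps)
  then show "fresnel e1 e2 e3 m1 m2 m3 l w1 w2 w3 = 0"
    unfolding lk k(2) by simp
  have "2 * fresnel2 e1 e2 m1 m2 * w3 + fresnel1 e1 e2 e3 m1 m2 m3 l w1 w2 =
      - 2 * a3 * (l - (a1 * w1 + a2 * w2 + a3 * w3)) - 1/2 * (b3 * (z - x - y))"
    unfolding fresnel2_def fresnel1_def x_def y_def z_def a b by (simp add: field_simps)
  also have "\<dots> = - 2 * a3 * k - 1/2 * (b3 * (z - x - y))" unfolding lk ..
  \<comment> \<open>If \<open>x * y \<le> 0\<close>, then \<open>|z - x - y| \<le> 2 k\<close> and
    \<open>|b3| < 2 a3\<close> suffice. Otherwise \<open>b3\<close> has the sign opposite to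
    \<open>b1\<close> and \<open>b2\<close>, and both terms are negative.\<close>
  also have "\<dots> < 0"
  proof (cases "x * y \<le> 0")
    case True
    then have "(z - x - y)\<^sup>2 \<le> (2 * k)\<^sup>2" using K4(1) k(2) by (simp add: power_mult_distrib)
    then have "\<bar>z - x - y\<bar> \<le> \<bar>2 * k\<bar>" by (simp only: abs_le_square_iff)
    then have "\<bar>z - x - y\<bar> \<le> 2 * k" using k(1) by simp
    then have "\<bar>b3\<bar> * \<bar>z - x - y\<bar> \<le> \<bar>b3\<bar> * (2 * k)" by (intro mult_left_mono) auto
    also have "\<dots> < (2 * a3) * (2 * k)"
    proof (intro mult_strict_right_mono)
      show "\<bar>b3\<bar> < 2 * a3" 
      proof -
        have "e1 * m2 > 0" "e2 * m1 > 0" using pos by simp_all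
        then have "\<bar>e1 * m2 - e2 * m1\<bar> < e1 * m2 + e2 * m1" by linarith
        then show ?thesis unfolding a b by simp
      qed
    qed (use k in simp)
    finally have "\<bar>b3 * (z - x - y)\<bar> < 4 * a3 * k" by (simp add: abs_mult)
    then show ?thesis by linarith
  next
    case False
    then have "(b1 * b2) * (w1 * w2) > 0" by (simp add: x_def y_def algebra_simps)
    moreover have "w1 * w2 > 0" using w by simp
    ultimately have b12: "b1 * b2 > 0" by (rule zero_less_mult_pos2)
    have neg: "b1 * b3 < 0 \<and> b2 * b3 < 0"
      using signs b12 bnz by (auto simp: mult_less_0_iff zero_less_mult_iff)
    have "b3 * (z - x - y) = b3\<^sup>2 * w3 + (- (b1 * b3)) * w1 + (- (b2 * b3)) * w2"
      by (simp add: x_def y_def z_def power2_eq_square algebra_simps)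
    also have "\<dots> > 0" using neg w bnz by (intro add_pos_pos mult_pos_pos) auto
    finally have "b3 * (z - x - y) > 0" .
    moreover have "a3 > 0" unfolding a using pos by (simp add: add_pos_pos)
    then have "a3 * k > 0" using k by simp
    ultimately show ?thesis by linarith
  qed
  finally show "2 * fresnel2 e1 e2 m1 m2 * w3 + fresnel1 e1 e2 e3 m1 m2 m3 l w1 w2 < 0" .
qed

section \<open>From the first-order system to one scalar equation\<close>

lemma act_minus_right: "act a (\<lambda>n. - u n) n = - act a u n"
  using act_scale_right[of a "- 1" u n] by simp

text \<open>The electric equation is multiplied by \<open>lam\<close>, so that
  \<open>lam * H\<close> can be replaced through the magnetic equations without a division. Generic
  indices let one computation serve all three rows by cyclic permutation.\<close>

lemma maxwell_row:
  assumes E: "\<And>n. e * (act yj Hk n - act yk Hj n) - lam * Ei n = coef fi n"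
    and Hj: "\<And>n. mj * - (act yk Ei n - act yi Ek n) - lam * Hj n = coef gj n"
    and Hk: "\<And>n. mk * - (act yi Ej n - act yj Ei n) - lam * Hk n = coef gk n"
  shows "act (const (lam * lam) - const (e * mk) * yj * yj - const (e * mj) * yk * yk) Ei n +
    act (const (e * mk) * yi * yj) Ej n + act (const (e * mj) * yi * yk) Ek n =
    coef (- (const lam * fi) - const e * yj * gk + const e * yk * gj) n"
proof -
  have h: "lam * act y H n = - (m * (act (y * a) A n - act (y * b) B n)) - act y (coef g) n"
    if "\<And>n. m * - (act a A n - act b B n) - lam * H n = coef g n" for y m a b A B H g
  proof -
    have "lam * H n = - m * (act a A n - act b B n) - coef g n" for n
      using that[of n] by (simp add: algebra_simps)
    then have "lam * act y H n = act y (\<lambda>n. - m * (act a A n - act b B n) - coef g n) n"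
      by (simp flip: act_scale_right)
    then show ?thesis
      by (simp add: act_diff_right act_scale_right act_minus_right act_mult)
  qed
  have "e * (lam * act yj Hk n - lam * act yk Hj n) - lam * (lam * Ei n) = lam * coef fi n"
    unfolding E[symmetric] by (simp add: algebra_simps)
  then have "e * ((- (mk * (act (yj * yi) Ej n - act (yj * yj) Ei n)) - act yj (coef gk) n)
      - (- (mj * (act (yk * yk) Ei n - act (yk * yi) Ek n)) - act yk (coef gj) n)) - lam * (lam * Ei n) = lam * coef fi n"
    unfolding h[OF Hk] h[OF Hj] .
  note eq = this[symmetric]
  have c: "act (const a * x * y) F n = a * act (x * y) F n" for a x y F
    by (simp only: mult.assoc act_mult act_const)
  have coef: "coef (const a * x * f) n = a * act x (coef f) n" "coef (const a * f) n = a * coef f n" for a x f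
    by (simp_all only: mult.assoc coef_mult act_mult act_const)
  show ?thesis
    unfolding act_diff c act_const lookup_add lookup_minus lookup_uminus coef eq
      mult.commute[of yi yj] mult.commute[of yi yk]
    by (simp add: algebra_simps)
qed

text \<open>Cramer's rule over the commutative ring of operators: the cofactors of the first column
  cancel \<open>E2\<close> and \<open>E3\<close>, and the right-hand side keeps finite
  support.\<close>

lemma cramer:
  assumes "\<And>n. act a1 E1 n + act a2 E2 n + act a3 E3 n = coef f n"
    and "\<And>n. act b1 E1 n + act b2 E2 n + act b3 E3 n = coef g n"
    and "\<And>n. act c1 E1 n + act c2 E2 n + act c3 E3 n = coef h n"
  shows "act (a1 * (b2 * c3 - b3 * c2) - b1 * (a2 * c3 - a3 * c2) + c1 * (a2 * b3 - a3 * b2)) E1 =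
    coef ((b2 * c3 - b3 * c2) * f - (a2 * c3 - a3 * c2) * g + (a2 * b3 - a3 * b2) * h)"
proof
  fix n
  define k1 k2 k3 where "k1 = b2 * c3 - b3 * c2" and "k2 = a2 * c3 - a3 * c2" and "k3 = a2 * b3 - a3 * b2"
  have mult: "coef (k * f') n = act (k * x1) E1 n + act (k * x2) E2 n + act (k * x3) E3 n"
    if "\<And>n. act x1 E1 n + act x2 E2 n + act x3 E3 n = coef f' n" for k x1 x2 x3 f'
    unfolding coef_mult using that by (simp add: fun_eq_iff[symmetric] act_mult flip: act_add_right)
  have z2: "k1 * a2 - k2 * b2 + k3 * c2 = 0" and z3: "k1 * a3 - k2 * b3 + k3 * c3 = 0"
    unfolding k1_def k2_def k3_def by (simp_all add: algebra_simps)
  have "coef (k1 * f - k2 * g + k3 * h) n =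
      act (k1 * a1 - k2 * b1 + k3 * c1) E1 n + act (k1 * a2 - k2 * b2 + k3 * c2) E2 n +
      act (k1 * a3 - k2 * b3 + k3 * c3) E3 n"
    by (simp add: lookup_add lookup_minus mult[OF assms(1)] mult[OF assms(2)] mult[OF assms(3)] act_add act_diff)
  also have "\<dots> = act (a1 * k1 - b1 * k2 + c1 * k3) E1 n"
    unfolding z2 z3 by (simp add: mult.commute)
  finally show "act (a1 * (b2 * c3 - b3 * c2) - b1 * (a2 * c3 - a3 * c2) + c1 * (a2 * b3 - a3 * b2)) E1 n =
    coef ((b2 * c3 - b3 * c2) * f - (a2 * c3 - a3 * c2) * g + (a2 * b3 - a3 * b2) * h) n"
    unfolding k1_def k2_def k3_def by simp
qed

text \<open>At \<open>l = 0\<close> the matrix annihilates the gradient direction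
  \<open>(y1, y2, y3)\<close>, which accounts for the factor \<open>l\<close>.\<close>

lemma maxwell_determinant:
  fixes e1 e2 e3 m1 m2 m3 l y1 y2 y3 :: "'a::comm_ring_1"
  shows "(l - e1 * m3 * y2 * y2 - e1 * m2 * y3 * y3) *
      ((l - e2 * m1 * y3 * y3 - e2 * m3 * y1 * y1) * (l - e3 * m2 * y1 * y1 - e3 * m1 * y2 * y2)
        - (e2 * m1 * y2 * y3) * (e3 * m1 * y3 * y2))
    - (e2 * m3 * y2 * y1) * ((e1 * m3 * y1 * y2) * (l - e3 * m2 * y1 * y1 - e3 * m1 * y2 * y2)
        - (e1 * m2 * y1 * y3) * (e3 * m1 * y3 * y2))
    + (e3 * m2 * y3 * y1) * ((e1 * m3 * y1 * y2) * (e2 * m1 * y2 * y3)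
        - (e1 * m2 * y1 * y3) * (l - e2 * m1 * y3 * y3 - e2 * m3 * y1 * y1))
    = l * fresnel e1 e2 e3 m1 m2 m3 l (y1 * y1) (y2 * y2) (y3 * y3)"
  unfolding fresnel_def by (simp add: algebra_simps)

lemma maxwell_scalar:
  assumes E1: "\<And>n. e1 * (act y2 H3 n - act y3 H2 n) - lam * E1 n = coef f1 n"
    and E2: "\<And>n. e2 * (act y3 H1 n - act y1 H3 n) - lam * E2 n = coef f2 n"
    and E3: "\<And>n. e3 * (act y1 H2 n - act y2 H1 n) - lam * E3 n = coef f3 n"
    and H1: "\<And>n. m1 * - (act y2 E3 n - act y3 E2 n) - lam * H1 n = coef g1 n"
    and H2: "\<And>n. m2 * - (act y3 E1 n - act y1 E3 n) - lam * H2 n = coef g2 n"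
    and H3: "\<And>n. m3 * - (act y1 E2 n - act y2 E1 n) - lam * H3 n = coef g3 n"
  obtains g where "act (const (lam * lam) * fresnel (const e1) (const e2) (const e3) (const m1) (const m2) (const m3)
      (const (lam * lam)) (y1 * y1) (y2 * y2) (y3 * y3)) E1 = coef g"
proof -
  note r1 = maxwell_row[OF E1 H2 H3]
  have r2: "act (const (e2 * m3) * y2 * y1) E1 n +
      act (const (lam * lam) - const (e2 * m1) * y3 * y3 - const (e2 * m3) * y1 * y1) E2 n + act (const (e2 * m1) * y2 * y3) E3 n =
      coef (- (const lam * f2) - const e2 * y3 * g1 + const e2 * y1 * g3) n" for n
    using maxwell_row[OF E2 H3 H1, of n] by (simp only: add_ac)
  have r3: "act (const (e3 * m2) * y3 * y1) E1 n + act (const (e3 * m1) * y3 * y2) E2 n +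
      act (const (lam * lam) - const (e3 * m2) * y1 * y1 - const (e3 * m1) * y2 * y2) E3 n =
      coef (- (const lam * f3) - const e3 * y1 * g2 + const e3 * y2 * g1) n" for n
    using maxwell_row[OF E3 H1 H2, of n] by (simp only: add_ac)
  show ?thesis
    by (rule that, rule trans[OF _ cramer[OF r1 r2 r3]])
      (simp only: const_hom(2)[of e1] const_hom(2)[of e2] const_hom(2)[of e3] maxwell_determinant)
qed

section \<open>Return to the vector-valued sequence\<close>

lemma Bstar_component:
  assumes "u \<in> B0star"
  shows "(\<lambda>n. fst (u n) $ i) \<in> Bstar" "(\<lambda>n. snd (u n) $ i) \<in> Bstar"
proof -
  have lim: "((\<lambda>R::real. 1 / R * (\<Sum>n\<in>l1ball R. (norm (u n))\<^sup>2)) \<longlongrightarrow> 0) at_top"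
    using assms by (simp add: B0star_def)
  have "cmod (fst (u n) $ i) \<le> norm (u n)" "cmod (snd (u n) $ i) \<le> norm (u n)" for n
    using order_trans[OF Finite_Cartesian_Product.norm_nth_le norm_fst_le[of "fst (u n)" "snd (u n)"]]
      order_trans[OF Finite_Cartesian_Product.norm_nth_le norm_snd_le[of "snd (u n)" "fst (u n)"]] by simp_all
  then show "(\<lambda>n. fst (u n) $ i) \<in> Bstar" "(\<lambda>n. snd (u n) $ i) \<in> Bstar"
    by (auto intro!: Bstar_dominated[OF _ lim] sum_mono power_mono)
qed

lemma fresnel_cyclic:
  "fresnel e1 e2 e3 m1 m2 m3 l z1 z2 z3 = fresnel e2 e3 e1 m2 m3 m1 l z2 z3 z1"
  unfolding fresnel_def by (simp add: algebra_simps)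

lemma finite_support_coef:
  assumes "finite F" "\<And>n. n \<notin> F \<Longrightarrow> f n = 0"
  obtains g where "coef g = f"
proof (rule that)
  have "finite {n. f n \<noteq> 0}" by (rule finite_subset[OF _ assms(1)]) (use assms(2) in auto)
  then show "coef (Abs_poly_mapping f) = f" by simp
qed

text \<open>Only the electric components pass through the scalar theorem. The magnetic ones follow
  from their own equations after division by \<open>lam\<close>. Besides this,
  \<open>lam \<noteq> 0\<close> serves to remove the factor \<open>lam^2\<close> of the
  determinant.\<close>

lemma rellich_type_if_rellich:
  fixes \<epsilon> \<mu> :: "real^3" and lam :: real
  assumes lam: "lam \<noteq> 0"
    and P: "rellich (fresnel (const (of_real (\<epsilon>$1))) (const (of_real (\<epsilon>$2))) (const (of_real (\<epsilon>$3)))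
      (const (of_real (\<mu>$1))) (const (of_real (\<mu>$2))) (const (of_real (\<mu>$3))) (const (of_real (lam\<^sup>2))) (zop 1) (zop 2) (zop 3))"
      (is "rellich ?P")
  shows "rellich_type (\<lambda>u n. HDhat \<epsilon> \<mu> u n - lam *\<^sub>R u n)"
  unfolding rellich_type_def
proof (intro ballI impI, elim exE conjE)
  fix u F assume u: "u \<in> B0star" and F: "finite F"
    "\<forall>n. n \<notin> F \<longrightarrow> HDhat \<epsilon> \<mu> u n - lam *\<^sub>R u n = 0"
  define E where "E = (\<lambda>i n. fst (u n) $ i)"
  define H where "H = (\<lambda>i n. snd (u n) $ i)"
  define e where "e = (\<lambda>i. complex_of_real (\<epsilon> $ i))"
  define m where "m = (\<lambda>i. complex_of_real (\<mu> $ i))"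
  define l where "l = complex_of_real lam"
  have l: "l \<noteq> 0" "complex_of_real (lam\<^sup>2) = l * l" using lam by (simp_all add: l_def power2_eq_square)
  have B: "E i \<in> Bstar" "H i \<in> Bstar" for i
    unfolding E_def H_def by (rule Bstar_component[OF u])+
  define TE where "TE = (\<lambda>i n. fst (HDhat \<epsilon> \<mu> u n - lam *\<^sub>R u n) $ i)"
  define TH where "TH = (\<lambda>i n. snd (HDhat \<epsilon> \<mu> u n - lam *\<^sub>R u n) $ i)"
  have "\<exists>g. coef g = TE i" "\<exists>g. coef g = TH i" for i
  proof -
    have "TE i n = 0" "TH i n = 0" if "n \<notin> F" for n
      using F(2) that by (simp_all add: TE_def TH_def)
    then show "\<exists>g. coef g = TE i" "\<exists>g. coef g = TH i"
      using finite_support_coef[OF F(1)] by blast+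
  qed
  then obtain f g where fg: "\<And>i. coef (f i) = TE i" "\<And>i. coef (g i) = TH i" by metis
  let ?y = "\<lambda>j. act (yop j)"
  have comp: "(lam *\<^sub>R x) $ i = l * x $ i" for x :: "complex^3" and i
    by (subst vector_scaleR_component) (simp only: scaleR_conv_of_real l_def)
  have TE: "TE 1 n = e 1 * (?y 2 (H 3) n - ?y 3 (H 2) n) - l * E 1 n"
    "TE 2 n = e 2 * (?y 3 (H 1) n - ?y 1 (H 3) n) - l * E 2 n"
    "TE 3 n = e 3 * (?y 1 (H 2) n - ?y 2 (H 1) n) - l * E 3 n" for n
    by (simp_all add: TE_def HDhat_def H0hat_def Dhat_def Mtilde_def act_yop E_def H_def e_def comp del: vector_scaleR_component)
  have TH: "TH 1 n = m 1 * - (?y 2 (E 3) n - ?y 3 (E 2) n) - l * H 1 n"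
    "TH 2 n = m 2 * - (?y 3 (E 1) n - ?y 1 (E 3) n) - l * H 2 n"
    "TH 3 n = m 3 * - (?y 1 (E 2) n - ?y 2 (E 1) n) - l * H 3 n" for n
    by (simp_all add: TH_def HDhat_def H0hat_def Dhat_def Mtilde_def act_yop E_def H_def m_def comp algebra_simps del: vector_scaleR_component)
  note eqs = TE[folded fg, symmetric] TH[folded fg, symmetric]
  let ?c = "\<lambda>i. const (e i)" and ?d = "\<lambda>i. const (m i)"
  have lP: "rellich (const (l * l) * ?P)"
    using l(1) by (intro rellich_mult rellich_const P) simp
  have coefE: "\<exists>h. E i = coef h" for i
  proof -
    let ?F = "\<lambda>i j k. fresnel (?c i) (?c j) (?c k) (?d i) (?d j) (?d k) (const (l * l)) (zop i) (zop j) (zop k)"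
    have P1: "?F 1 2 3 = ?P" by (simp only: e_def m_def l(2))
    have P2: "?F 2 3 1 = ?P" unfolding P1[symmetric] by (rule fresnel_cyclic[symmetric])
    have P3: "?F 3 1 2 = ?P" unfolding P2[symmetric] by (rule fresnel_cyclic[symmetric])
    have "\<exists>g. act (const (l * l) * ?P) (E 1) = coef g"
      by (rule maxwell_scalar[OF eqs]) (unfold yop_square P1, blast)
    moreover have "\<exists>g. act (const (l * l) * ?P) (E 2) = coef g"
      by (rule maxwell_scalar[OF eqs(2,3,1) eqs(5,6,4)]) (unfold yop_square P2, blast)
    moreover have "\<exists>g. act (const (l * l) * ?P) (E 3) = coef g"
      by (rule maxwell_scalar[OF eqs(3,1,2) eqs(6,4,5)]) (unfold yop_square P3, blast)
    ultimately have "\<exists>g. act (const (l * l) * ?P) (E i) = coef g"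
      using exhaust_3[of i] by metis
    then show ?thesis using lP B(1) unfolding rellich_def by blast
  qed
  then obtain hE where hE: "\<And>i. E i = coef (hE i)" by metis
  have H: "\<exists>h. H i = coef h" if "\<And>n. m i * - (?y j (E k) n - ?y k (E j) n) - l * H i n = coef (g i) n" for i j k
  proof -
    have "H i n = coef (const (- 1 / l) * (g i + const (m i) * (yop j * hE k - yop k * hE j))) n" for n
    proof -
      have "l * H i n = - (coef (g i) n + m i * (?y j (E k) n - ?y k (E j) n))"
        unfolding that[symmetric] by (simp add: algebra_simps)
      then have "H i n = - 1 / l * (coef (g i) n + m i * (?y j (E k) n - ?y k (E j) n))"
        using l(1) by (simp add: field_simps)
      then show ?thesis by (simp only: coef_mult act_const lookup_add lookup_minus hE)
    qed
    then show ?thesis by blast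
  qed
  have "\<exists>h. H i = coef h" for i
    using exhaust_3[of i] H[OF eqs(4)] H[OF eqs(5)] H[OF eqs(6)] by metis
  then obtain hH where hH: "\<And>i. H i = coef (hH i)" by metis
  define S where "S = (\<Union>i\<in>UNIV. supp (hE i) \<union> supp (hH i))"
  have "finite S" by (simp add: S_def)
  then obtain K where K: "K > 0" "\<And>n. n \<in> S \<Longrightarrow> real_of_int (l1norm n) \<le> K"
    using l1norm_bound by blast
  have "u n = 0" if "real_of_int (l1norm n) > K" for n
  proof -
    have "n \<notin> S" using K(2) that by force
    then have "E i n = 0" "H i n = 0" for i
      unfolding hE hH by (auto simp: S_def in_keys_iff)
    then show ?thesis
      by (simp add: E_def H_def prod_eq_iff vec_eq_iff)
  qed
  then show "\<exists>R>0. \<forall>n. R < real_of_int (l1norm n) \<longrightarrow> u n = 0"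
    using K(1) by blast
qed

theorem theorem1p1:
  fixes \<epsilon> \<mu> :: "real^3" and lam :: real
  assumes "\<And>i. \<epsilon>$i > 0" and "\<And>i. \<mu>$i > 0"
    and "(beta \<epsilon> \<mu> \<in> B0 \<and> 0 < \<bar>lam\<bar> \<and> \<bar>lam\<bar> < lambda_plus \<epsilon> \<mu>) \<or>
         (beta \<epsilon> \<mu> \<in> B3 \<and> 0 < \<bar>lam\<bar> \<and> \<bar>lam\<bar> < lambda_plus \<epsilon> \<mu>) \<or>
         (beta \<epsilon> \<mu> \<in> B12 \<and> 0 < \<bar>lam\<bar> \<and> \<bar>lam\<bar> < lambda_minus \<epsilon> \<mu>)"
  shows "rellich_type (\<lambda>u n. HDhat \<epsilon> \<mu> u n - lam *\<^sub>R u n)"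
proof -
  define b where "b = beta \<epsilon> \<mu>"
  define a where "a = alpha \<epsilon> \<mu>"
  have lam: "lam \<noteq> 0" using assms(3) by auto
  have pos: "\<epsilon>$1 > 0" "\<epsilon>$2 > 0" "\<epsilon>$3 > 0" "\<mu>$1 > 0" "\<mu>$2 > 0" "\<mu>$3 > 0" "lam\<^sup>2 > 0"
    using assms(1,2) lam by simp_all
  have b: "b$1 = \<epsilon>$2 * \<mu>$3 - \<epsilon>$3 * \<mu>$2" "b$2 = \<epsilon>$3 * \<mu>$1 - \<epsilon>$1 * \<mu>$3" "b$3 = \<epsilon>$1 * \<mu>$2 - \<epsilon>$2 * \<mu>$1"
    by (simp_all add: b_def beta_def cross3_def)
  have a: "a$1 = (\<epsilon>$2 * \<mu>$3 + \<epsilon>$3 * \<mu>$2) / 2" "a$2 = (\<epsilon>$3 * \<mu>$1 + \<epsilon>$1 * \<mu>$3) / 2"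
    "a$3 = (\<epsilon>$1 * \<mu>$2 + \<epsilon>$2 * \<mu>$1) / 2"
    by (simp_all add: a_def alpha_def)
  have Psi: "Psi0 \<epsilon> \<mu> w = a$1 * w$1 + a$2 * w$2 + a$3 * w$3" for w
    by (simp add: Psi0_def sum_3 a_def)
  have K: "K0 \<epsilon> \<mu> w = 1/4 * ((b$1 * w$1)\<^sup>2 + (b$2 * w$2)\<^sup>2 + (b$3 * w$3)\<^sup>2) -
      1/2 * (b$1 * b$2 * w$1 * w$2 + b$1 * b$3 * w$1 * w$3 + b$2 * b$3 * w$2 * w$3)" for w
    by (simp add: K0_def Let_def sum_3 b_def)
  have sq_less: "lam\<^sup>2 < t" if "\<bar>lam\<bar> < sqrt t" for t
  proof -
    \<comment> \<open>\<open>sqrt\<close> takes negative values at negative arguments, so the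
      assumption forces \<open>t\<close> to be positive.\<close>
    have "t > 0" using that by (smt (verit) real_sqrt_le_0_iff)
    then show ?thesis using that by (metis power2_abs real_less_rsqrt real_sqrt_less_iff real_sqrt_abs)
  qed
  have degenerate: "rellich_type (\<lambda>u n. HDhat \<epsilon> \<mu> u n - lam *\<^sub>R u n)"
    if w: "w \<in> unit_cube" and tau: "lam\<^sup>2 < Psi0 \<epsilon> \<mu> w - sqrt (K0 \<epsilon> \<mu> w)"
      and g: "4 * g1\<^sup>2 = (b$1)\<^sup>2" "4 * g2\<^sup>2 = (b$2)\<^sup>2" "4 * g3\<^sup>2 = (b$3)\<^sup>2"
      "4 * (g1 * g2) = - (b$1 * b$2)" "4 * (g1 * g3) = - (b$1 * b$3)" "4 * (g2 * g3) = - (b$2 * b$3)"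
    for w and g1 g2 g3 :: real
  proof (rule rellich_type_if_rellich[OF lam], rule rellich_fresnel_degenerate[OF pos b a g])
    have "4 * K0 \<epsilon> \<mu> w = (b$1)\<^sup>2 * (w$1)\<^sup>2 + (b$2)\<^sup>2 * (w$2)\<^sup>2 + (b$3)\<^sup>2 * (w$3)\<^sup>2 +
        2 * (- (b$1 * b$2) * (w$1 * w$2) + - (b$1 * b$3) * (w$1 * w$3) + - (b$2 * b$3) * (w$2 * w$3))"
      unfolding K by (simp add: power_mult_distrib algebra_simps)
    also have "\<dots> = 4 * (g1 * w$1 + g2 * w$2 + g3 * w$3)\<^sup>2"
      unfolding g[symmetric] by (simp add: power2_eq_square algebra_simps)
    finally have "sqrt (K0 \<epsilon> \<mu> w) = \<bar>g1 * w$1 + g2 * w$2 + g3 * w$3\<bar>" by simp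
    then show "lam\<^sup>2 < a$1 * w$1 + a$2 * w$2 + a$3 * w$3 - \<bar>g1 * w$1 + g2 * w$2 + g3 * w$3\<bar>"
      using tau Psi by simp
  qed (use w in \<open>auto simp: unit_cube_def\<close>)
  have some_zero: "rellich_type (\<lambda>u n. HDhat \<epsilon> \<mu> u n - lam *\<^sub>R u n)"
    if w: "w \<in> unit_cube" and tau: "lam\<^sup>2 < Psi0 \<epsilon> \<mu> w - sqrt (K0 \<epsilon> \<mu> w)" and "b$1 * b$2 * b$3 = 0" for w
  proof -
    \<comment> \<open>When one component of \<open>b\<close> is zero, a single mixed product
      survives; halving \<open>b\<close> and flipping one sign gives that product the required
      sign.\<close>
    from that(3) consider "b$1 = 0" | "b$2 = 0" | "b$3 = 0" by auto
    then show ?thesis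
    proof cases
      case 1
      show ?thesis by (rule degenerate[OF w tau, of 0 "b$2 / 2" "- b$3 / 2"]) (simp_all add: 1 power2_eq_square)
    next
      case 2
      show ?thesis by (rule degenerate[OF w tau, of "b$1 / 2" 0 "- b$3 / 2"]) (simp_all add: 2 power2_eq_square)
    next
      case 3
      show ?thesis by (rule degenerate[OF w tau, of "b$1 / 2" "- b$2 / 2" 0]) (simp_all add: 3 power2_eq_square)
    qed
  qed
  from assms(3) consider "b = 0" "\<bar>lam\<bar> < lambda_plus \<epsilon> \<mu>"
    | "b$1 * b$2 * b$3 \<noteq> 0" "\<bar>lam\<bar> < lambda_plus \<epsilon> \<mu>"
    | "b$1 * b$2 * b$3 = 0" "\<bar>lam\<bar> < lambda_minus \<epsilon> \<mu>"
    by (auto simp: B0_def B3_def B12_def b_def)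
  then show ?thesis
  proof cases
    case 1
    obtain w where w: "w \<in> unit_cube" "lambda_plus \<epsilon> \<mu> = sqrt (tau_plus \<epsilon> \<mu> w)"
      using lambda_plus_max by metis
    \<comment> \<open>For \<open>b = 0\<close> the two sheets coincide, so the bound by
      \<open>tau_plus\<close> is also one by \<open>tau_minus\<close>.\<close>
    have "K0 \<epsilon> \<mu> w = 0" unfolding K 1(1) by simp
    moreover have "lam\<^sup>2 < tau_plus \<epsilon> \<mu> w" using 1(2) w(2) sq_less by simp
    ultimately have "lam\<^sup>2 < Psi0 \<epsilon> \<mu> w - sqrt (K0 \<epsilon> \<mu> w)" by (simp add: tau_plus_def)
    then show ?thesis using some_zero w(1) 1(1) by simp
  next
    case 3
    obtain w where w: "w \<in> unit_cube" "lambda_minus \<epsilon> \<mu> = sqrt (tau_minus \<epsilon> \<mu> w)"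
      using lambda_minus_max by metis
    have "lam\<^sup>2 < tau_minus \<epsilon> \<mu> w" using 3(2) w(2) sq_less by simp
    then show ?thesis using some_zero w(1) 3(1) by (simp add: tau_minus_def)
  next
    case 2
    obtain w where w: "w \<in> unit_cube" "lambda_plus \<epsilon> \<mu> = sqrt (tau_plus \<epsilon> \<mu> w)"
      using lambda_plus_max by metis
    have tau: "lam\<^sup>2 < tau_plus \<epsilon> \<mu> w" using 2(2) w(2) sq_less by simp
    \<comment> \<open>The maximiser may lie on the boundary of the cube; a small move towards the
      centre makes it interior and keeps \<open>tau_plus\<close> above \<open>lam^2\<close>.\<close>
    define c where "c = (\<lambda>t::real. (\<chi> i. (1 - t) * w$i + t / 2) :: real^3)"
    define f where "f = (\<lambda>t. tau_plus \<epsilon> \<mu> (c t))"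
    have "isCont f 0"
      unfolding f_def tau_plus_def Psi K c_def vec_lambda_beta by (intro continuous_intros) auto
    moreover have c0: "c 0 = w" by (simp add: c_def vec_eq_iff)
    then have "0 < f 0 - lam\<^sup>2" using tau by (simp add: f_def)
    ultimately obtain d where d: "d > 0" "\<And>t. dist t 0 < d \<Longrightarrow> dist (f t) (f 0) < f 0 - lam\<^sup>2"
      unfolding continuous_at_eps_delta by blast
    define t where "t = min (d / 2) (1 / 2)"
    have "dist t 0 < d" "0 < t" "t < 1" using d(1) by (auto simp: t_def dist_real_def)
    then have t: "lam\<^sup>2 < tau_plus \<epsilon> \<mu> (c t)" "0 < t" "t < 1"
      using d(2)[of t] unfolding f_def dist_real_def by linarith+
    have ct: "0 < c t $ i" "c t $ i < 1" for i
    proof -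
      have wi: "0 \<le> w$i" "w$i \<le> 1" using w(1) by (auto simp: unit_cube_def)
      have lo: "0 \<le> (1 - t) * w$i" using wi t by simp
      have hi: "(1 - t) * w$i \<le> 1 - t" using mult_left_le[of "w$i" "1 - t"] wi t by simp
      show "0 < c t $ i" unfolding c_def vec_lambda_beta using lo t(2) by linarith
      show "c t $ i < 1" unfolding c_def vec_lambda_beta using hi t(2) by linarith
    qed
    \<comment> \<open>\<open>tau_plus\<close> is homogeneous of degree one, so shrinking by this
      factor attains \<open>lam^2\<close> exactly without leaving the open cube.\<close>
    define s where "s = lam\<^sup>2 / tau_plus \<epsilon> \<mu> (c t)"
    have tpos: "tau_plus \<epsilon> \<mu> (c t) > 0" using t(1) pos(7) by linarith
    then have s: "0 < s" "s < 1" using t(1) lam by (simp_all add: s_def)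
    define z where "z = (\<chi> i. s * c t $ i)"
    have z: "0 < z$i" "z$i < 1" for i
      using ct[of i] s mult_strict_mono[of s 1 "c t $ i" 1] by (auto simp: z_def)
    have "K0 \<epsilon> \<mu> z = s\<^sup>2 * K0 \<epsilon> \<mu> (c t)" "Psi0 \<epsilon> \<mu> z = s * Psi0 \<epsilon> \<mu> (c t)"
      unfolding K Psi z_def by (simp_all add: power2_eq_square algebra_simps)
    then have "Psi0 \<epsilon> \<mu> z + sqrt (K0 \<epsilon> \<mu> z) = s * tau_plus \<epsilon> \<mu> (c t)"
      using s by (simp add: tau_plus_def real_sqrt_mult distrib_left)
    also have "\<dots> = lam\<^sup>2" using tpos by (simp add: s_def)
    finally have l: "lam\<^sup>2 = a$1 * z$1 + a$2 * z$2 + a$3 * z$3 + sqrt (K0 \<epsilon> \<mu> z)" by (simp add: Psi)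
    have bnz: "b$1 \<noteq> 0" "b$2 \<noteq> 0" "b$3 \<noteq> 0" using 2(1) by auto
    show ?thesis
      using fresnel_point[OF pos b bnz a z(1) z(1) z(1) K l] bnz[unfolded b]
      by (intro rellich_type_if_rellich[OF lam] rellich_fresnel[OF pos _ _ _ z z z]) auto
  qed
qed

end
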